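(* Let $\mathcal F:\mathcal R\to\mathbf{Top}^*$ be a resonance functor such that $\mathcal F(1^l)$ is contractible for all $l\ge2$. Let $\lambda=(\lambda_1,\dots,\lambda_n)$, $\lambda_1\le\dots\le\lambda_n$, be a sequential partition such that $I(\lambda)$ exists. (1) If $mm(\lambda)\ge2$, then $\mathcal F(\lambda)$ is contractible. (2) Suppose $mm(\lambda)=1$. Let $T=S_{(\lambda_1,\dots,\lambda_{n-1})}\in\mathcal R_{n-1}$, let $\nu\in P(n-1)$ be the partition whose only nonsingleton block is $I(\lambda)$, and let $\mu=(\lambda_{j_1},\dots,\lambda_{j_t})$, where $\{j_1,\dots,j_t\}=[n]\setminus I(\lambda)$. Then $\mathcal F(\lambda)\simeq\mathcal F(Q(T,\nu\downarrow T))\wedge\mathcal F(1)$, and there is the inclusion triple $$\mathcal F(\mu)\stackrel{i}{\hookrightarrow}\mathcal F(\lambda_1,\dots,\lambda_{n-1})\to\mathcal F(Q(T,\nu\downarrow T)),$$ i.e. $i$ is the inclusion $\mathcal F(\tilde\nu T\stackrel{\tilde\nu}{\hookrightarrow}T)$ for an ordering $\tilde\nu$ of $\nu$ (with $[\tilde\nu T]=\mu$), and $\mathcal F(Q(T,\nu\downarrow T))$ is, up to homotopy equivalence, the quotient of $\mathcal F(\lambda_1,\dots,\lambda_{n-1})$ by the image of $i$. If moreover $\lambda$ is strongly sequential, then $i$ is homotopic to a trivial map (mapping everything to a point), hence the triple splits and $$\mathcal F(\lambda)\simeq\big(\mathcal F(1)\wedge\mathcal F(\lambda_1,\dots,\lambda_{n-1})\big)\vee\mathrm{susp}\big(\mathcal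 F(1)\wedge\mathcal F(\mu)\big).$$
   Context: Sequential partitions. A number partition $\lambda=(\lambda_1,\dots,\lambda_n)$, $\lambda_1\le\dots\le\lambda_n$ (positive integers), is sequential if whenever $\sum_{i\in I}\lambda_i=\sum_{j\in J}\lambda_j$ with $I,J\subseteq[n]$ and $q\in I$ satisfies $q=\max(I\cup J)$, there is $\widetilde J\subseteq J$ with $\lambda_q=\sum_{j\in\widetilde J}\lambda_j$. Put $mm(\lambda)=|\{i\in[n]:\lambda_i=\lambda_n\}|$. $I(\lambda)\subseteq[n]$ is the lexicographically maximal set with $|I(\lambda)|\ge2$ and $\lambda_n=\sum_{i\in I(\lambda)}\lambda_i$ (it may fail to exist). Lexicographic convention: for $A=\{a_1\le\dots\le a_k\}$, $B=\{b_1\le\dots\le b_m\}$ in $[n]$, $A$ is larger than $B$ if $A\supseteq B$ or there is $0\le q<\min(k,m)$ with $a_k=b_m,\dots,a_{k-q+1}=b_{m-q+1}$ and $a_{k-q}>b_{m-q}$. A sequential $\lambda$ is strongly sequential if either $I(\lambda)$ does not exist, or, with $q=\max I(\lambda)$, there is $J\subseteq I(\lambda)\setminus\{q\}$ with $\lambda_q=\sum_{i\in J}\lambda_i$ ($|J|\ge 2$ is not required). Cuts and resonances. $[n]=\{1,\dots,n\}$. For $x\in\{-1,0,1\}^n$ put $\mathrm{Plus}(x)=\{i: x_i=1\}$, $\mathrm{Minus}(x)=\{i:x_i=-1\}$. A set $S\subseteq\{-1,0,1\}^n$ is an $n$-cut if $\mathrm{span}(S)\cap\{-1,0,1\}^n=S$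 (linear span in $\mathbb R^n$, so $0\in S$) and every nonzero $x\in S$ has $\mathrm{Plus}(x)\neq\emptyset$ and $\mathrm{Minus}(x)\ne\emptyset$. $\mathcal R_n$ is the set of $n$-cuts. The symmetric group on $n$ letters acts on $\mathcal R_n$ by permuting coordinates; the orbit $[S]$ is called an $n$-resonance. For a vector $\lambda=(\lambda_1,\dots,\lambda_n)$ of positive integers, $S_\lambda=\{x\in\{-1,0,1\}^n:\langle x,\lambda\rangle=0\}$ is an $n$-cut, and $\lambda$ also denotes the resonance $[S_\lambda]$, which does not depend on the order of the parts; exponents denote repeated parts. Partitions. $P(A)$, $OP(A)$ are the sets of set partitions, resp. ordered set partitions, of $A$ (nonempty blocks); $P(n)=P([n])$, $OP(n)=OP([n])$; $\mathrm{un}:OP(A)\to P(A)$ forgets the order. If $\pi=(\pi_1,\dots,\pi_k)\in OP(m)$ and $\nu=(\nu_1,\dots,\nu_m)\in OP(n)$, then $\pi\circ\nu\in OP(n)$ has blocks $\bigcup_{j\in\pi_i}\nu_j$, $i=1,\dots,k$. For disjoint $A,B$ and $\Pi\subseteq P(A)$, $\Lambda\subseteq P(B)$, $\Pi\times\Lambda$ is the set of $\pi\in P(A\cup B)$ whose restriction to $A$ lies in $\Pi$ and whose restriction to $B$ lies in $\Lambda$. For $S\in\mathcal R_n$ and $\pi=(\pi_1,\dots,\pi_m)\in OP(n)$, $\pi S\in\mathcal R_m$ is the set of $(t_1,\dots,t_m)\in\{-1,0,1\}^m$ for which there is $s\in S$ with $s_i=t_j$ for all $j\in[m]$, $i\in\pi_j$.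 Resonance category $\mathcal R$. Objects: all $n$-cuts, $n\ge1$. Morphisms from $S\in\mathcal R_m$ to $T\in\mathcal R_n$: triples $(S,T,\pi)$ with $\pi\in OP(n)$ having $m$ parts and $S\subseteq\pi T$. Composing $(S,T,\pi)$ with $(T,Q,\nu)$ gives $(S,Q,\pi\circ\nu)$. The morphism $(\pi T,T,\pi)$ is denoted $\pi T\stackrel{\pi}{\hookrightarrow}T$. Closure. Let $A(n)$ be the set of all collections of nonempty multisubsets of $[n]$; $P(n)\subseteq A(n)$. For $S\in\mathcal R_n$ and $\mathcal A\in A(n)$, $\mathcal A\Downarrow S\subseteq A(n)$ is the minimal set such that: (1) $\mathcal A\in\mathcal A\Downarrow S$; (2) if $\{B_1,B_2,\dots,B_m\}\in\mathcal A\Downarrow S$ then $\{B_1\cup B_2,B_3,\dots,B_m\}\in\mathcal A\Downarrow S$; (3) if $\{B_1,\dots,B_m\}\in\mathcal A\Downarrow S$ and $x\in S$ satisfies $\mathrm{Plus}(x)\subseteq B_1$, then $\{(B_1\setminus\mathrm{Plus}(x))\cup\mathrm{Minus}(x),B_2,\dots,B_m\}\in\mathcal A\Downarrow S$ (operations on multisets, with multiplicities). For $\pi\in P(n)$, $\pi\downarrow S=(\pi\Downarrow S)\cap P(n)$; for $\pi\in OP(n)$, $\pi\downarrow S$ means $\mathrm{un}(\pi)\downarrow S$. $\Pi\subseteq P(n)$ is $S$-closed if $\bigcup_{\pi\in\Pi}\pi\downarrow S=\Pi$. Relative cuts. $S\setminus\Pi$ is $S$ with all those $s$ removed for which the partition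 of $[n]$ whose only possibly nonsingleton blocks are $\mathrm{Minus}(s)$ and $\mathrm{Plus}(s)$ lies in $\Pi$. A relative $n$-cut is a pair $(S,\Pi)$, $S\subseteq\{-1,0,1\}^n$, $\Pi\subseteq P(n)$, with $\overline S\setminus\Pi=S$ and $\Pi$ being $\overline S$-closed, where $\overline S=\mathrm{span}(S)\cap\{-1,0,1\}^n$. For $S\in\mathcal R_n$ and $S$-closed $\Pi$, $Q(S,\Pi)$ denotes $(S\setminus\Pi,\Pi)$. Square brackets denote orbits under simultaneous permutation of the $n$ coordinates/elements (relative resonances). Product: for a relative $n$-cut $(S,\Pi)$ and a relative $m$-cut $(T,\Lambda)$, $(S,\Pi)\times(T,\Lambda)=(S\times T,(\Pi\times P(m))\cup(P(n)\times\Lambda))$, with the second index set identified with $\{n+1,\dots,n+m\}$. Resonance functors. $\mathbf{Top}^*$ is the category of pointed topological spaces. For a functor $\mathcal F:\mathcal R\to\mathbf{Top}^*$ put $\mathcal F(Q(S,\Pi))=\mathcal F(S)\big/\bigcup_{\mathrm{un}(\pi)\in\Pi}\mathrm{Im}\,\mathcal F(\pi S\stackrel{\pi}{\hookrightarrow}S)$, and $\mathcal F(S,\Pi)=\mathcal F(Q(\overline S,\Pi))$ for a relative cut. $\mathcal F$ is a resonance functor if: (A1) for $S\in\mathcal R_n$, $\pi\in OP(n)$, $\mathcal F(\pi S\stackrel{\pi}{\hookrightarrow}S)$ is an inclusion map and $\mathcal F(S)/\mathrm{Im}\,\mathcal F(\pi S\stackrel{\pi}{\hookrightarrow}S)\simeq\mathcal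 F(Q(S,\pi\downarrow S))$; (A2) $[Q(S,\Pi)]=[Q(T,\Lambda)]$ implies $\mathcal F(Q(S,\Pi))\simeq\mathcal F(Q(T,\Lambda))$; (A3) for relative cuts, $\mathcal F(S,\Pi)\wedge\mathcal F(T,\Lambda)\simeq\mathcal F((S,\Pi)\times(T,\Lambda))$. Here $\simeq$ is homotopy equivalence, $\wedge$ is the smash product and $\vee$ the wedge. For a vector $\lambda$ of positive integers $\mathcal F(\lambda)$ means $\mathcal F(S_\lambda)$. $\mathrm{susp}$ is suspension of pointed spaces.
   Formalization: "Inclusion map" in (A1) is read as an embedding with the pointed homotopy extension property (a cofibration), since (1) fails for bare embeddings, e.g. at λ=(1,1,2,2); "the triple splits" is expressed only through the null-homotopy of i and the final wedge formula. *)

theory Defs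
  imports
    "HOL-Analysis.Analysis"
    "HOL-Library.Multiset"
    "HOL-Library.Disjoint_Sets"
    "HOL-Combinatorics.Permutations"
begin

section \<open>Number partitions\<close>

text \<open>Vectors of positive integers are lists; indices run through \<open>{1..n}\<close>.\<close>

definition part :: "nat list \<Rightarrow> nat \<Rightarrow> nat" where
  "part l i = l ! (i - 1)"

definition number_partition :: "nat list \<Rightarrow> bool" where
  "number_partition l \<longleftrightarrow> l \<noteq> [] \<and> sorted l \<and> (\<forall>x\<in>set l. x > 0)"

definition sequential :: "nat list \<Rightarrow> bool" where
  "sequential l \<longleftrightarrow> number_partition l \<and>
    (\<forall>I J q. I \<subseteq> {1..length l} \<and> J \<subseteq> {1..length l} \<and>
       (\<Sum>i\<in>I. part l i) = (\<Sum>j\<in>J. part l j) \<and> q \<in> I \<and> q = Max (I \<union> J) \<longrightarrow>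
       (\<exists>J'\<subseteq>J. part l q = (\<Sum>j\<in>J'. part l j)))"

definition mm :: "nat list \<Rightarrow> nat" where
  "mm l = card {i \<in> {1..length l}. part l i = part l (length l)}"

definition lex_larger :: "nat set \<Rightarrow> nat set \<Rightarrow> bool" where
  "lex_larger A B \<longleftrightarrow> A \<supseteq> B \<or>
    (\<exists>q < min (card A) (card B).
       (\<forall>p<q. rev (sorted_list_of_set A) ! p = rev (sorted_list_of_set B) ! p) \<and>
       rev (sorted_list_of_set A) ! q > rev (sorted_list_of_set B) ! q)"

definition is_I_set :: "nat list \<Rightarrow> nat set \<Rightarrow> bool" where
  "is_I_set l A \<longleftrightarrow>
    (let cands = {I. I \<subseteq> {1..length l} \<and> card I \<ge> 2 \<and> part l (length l) = (\<Sum>i\<in>I. part l i)}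
     in A \<in> cands \<and> (\<forall>B\<in>cands. lex_larger A B))"

definition I_exists :: "nat list \<Rightarrow> bool" where
  "I_exists l \<longleftrightarrow> (\<exists>A. is_I_set l A)"

definition I_set :: "nat list \<Rightarrow> nat set" where
  "I_set l = (THE A. is_I_set l A)"

definition strongly_sequential :: "nat list \<Rightarrow> bool" where
  "strongly_sequential l \<longleftrightarrow> sequential l \<and>
    (\<not> I_exists l \<or>
     (let q = Max (I_set l) in \<exists>J \<subseteq> I_set l - {q}. part l q = (\<Sum>i\<in>J. part l i)))"


section \<open>Cuts\<close>

text \<open>A vector in \<open>{-1,0,1}\<close>-space of dimension \<open>n\<close> is a function that vanishes outside
  \<open>{1..n}\<close>. Since such a function does not determine \<open>n\<close>, an \<open>n\<close>-cut \<open>S\<close> regarded as an object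
  of the resonance category is the pair \<open>(n, S)\<close>.\<close>

type_synonym vect = "nat \<Rightarrow> int"
type_synonym cut = "nat \<times> vect set"

definition tern :: "nat \<Rightarrow> vect set" where
  "tern n = {x. (\<forall>i\<in>{1..n}. x i \<in> {-1, 0, 1}) \<and> (\<forall>i. i \<notin> {1..n} \<longrightarrow> x i = 0)}"

definition Plus :: "vect \<Rightarrow> nat set" where "Plus x = {i. x i = 1}"
definition Minus :: "vect \<Rightarrow> nat set" where "Minus x = {i. x i = -1}"

text \<open>The real linear span, written out because functions do not form a \<open>real_vector\<close>.\<close>

definition lin_span :: "vect set \<Rightarrow> (nat \<Rightarrow> real) set" where
  "lin_span S = {v. \<exists>A c. finite A \<and> A \<subseteq> S \<and> v = (\<lambda>i. \<Sum>s\<in>A. c s * real_of_int (s i))}"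

definition tspan :: "nat \<Rightarrow> vect set \<Rightarrow> vect set" where
  "tspan n S = {x \<in> tern n. (\<lambda>i. real_of_int (x i)) \<in> lin_span S}"

definition cuts :: "nat \<Rightarrow> vect set set" where
  "cuts n = {S. S \<subseteq> tern n \<and> tspan n S = S \<and>
     (\<forall>x\<in>S. x \<noteq> (\<lambda>_. 0) \<longrightarrow> Plus x \<noteq> {} \<and> Minus x \<noteq> {})}"

definition S_vec :: "nat list \<Rightarrow> vect set" where
  "S_vec l = {x \<in> tern (length l). (\<Sum>i=1..length l. x i * int (part l i)) = 0}"

definition cut_of :: "nat list \<Rightarrow> cut" where
  "cut_of l = (length l, S_vec l)"

definition perm_vects :: "(nat \<Rightarrow> nat) \<Rightarrow> vect set \<Rightarrow> vect set" where
  "perm_vects \<sigma> S = (\<lambda>x. x \<circ> inv \<sigma>) ` S"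

definition resonance :: "nat \<Rightarrow> vect set \<Rightarrow> vect set set" where
  "resonance n S = {perm_vects \<sigma> S | \<sigma>. \<sigma> permutes {1..n}}"


section \<open>Set partitions and closure\<close>

definition Pt :: "nat set \<Rightarrow> nat set set set" where
  "Pt A = {\<pi>. partition_on A \<pi>}"

text \<open>Ordered set partitions are lists of blocks, so that \<open>un\<close> is \<open>set\<close>.\<close>

definition OPt :: "nat set \<Rightarrow> nat set list set" where
  "OPt A = {\<pi>. distinct \<pi> \<and> partition_on A (set \<pi>)}"

definition op_comp :: "nat set list \<Rightarrow> nat set list \<Rightarrow> nat set list" where
  "op_comp \<pi> \<nu> = map (\<lambda>B. \<Union>j\<in>B. \<nu> ! (j - 1)) \<pi>"

definition merge :: "nat set list \<Rightarrow> vect set \<Rightarrow> vect set" where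
  "merge \<pi> S = {t \<in> tern (length \<pi>).
     \<exists>s\<in>S. \<forall>j\<in>{1..length \<pi>}. \<forall>i\<in>\<pi> ! (j - 1). s i = t j}"

text \<open>Collections of multisubsets may contain a multisubset several times, so they are multisets
  of multisets; unions of multisubsets add multiplicities.\<close>

definition coll_of :: "nat set set \<Rightarrow> nat multiset multiset" where
  "coll_of \<pi> = image_mset mset_set (mset_set \<pi>)"

inductive_set Down :: "nat multiset multiset \<Rightarrow> vect set \<Rightarrow> nat multiset multiset set"
  for A :: "nat multiset multiset" and S :: "vect set" where
  start: "A \<in> Down A S"
| join: "add_mset B1 (add_mset B2 C) \<in> Down A S \<Longrightarrow> add_mset (B1 + B2) C \<in> Down A S"
| exch: "add_mset B C \<in> Down A S \<Longrightarrow> x \<in> S \<Longrightarrow> mset_set (Plus x) \<subseteq># B \<Longrightarrow>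
    add_mset ((B - mset_set (Plus x)) + mset_set (Minus x)) C \<in> Down A S"

definition down :: "nat \<Rightarrow> nat set set \<Rightarrow> vect set \<Rightarrow> nat set set set" where
  "down n \<pi> S = {\<rho> \<in> Pt {1..n}. coll_of \<rho> \<in> Down (coll_of \<pi>) S}"

definition closed_parts :: "nat \<Rightarrow> vect set \<Rightarrow> nat set set set \<Rightarrow> bool" where
  "closed_parts n S \<Gamma> \<longleftrightarrow> \<Gamma> \<subseteq> Pt {1..n} \<and> (\<Union>\<pi>\<in>\<Gamma>. down n \<pi> S) = \<Gamma>"


section \<open>Relative cuts\<close>

definition vect_partition :: "nat \<Rightarrow> vect \<Rightarrow> nat set set" where
  "vect_partition n s = ({Plus s, Minus s} - {{}}) \<union> {{i} | i. i \<in> {1..n} \<and> s i = 0}"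

definition rel_minus :: "nat \<Rightarrow> vect set \<Rightarrow> nat set set set \<Rightarrow> vect set" where
  "rel_minus n S \<Gamma> = {s \<in> S. vect_partition n s \<notin> \<Gamma>}"

type_synonym relcut = "vect set \<times> nat set set set"

text \<open>Being closed with respect to \<open>tspan n S\<close> only makes sense if \<open>tspan n S\<close> is an \<open>n\<close>-cut.\<close>

definition relative_cut :: "nat \<Rightarrow> relcut \<Rightarrow> bool" where
  "relative_cut n R \<longleftrightarrow> (case R of (S, \<Gamma>) \<Rightarrow>
     S \<subseteq> tern n \<and> \<Gamma> \<subseteq> Pt {1..n} \<and> tspan n S \<in> cuts n \<and>
     rel_minus n (tspan n S) \<Gamma> = S \<and> closed_parts n (tspan n S) \<Gamma>)"

definition Q :: "nat \<Rightarrow> vect set \<Rightarrow> nat set set set \<Rightarrow> relcut" where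
  "Q n S \<Gamma> = (rel_minus n S \<Gamma>, \<Gamma>)"

definition rel_resonance :: "nat \<Rightarrow> relcut \<Rightarrow> relcut set" where
  "rel_resonance n R = {(perm_vects \<sigma> (fst R), (\<lambda>\<pi>. (\<lambda>B. \<sigma> ` B) ` \<pi>) ` snd R) | \<sigma>.
     \<sigma> permutes {1..n}}"

definition restrict_part :: "nat set \<Rightarrow> nat set set \<Rightarrow> nat set set" where
  "restrict_part A \<pi> = (\<lambda>B. B \<inter> A) ` \<pi> - {{}}"

definition parts_times ::
    "nat set \<Rightarrow> nat set \<Rightarrow> nat set set set \<Rightarrow> nat set set set \<Rightarrow> nat set set set" where
  "parts_times A B \<Gamma> \<Lambda> =
     {\<pi> \<in> Pt (A \<union> B). restrict_part A \<pi> \<in> \<Gamma> \<and> restrict_part B \<pi> \<in> \<Lambda>}"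

definition vects_times :: "nat \<Rightarrow> vect set \<Rightarrow> vect set \<Rightarrow> vect set" where
  "vects_times n S T = {(\<lambda>i. if i \<le> n then s i else t (i - n)) | s t. s \<in> S \<and> t \<in> T}"

definition shift_parts :: "nat \<Rightarrow> nat set set set \<Rightarrow> nat set set set" where
  "shift_parts n \<Lambda> = (\<lambda>\<pi>. (\<lambda>B. (\<lambda>i. n + i) ` B) ` \<pi>) ` \<Lambda>"

definition rel_times :: "nat \<Rightarrow> nat \<Rightarrow> relcut \<Rightarrow> relcut \<Rightarrow> relcut" where
  "rel_times n m R R' = (case R of (S, \<Gamma>) \<Rightarrow> case R' of (T, \<Lambda>) \<Rightarrow>
     (vects_times n S T,
      parts_times {1..n} {n+1..n+m} \<Gamma> (Pt {n+1..n+m}) \<union>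
      parts_times {1..n} {n+1..n+m} (Pt {1..n}) (shift_parts n \<Lambda>)))"


section \<open>Pointed topological spaces\<close>

type_synonym 'a pspace = "'a topology \<times> 'a"

definition pspace :: "'a pspace \<Rightarrow> bool" where
  "pspace X \<longleftrightarrow> snd X \<in> topspace (fst X)"

definition pmap :: "'a pspace \<Rightarrow> 'b pspace \<Rightarrow> ('a \<Rightarrow> 'b) \<Rightarrow> bool" where
  "pmap X Y f \<longleftrightarrow> continuous_map (fst X) (fst Y) f \<and> f (snd X) = snd Y"

definition phomotopic :: "'a pspace \<Rightarrow> 'b pspace \<Rightarrow> ('a \<Rightarrow> 'b) \<Rightarrow> ('a \<Rightarrow> 'b) \<Rightarrow> bool" where
  "phomotopic X Y f g \<longleftrightarrow> homotopic_with (\<lambda>h. h (snd X) = snd Y) (fst X) (fst Y) f g"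

definition phomotopy_equivalent :: "'a pspace \<Rightarrow> 'b pspace \<Rightarrow> bool"  (infix "\<simeq>\<^sub>*" 50) where
  "X \<simeq>\<^sub>* Y \<longleftrightarrow> (\<exists>f g. pmap X Y f \<and> pmap Y X g \<and>
     phomotopic X X (g \<circ> f) id \<and> phomotopic Y Y (f \<circ> g) id)"

definition pnull :: "'a pspace \<Rightarrow> 'b pspace \<Rightarrow> ('a \<Rightarrow> 'b) \<Rightarrow> bool" where
  "pnull X Y f \<longleftrightarrow> phomotopic X Y f (\<lambda>_. snd Y)"

definition pcontractible :: "'a pspace \<Rightarrow> bool" where
  "pcontractible X \<longleftrightarrow> X \<simeq>\<^sub>* (discrete_topology {()}, ())"

definition quot_topology :: "'a topology \<Rightarrow> ('a \<Rightarrow> 'b) \<Rightarrow> 'b topology" where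
  "quot_topology X f =
     topology (\<lambda>U. U \<subseteq> f ` topspace X \<and> openin X {x \<in> topspace X. f x \<in> U})"

lemma istopology_quot:
  "istopology (\<lambda>U. U \<subseteq> f ` topspace X \<and> openin X {x \<in> topspace X. f x \<in> U})"
proof -
  have *: "{x \<in> topspace X. f x \<in> U \<inter> V} =
      {x \<in> topspace X. f x \<in> U} \<inter> {x \<in> topspace X. f x \<in> V}" for U V by blast
  have **: "{x \<in> topspace X. f x \<in> \<Union>K} = \<Union>((\<lambda>U. {x \<in> topspace X. f x \<in> U}) ` K)" for K by blast
  show ?thesis
    unfolding istopology_def
  proof (intro conjI allI impI)
    fix U V assume "U \<subseteq> f ` topspace X \<and> openin X {x \<in> topspace X. f x \<in> U}"
      and "V \<subseteq> f ` topspace X \<and> openin X {x \<in> topspace X. f x \<in> V}"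
    then show "U \<inter> V \<subseteq> f ` topspace X" "openin X {x \<in> topspace X. f x \<in> U \<inter> V}"
      unfolding * by (blast, simp add: openin_Int)
  next
    fix K assume K: "\<forall>U\<in>K. U \<subseteq> f ` topspace X \<and> openin X {x \<in> topspace X. f x \<in> U}"
    then show "\<Union>K \<subseteq> f ` topspace X" by (simp add: Sup_le_iff)
    show "openin X {x \<in> topspace X. f x \<in> \<Union>K}"
      unfolding ** by (rule openin_Union) (use K in auto)
  qed
qed

lemma openin_quot_topology:
  "openin (quot_topology X f) U \<longleftrightarrow>
     U \<subseteq> f ` topspace X \<and> openin X {x \<in> topspace X. f x \<in> U}"
  by (simp only: quot_topology_def topology_inverse'[OF istopology_quot])

lemma topspace_quot_topology: "topspace (quot_topology X f) = f ` topspace X"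
proof
  show "topspace (quot_topology X f) \<subseteq> f ` topspace X"
    using openin_quot_topology[of X f "topspace (quot_topology X f)"] openin_topspace by simp
  have "{x \<in> topspace X. f x \<in> f ` topspace X} = topspace X" by blast
  then have "openin (quot_topology X f) (f ` topspace X)"
    by (simp add: openin_quot_topology)
  then show "f ` topspace X \<subseteq> topspace (quot_topology X f)"
    by (rule openin_subset)
qed

lemma quotient_map_quot_topology: "quotient_map X (quot_topology X f) f"
  by (simp add: quotient_map_def openin_quot_topology topspace_quot_topology)

text \<open>\<open>X / A\<close> with the base point as the collapsed point, on the underlying set
  \<open>(X - A) \<union> {base point}\<close>. In particular the quotient by the empty set is \<open>X\<close>.\<close>

definition pquot :: "'a pspace \<Rightarrow> 'a set \<Rightarrow> 'a pspace" where
  "pquot X A = (quot_topology (fst X) (\<lambda>x. if x \<in> A then snd X else x), snd X)"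

definition axes :: "'a pspace \<Rightarrow> 'b pspace \<Rightarrow> ('a \<times> 'b) set" where
  "axes X Y = topspace (fst X) \<times> {snd Y} \<union> {snd X} \<times> topspace (fst Y)"

definition smash :: "'a pspace \<Rightarrow> 'b pspace \<Rightarrow> ('a \<times> 'b) pspace" where
  "smash X Y = pquot (prod_topology (fst X) (fst Y), (snd X, snd Y)) (axes X Y)"

definition wedge :: "'a pspace \<Rightarrow> 'b pspace \<Rightarrow> ('a \<times> 'b) pspace" where
  "wedge X Y = (subtopology (prod_topology (fst X) (fst Y)) (axes X Y), (snd X, snd Y))"

text \<open>Reduced suspension.\<close>

definition susp :: "'a pspace \<Rightarrow> (real \<times> 'a) pspace" where
  "susp X = pquot (prod_topology (top_of_set {0..1::real}) (fst X), (0, snd X))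
     ({0, 1} \<times> topspace (fst X) \<union> {0..1} \<times> {snd X})"

text \<open>The homotopy extension property in pointed spaces. Test spaces on the type \<open>real \<times> 'b\<close>
  suffice for injective \<open>i\<close>: the reduced mapping cylinder of \<open>i\<close>, which is the universal test
  space, lives there.\<close>

definition pointed_HEP :: "'a pspace \<Rightarrow> 'b pspace \<Rightarrow> ('a \<Rightarrow> 'b) \<Rightarrow> bool" where
  "pointed_HEP A X i \<longleftrightarrow>
    (\<forall>(Z :: (real \<times> 'b) pspace) g h.
       pspace Z \<and> pmap X Z g \<and>
       continuous_map (prod_topology (top_of_set {0..1::real}) (fst A)) (fst Z) h \<and>
       (\<forall>a\<in>topspace (fst A). h (0, a) = g (i a)) \<and>
       (\<forall>t\<in>{0..1}. h (t, snd A) = snd Z) \<longrightarrow>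
       (\<exists>H. continuous_map (prod_topology (top_of_set {0..1::real}) (fst X)) (fst Z) H \<and>
          (\<forall>x\<in>topspace (fst X). H (0, x) = g x) \<and>
          (\<forall>t\<in>{0..1}. \<forall>a\<in>topspace (fst A). H (t, i a) = h (t, a))))"

text \<open>Inclusion maps of pointed spaces are understood as cofibrations. For bare embeddings
  collapsing a contractible subspace can change the homotopy type, and a quotient by a
  null-homotopic inclusion need not split.\<close>

definition inclusion_map :: "'a pspace \<Rightarrow> 'b pspace \<Rightarrow> ('a \<Rightarrow> 'b) \<Rightarrow> bool" where
  "inclusion_map A X i \<longleftrightarrow>
     pmap A X i \<and> embedding_map (fst A) (fst X) i \<and> pointed_HEP A X i"


section \<open>Resonance functors\<close>

definition morph :: "cut \<Rightarrow> cut \<Rightarrow> nat set list \<Rightarrow> bool" where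
  "morph S T \<pi> \<longleftrightarrow> fst S \<ge> 1 \<and> fst T \<ge> 1 \<and> snd S \<in> cuts (fst S) \<and> snd T \<in> cuts (fst T) \<and>
     \<pi> \<in> OPt {1..fst T} \<and> length \<pi> = fst S \<and> snd S \<subseteq> merge \<pi> (snd T)"

definition pfunctor :: "(cut \<Rightarrow> 'a pspace) \<Rightarrow> (cut \<Rightarrow> cut \<Rightarrow> nat set list \<Rightarrow> 'a \<Rightarrow> 'a) \<Rightarrow> bool"
where
  "pfunctor F M \<longleftrightarrow>
    (\<forall>n S. n \<ge> 1 \<and> S \<in> cuts n \<longrightarrow> pspace (F (n, S))) \<and>
    (\<forall>S T \<pi>. morph S T \<pi> \<longrightarrow> pmap (F S) (F T) (M S T \<pi>)) \<and>
    (\<forall>n S. n \<ge> 1 \<and> S \<in> cuts n \<longrightarrow>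
       (\<forall>x\<in>topspace (fst (F (n, S))). M (n, S) (n, S) (map (\<lambda>i. {i}) [1..<n+1]) x = x)) \<and>
    (\<forall>S T U \<pi> \<nu>. morph S T \<pi> \<and> morph T U \<nu> \<longrightarrow>
       (\<forall>x\<in>topspace (fst (F S)). M S U (op_comp \<pi> \<nu>) x = M T U \<nu> (M S T \<pi> x)))"

text \<open>The morphism \<open>\<pi>S \<hookrightarrow> S\<close> under the functor, and its image.\<close>

definition merge_cut :: "nat set list \<Rightarrow> vect set \<Rightarrow> cut" where
  "merge_cut \<pi> S = (length \<pi>, merge \<pi> S)"

definition incl :: "(cut \<Rightarrow> cut \<Rightarrow> nat set list \<Rightarrow> 'a \<Rightarrow> 'a) \<Rightarrow> nat \<Rightarrow> vect set \<Rightarrow> nat set list \<Rightarrow> 'a \<Rightarrow> 'a"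
where
  "incl M n S \<pi> = M (merge_cut \<pi> S) (n, S) \<pi>"

definition incl_im :: "(cut \<Rightarrow> 'a pspace) \<Rightarrow> (cut \<Rightarrow> cut \<Rightarrow> nat set list \<Rightarrow> 'a \<Rightarrow> 'a) \<Rightarrow>
    nat \<Rightarrow> vect set \<Rightarrow> nat set list \<Rightarrow> 'a set" where
  "incl_im F M n S \<pi> = incl M n S \<pi> ` topspace (fst (F (merge_cut \<pi> S)))"

text \<open>\<open>FQ F M n S \<Gamma>\<close> is the space assigned to \<open>Q n S \<Gamma>\<close>; it is defined through \<open>S\<close>, which
  \<open>Q n S \<Gamma>\<close> need not determine. \<open>Frel\<close> is the value at a relative cut.\<close>

definition FQ :: "(cut \<Rightarrow> 'a pspace) \<Rightarrow> (cut \<Rightarrow> cut \<Rightarrow> nat set list \<Rightarrow> 'a \<Rightarrow> 'a) \<Rightarrow>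
    nat \<Rightarrow> vect set \<Rightarrow> nat set set set \<Rightarrow> 'a pspace" where
  "FQ F M n S \<Gamma> =
     pquot (F (n, S)) (\<Union>\<pi>\<in>{\<pi> \<in> OPt {1..n}. set \<pi> \<in> \<Gamma>}. incl_im F M n S \<pi>)"

definition Frel :: "(cut \<Rightarrow> 'a pspace) \<Rightarrow> (cut \<Rightarrow> cut \<Rightarrow> nat set list \<Rightarrow> 'a \<Rightarrow> 'a) \<Rightarrow>
    nat \<Rightarrow> relcut \<Rightarrow> 'a pspace" where
  "Frel F M n R = FQ F M n (tspan n (fst R)) (snd R)"

definition axiom_A1 where
  "axiom_A1 F M \<longleftrightarrow> (\<forall>n S \<pi>. n \<ge> 1 \<and> S \<in> cuts n \<and> \<pi> \<in> OPt {1..n} \<longrightarrow>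
     inclusion_map (F (merge_cut \<pi> S)) (F (n, S)) (incl M n S \<pi>) \<and>
     pquot (F (n, S)) (incl_im F M n S \<pi>) \<simeq>\<^sub>* FQ F M n S (down n (set \<pi>) S))"

definition axiom_A2 where
  "axiom_A2 F M \<longleftrightarrow> (\<forall>n S T \<Gamma> \<Lambda>. n \<ge> 1 \<and> S \<in> cuts n \<and> T \<in> cuts n \<and>
     closed_parts n S \<Gamma> \<and> closed_parts n T \<Lambda> \<and>
     rel_resonance n (Q n S \<Gamma>) = rel_resonance n (Q n T \<Lambda>) \<longrightarrow>
     FQ F M n S \<Gamma> \<simeq>\<^sub>* FQ F M n T \<Lambda>)"

definition axiom_A3 where
  "axiom_A3 F M \<longleftrightarrow> (\<forall>n m R R'. n \<ge> 1 \<and> m \<ge> 1 \<and> relative_cut n R \<and> relative_cut m R' \<longrightarrow>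
     smash (Frel F M n R) (Frel F M m R') \<simeq>\<^sub>* Frel F M (n + m) (rel_times n m R R'))"

definition resonance_functor ::
    "(cut \<Rightarrow> 'a pspace) \<Rightarrow> (cut \<Rightarrow> cut \<Rightarrow> nat set list \<Rightarrow> 'a \<Rightarrow> 'a) \<Rightarrow> bool" where
  "resonance_functor F M \<longleftrightarrow> pfunctor F M \<and> axiom_A1 F M \<and> axiom_A2 F M \<and> axiom_A3 F M"

definition one_block :: "nat \<Rightarrow> nat set \<Rightarrow> nat set set" where
  "one_block n A = insert A {{i} | i. i \<in> {1..n} - A}"

end

theory Submission
  imports Defs
begin

text \<open>Closures with respect to \<open>S\<^sub>\<lambda>\<close> are governed by weights, and sequentiality makes
  the relations that are left after collapsing the partition with block \<open>I(\<lambda>)\<close> split as relations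
  among the parts smaller than \<open>\<lambda>\<^sub>n\<close> times relations among the copies of
  \<open>\<lambda>\<^sub>n\<close>. So the collapsed space is a smash product with \<open>F(1\<^sup>m)\<close>, where
  \<open>m = mm(\<lambda>)\<close>. Collapsing does not change the homotopy type of \<open>F(\<lambda>)\<close>: the
  collapsed subspace belongs to a partition with one more copy of the largest part, and such spaces are contractible
  by induction. If \<open>\<lambda>\<close> is strongly sequential, the inclusion \<open>i\<close> factors through the
  space of the partition in which \<open>J\<close> is merged to a second copy of \<open>\<lambda>\<^sub>q\<close>;
  this space is contractible because no part larger than \<open>\<lambda>\<^sub>q\<close> other than
  \<open>\<lambda>\<^sub>n\<close> is a sum that involves parts of \<open>I(\<lambda>)\<close>.\<close>

section \<open>Pointed homotopy\<close>

text \<open>The induction trades parts for multiplicity: merging a set of weight c replaces at least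
  two small parts by one more copy of the largest part c, so a multiplicity 1 becomes 2 and the
  assumption on F(1^k) applies to a smash factor. Since merging disturbs the order of the indices,
  sequentiality is carried along as a property of multisets. The product axiom applies only if the
  collapsed family consists of exactly those partitions whose restriction to the small indices lies
  in a closure there. The hard inclusion is a pigeonhole argument: k + 1 blocks of weight c are
  distributed among blocks that contain only k indices of weight c, so some block must make up the
  deficit with small parts, and sequentiality extracts a subset of weight exactly c. The vectors
  that survive a collapse may span a smaller cut than the original one. Hence closedness is proved
  for all subsets of the cut, and axiom A2 moves between the two cuts.\<close>

abbreviation cyl :: "'a topology \<Rightarrow> (real \<times> 'a) topology" where
  "cyl X \<equiv> prod_topology (top_of_set {0..1::real}) X"

text \<open>The unit interval is compact Hausdorff, so multiplying a quotient map by it gives a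
  quotient map again. This is what lets homotopies descend to quotients, smash products, suspensions
  and cones.\<close>

lemma quotient_map_cyl:
  assumes "quotient_map X Y f"
  shows "quotient_map (cyl X) (cyl Y) (\<lambda>(t, x). (t, f x))"
proof (rule quotient_map_prod_right[OF _ _ assms])
  show "locally_compact_space (top_of_set {0..1::real})"
    by (rule compact_imp_locally_compact_space) (simp add: compact_space_subtopology)
  show "Hausdorff_space (top_of_set {0..1::real}) \<or> regular_space (top_of_set {0..1::real})"
    by (simp add: Hausdorff_space_subtopology)
qed

lemma continuous_map_cyl_snd:
  assumes "continuous_map (cyl X) Z (\<lambda>p. g (snd p))"
  shows "continuous_map X Z g"
  using continuous_map_o_Pair[OF assms, of 0] by (simp add: o_def)

lemma phomotopicI:
  assumes "pspace X" "continuous_map (cyl (fst X)) (fst Y) H"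
    and "\<And>x. x \<in> topspace (fst X) \<Longrightarrow> H (0, x) = f x"
    and "\<And>x. x \<in> topspace (fst X) \<Longrightarrow> H (1, x) = g x"
    and "\<And>t. t \<in> {0..1} \<Longrightarrow> H (t, snd X) = snd Y"
  shows "phomotopic X Y f g"
  unfolding phomotopic_def
  by (subst homotopic_with) (use assms in \<open>auto simp: pspace_def\<close>)

lemma phomotopicE:
  assumes "phomotopic X Y f g"
  obtains H where "continuous_map (cyl (fst X)) (fst Y) H" "\<And>x. H (0, x) = f x"
    "\<And>x. H (1, x) = g x" "\<And>t. t \<in> {0..1} \<Longrightarrow> H (t, snd X) = snd Y"
  using assms unfolding phomotopic_def homotopic_with_def by auto

lemma pequivI:
  assumes "pspace X" "pspace Y" "pmap X Y f" "pmap Y X g"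
    and "continuous_map (cyl (fst X)) (fst X) H"
    and "\<And>x. x \<in> topspace (fst X) \<Longrightarrow> H (0, x) = g (f x)"
    and "\<And>x. x \<in> topspace (fst X) \<Longrightarrow> H (1, x) = x"
    and "\<And>t. t \<in> {0..1} \<Longrightarrow> H (t, snd X) = snd X"
    and "continuous_map (cyl (fst Y)) (fst Y) K"
    and "\<And>x. x \<in> topspace (fst Y) \<Longrightarrow> K (0, x) = f (g x)"
    and "\<And>x. x \<in> topspace (fst Y) \<Longrightarrow> K (1, x) = x"
    and "\<And>t. t \<in> {0..1} \<Longrightarrow> K (t, snd Y) = snd Y"
  shows "X \<simeq>\<^sub>* Y"
  unfolding phomotopy_equivalent_def
  using assms by (intro exI[of _ f] exI[of _ g] conjI phomotopicI[where H=H] phomotopicI[where H=K]) auto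

lemma phomeo_imp_pequiv:
  assumes "pspace X" "pspace Y" "pmap X Y f" "pmap Y X g"
    and "\<And>x. x \<in> topspace (fst X) \<Longrightarrow> g (f x) = x"
    and "\<And>x. x \<in> topspace (fst Y) \<Longrightarrow> f (g x) = x"
  shows "X \<simeq>\<^sub>* Y"
  using assms
  by (intro pequivI[where f=f and g=g and H=snd and K=snd])
     (auto intro!: continuous_intros simp: pmap_def)

lemma pequiv_sym: "X \<simeq>\<^sub>* Y \<Longrightarrow> Y \<simeq>\<^sub>* X"
  unfolding phomotopy_equivalent_def by blast

lemma phomotopic_trans: "phomotopic X Y f g \<Longrightarrow> phomotopic X Y g h \<Longrightarrow> phomotopic X Y f h"
  unfolding phomotopic_def by (rule homotopic_with_trans)

lemma phomotopic_sandwich: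
  assumes "phomotopic Y Y u v" "pmap X Y f" "pmap Y Z g"
  shows "phomotopic X Z (g \<circ> u \<circ> f) (g \<circ> v \<circ> f)"
proof -
  have "homotopic_with (\<lambda>h. h (snd X) = snd Y) (fst X) (fst Y) (u \<circ> f) (v \<circ> f)"
    using assms unfolding phomotopic_def pmap_def
    by (intro homotopic_with_compose_continuous_map_right) auto
  then have "homotopic_with (\<lambda>h. h (snd X) = snd Z) (fst X) (fst Z) (g \<circ> (u \<circ> f)) (g \<circ> (v \<circ> f))"
    using assms unfolding pmap_def
    by (intro homotopic_with_compose_continuous_map_left[where p="\<lambda>h. h (snd X) = snd Y"]) auto
  then show ?thesis
    by (simp add: phomotopic_def o_assoc)
qed

lemma pmap_compose: "pmap X Y f \<Longrightarrow> pmap Y Z g \<Longrightarrow> pmap X Z (g \<circ> f)"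
  unfolding pmap_def by (auto intro: continuous_map_compose)

lemma pequiv_trans:
  assumes "X \<simeq>\<^sub>* Y" "Y \<simeq>\<^sub>* Z"
  shows "X \<simeq>\<^sub>* Z"
proof -
  obtain f g where f: "pmap X Y f" "pmap Y X g" "phomotopic X X (g \<circ> f) id" "phomotopic Y Y (f \<circ> g) id"
    using assms(1) unfolding phomotopy_equivalent_def by blast
  obtain h k where h: "pmap Y Z h" "pmap Z Y k" "phomotopic Y Y (k \<circ> h) id" "phomotopic Z Z (h \<circ> k) id"
    using assms(2) unfolding phomotopy_equivalent_def by blast
  have "phomotopic X X (g \<circ> (k \<circ> h) \<circ> f) (g \<circ> id \<circ> f)"
    by (rule phomotopic_sandwich[OF h(3) f(1,2)])
  then have 1: "phomotopic X X ((g \<circ> k) \<circ> (h \<circ> f)) id"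
    using phomotopic_trans f(3) by (simp add: o_assoc) blast
  have "phomotopic Z Z (h \<circ> (f \<circ> g) \<circ> k) (h \<circ> id \<circ> k)"
    by (rule phomotopic_sandwich[OF f(4) h(2,1)])
  then have 2: "phomotopic Z Z ((h \<circ> f) \<circ> (g \<circ> k)) id"
    using phomotopic_trans h(4) by (simp add: o_assoc) blast
  show ?thesis
    unfolding phomotopy_equivalent_def
    using 1 2 pmap_compose[OF f(1) h(1)] pmap_compose[OF h(2) f(2)] by blast
qed

lemma pcontractible_pequiv: "X \<simeq>\<^sub>* Y \<Longrightarrow> pcontractible Y \<Longrightarrow> pcontractible X"
  unfolding pcontractible_def by (rule pequiv_trans)

lemma pcontractible_imp_phomotopic:
  assumes "pcontractible X"
  shows "phomotopic X X (\<lambda>x. x) (\<lambda>_. snd X)"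
proof -
  obtain f g where "pmap (discrete_topology {()}, ()) X g" "phomotopic X X (g \<circ> f) id"
    using assms unfolding pcontractible_def phomotopy_equivalent_def by blast
  then have "g \<circ> f = (\<lambda>_. snd X)" "phomotopic X X (g \<circ> f) (\<lambda>x. x)"
    by (auto simp: pmap_def id_def)
  then show ?thesis
    unfolding phomotopic_def using homotopic_with_sym by metis
qed

lemma phomotopic_imp_pcontractible:
  assumes "pspace X" "phomotopic X X (\<lambda>x. x) (\<lambda>_. snd X)"
  shows "pcontractible X"
proof -
  have "phomotopic X X (\<lambda>_. snd X) (\<lambda>x. x)"
    using assms(2) unfolding phomotopic_def using homotopic_with_sym by metis
  then obtain H where H: "continuous_map (cyl (fst X)) (fst X) H" "\<And>x. H (0, x) = snd X"
    "\<And>x. H (1, x) = x" "\<And>t. t \<in> {0..1} \<Longrightarrow> H (t, snd X) = snd X"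
    by (rule phomotopicE) auto
  show ?thesis
    unfolding pcontractible_def
    by (rule pequivI[where f="\<lambda>_. ()" and g="\<lambda>_. snd X" and H=H and K="\<lambda>_. ()"])
       (use H assms(1) in \<open>auto simp: pmap_def pspace_def\<close>)
qed

text \<open>The null homotopy is the contraction of \<open>Y\<close> transported along
  \<open>f\<close> and \<open>g\<close>. \<open>k\<close> is compared with the composite pointwise
  on the carrier, which is the form in which functoriality of \<open>M\<close> is available.\<close>

lemma pnull_factor:
  assumes "pcontractible Y" "pmap X Y f" "pmap Y Z g" "pspace X"
    and "\<And>x. x \<in> topspace (fst X) \<Longrightarrow> g (f x) = k x"
  shows "pnull X Z k"
proof -
  obtain H where H: "continuous_map (cyl (fst Y)) (fst Y) H" "\<And>x. H (0, x) = x"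
    "\<And>x. H (1, x) = snd Y" "\<And>t. t \<in> {0..1} \<Longrightarrow> H (t, snd Y) = snd Y"
    using pcontractible_imp_phomotopic[OF assms(1)] by (rule phomotopicE) auto
  have f: "continuous_map (fst X) (fst Y) f" "f (snd X) = snd Y"
    and g: "continuous_map (fst Y) (fst Z) g" "g (snd Y) = snd Z"
    using assms by (auto simp: pmap_def)
  have "continuous_map (cyl (fst X)) (cyl (fst Y)) (\<lambda>p. (fst p, f (snd p)))"
    by (intro continuous_map_pairedI continuous_map_fst
        continuous_map_compose[OF continuous_map_snd f(1), unfolded o_def])
  then have "continuous_map (cyl (fst X)) (fst Z) (\<lambda>p. g (H (fst p, f (snd p))))"
    using continuous_map_compose[OF continuous_map_compose[OF _ H(1)] g(1)] by (simp add: o_def)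
  then show ?thesis
    unfolding pnull_def using assms H f g
    by (intro phomotopicI[where H="\<lambda>p. g (H (fst p, f (snd p)))"]) auto
qed

section \<open>Quotients\<close>

definition collapse :: "'a pspace \<Rightarrow> 'a set \<Rightarrow> 'a \<Rightarrow> 'a" where
  "collapse X A x = (if x \<in> A then snd X else x)"

lemma snd_pquot [simp]: "snd (pquot X A) = snd X"
  by (simp add: pquot_def)

lemma quotient_map_collapse: "quotient_map (fst X) (fst (pquot X A)) (collapse X A)"
  using quotient_map_quot_topology[of "fst X" "collapse X A"]
  by (simp add: pquot_def collapse_def[abs_def])

lemma topspace_pquot: "topspace (fst (pquot X A)) = collapse X A ` topspace (fst X)"
  using quotient_imp_surjective_map[OF quotient_map_collapse[of X A]] by simp

lemma pmap_collapse: "pmap X (pquot X A) (collapse X A)"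
  using quotient_imp_continuous_map[OF quotient_map_collapse[of X A]]
  by (simp add: pmap_def collapse_def)

lemma pspace_pquot: "pspace X \<Longrightarrow> pspace (pquot X A)"
  by (auto simp: pspace_def topspace_pquot collapse_def image_iff)

lemma topspace_pquotD:
  assumes "pspace X" "z \<in> topspace (fst (pquot X A))"
  shows "z \<in> topspace (fst X)" "collapse X A z = z" "z \<in> A \<Longrightarrow> z = snd X"
  using assms by (auto simp: pspace_def topspace_pquot collapse_def split: if_splits)

text \<open>The quotient reuses points of \<open>X\<close> as representatives, so the same function
  \<open>H\<close> serves before and after collapsing: constancy on \<open>A\<close> says that
  \<open>H\<close> agrees with its composite with \<open>collapse\<close>.\<close>

lemma continuous_map_pquot_cyl:
  assumes "pspace X" "continuous_map (cyl (fst X)) Z H"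
    and "\<And>t a. t \<in> {0..1} \<Longrightarrow> a \<in> A \<Longrightarrow> a \<in> topspace (fst X) \<Longrightarrow> H (t, a) = H (t, snd X)"
  shows "continuous_map (cyl (fst (pquot X A))) Z H"
proof (rule continuous_compose_quotient_map[OF quotient_map_cyl[OF quotient_map_collapse]])
  show "continuous_map (cyl (fst X)) Z (H \<circ> (\<lambda>(t, x). (t, collapse X A x)))"
    by (rule continuous_map_eq[OF assms(2)]) (use assms(3) in \<open>auto simp: collapse_def\<close>)
qed

lemma continuous_map_pquot:
  assumes "pspace X" "continuous_map (fst X) Z g"
    and "\<And>a. a \<in> A \<Longrightarrow> a \<in> topspace (fst X) \<Longrightarrow> g a = g (snd X)"
  shows "continuous_map (fst (pquot X A)) Z g"
proof (rule continuous_compose_quotient_map[OF quotient_map_collapse])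
  show "continuous_map (fst X) Z (g \<circ> collapse X A)"
    by (rule continuous_map_eq[OF assms(2)]) (use assms(3) in \<open>auto simp: collapse_def\<close>)
qed

lemma pmap_pquot:
  assumes "pspace X" "pmap X Y g"
    and "\<And>a. a \<in> A \<Longrightarrow> a \<in> topspace (fst X) \<Longrightarrow> g a = snd Y"
  shows "pmap (pquot X A) Y g"
  using assms unfolding pmap_def by (auto intro!: continuous_map_pquot)

lemma pquot_empty: "pquot X {} = X"
proof -
  have "quot_topology (fst X) (\<lambda>x. x) = fst X"
  proof (rule topology_eq[THEN iffD2], rule allI)
    fix U
    have "U \<subseteq> topspace (fst X) \<Longrightarrow> {x \<in> topspace (fst X). x \<in> U} = U"
      by blast
    then show "openin (quot_topology (fst X) (\<lambda>x. x)) U = openin (fst X) U"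
      using openin_subset[of "fst X" U] by (auto simp: openin_quot_topology)
  qed
  then show ?thesis
    by (simp add: pquot_def)
qed

section \<open>Smash products\<close>

lemma pspace_prod: "pspace X \<Longrightarrow> pspace Y \<Longrightarrow> pspace (prod_topology (fst X) (fst Y), (snd X, snd Y))"
  by (simp add: pspace_def)

lemma snd_smash [simp]: "snd (smash X Y) = (snd X, snd Y)"
  by (simp add: smash_def)

lemma pspace_smash: "pspace X \<Longrightarrow> pspace Y \<Longrightarrow> pspace (smash X Y)"
  unfolding smash_def by (intro pspace_pquot pspace_prod)

abbreviation smash_proj :: "'a pspace \<Rightarrow> 'b pspace \<Rightarrow> 'a \<times> 'b \<Rightarrow> 'a \<times> 'b" where
  "smash_proj X Y \<equiv> collapse (prod_topology (fst X) (fst Y), (snd X, snd Y)) (axes X Y)"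

lemma continuous_map_smash_proj:
  "continuous_map (prod_topology (fst X) (fst Y)) (fst (smash X Y)) (smash_proj X Y)"
  using pmap_collapse[of "(prod_topology (fst X) (fst Y), (snd X, snd Y))" "axes X Y"]
  by (simp add: pmap_def smash_def)

lemma smash_proj_axes: "p \<in> axes X Y \<Longrightarrow> smash_proj X Y p = (snd X, snd Y)"
  by (simp add: collapse_def)

lemma smash_proj_base: "smash_proj X Y (snd X, snd Y) = (snd X, snd Y)"
  by (simp add: collapse_def)

text \<open>Since \<open>H\<close> fixes the base point at every time, it carries axes to axes, so
  the homotopy on the product descends to the smash products. The second factor stays fixed; changes
  there are reached through commutativity.\<close>

lemma smash_homotopy:
  assumes X: "pspace X" and Y: "pspace Y" and H: "continuous_map (cyl (fst X)) (fst X') H"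
    and base: "\<And>t. t \<in> {0..1} \<Longrightarrow> H (t, snd X) = snd X'"
  shows "continuous_map (cyl (fst (smash X Y))) (fst (smash X' Y))
    (\<lambda>(t, p). smash_proj X' Y (H (t, fst p), snd p))"
proof -
  let ?P = "prod_topology (fst X) (fst Y)"
  have "continuous_map (cyl ?P) (prod_topology (fst X') (fst Y)) (\<lambda>q. (H (fst q, fst (snd q)), snd (snd q)))"
  proof (rule continuous_map_pairedI)
    have "continuous_map (cyl ?P) (cyl (fst X)) (\<lambda>q. (fst q, fst (snd q)))"
      by (intro continuous_map_pairedI continuous_map_fst
          continuous_map_compose[OF continuous_map_snd continuous_map_fst, unfolded o_def])
    from continuous_map_compose[OF this H]
    show "continuous_map (cyl ?P) (fst X') (\<lambda>q. H (fst q, fst (snd q)))"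
      by (simp add: o_def)
    show "continuous_map (cyl ?P) (fst Y) (\<lambda>q. snd (snd q))"
      by (intro continuous_map_compose[OF continuous_map_snd continuous_map_snd, unfolded o_def])
  qed
  from continuous_map_compose[OF this continuous_map_smash_proj]
  have *: "continuous_map (cyl ?P) (fst (smash X' Y)) (\<lambda>(t, p). smash_proj X' Y (H (t, fst p), snd p))"
    by (simp add: o_def case_prod_unfold)
  have HX: "H (t, x) \<in> topspace (fst X')" if "t \<in> {0..1}" "x \<in> topspace (fst X)" for t x
    using continuous_map_funspace[OF H] that by auto
  have ax: "smash_proj X' Y (H (t, x), y) = (snd X', snd Y)"
    if "t \<in> {0..1}" "(x, y) \<in> axes X Y" for t x y
    using that HX[of t x] base[of t] by (intro smash_proj_axes) (auto simp: axes_def)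
  have b: "(snd X, snd Y) \<in> axes X Y"
    using X by (auto simp: axes_def pspace_def)
  show ?thesis
    unfolding smash_def[of X]
    by (rule continuous_map_pquot_cyl)
       (use * ax ax[OF _ b] pspace_prod[OF X Y] in \<open>auto simp: smash_def[of X']\<close>)
qed

lemma smash_pmap:
  assumes X: "pspace X" and Y: "pspace Y" and f: "pmap X X' f"
  shows "pmap (smash X Y) (smash X' Y) (\<lambda>p. smash_proj X' Y (f (fst p), snd p))"
proof -
  have "continuous_map (cyl (fst X)) (fst X') (\<lambda>p. f (snd p))"
    using f continuous_map_compose[OF continuous_map_snd, of "fst X"] by (auto simp: pmap_def o_def)
  from smash_homotopy[OF X Y this] f
  have "continuous_map (cyl (fst (smash X Y))) (fst (smash X' Y))
     (\<lambda>q. (\<lambda>p. smash_proj X' Y (f (fst p), snd p)) (snd q))"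
    by (simp add: pmap_def case_prod_unfold)
  from continuous_map_cyl_snd[OF this] f show ?thesis
    by (simp add: pmap_def collapse_def)
qed

lemma topspace_smashD:
  assumes "pspace X" "pspace Y" "p \<in> topspace (fst (smash X Y))"
  shows "fst p \<in> topspace (fst X)" "snd p \<in> topspace (fst Y)" "smash_proj X Y p = p"
  using topspace_pquotD[OF pspace_prod, of X Y p "axes X Y"] assms by (auto simp: smash_def)

lemma smash_pequiv_aux:
  assumes X: "pspace X" and Y: "pspace Y" and f: "pmap X X' f" and g: "pmap X' X g"
    and H: "phomotopic X X (g \<circ> f) id"
  obtains K where "continuous_map (cyl (fst (smash X Y))) (fst (smash X Y)) K"
    "\<And>p. p \<in> topspace (fst (smash X Y)) \<Longrightarrow>
      K (0, p) = (\<lambda>p. smash_proj X Y (g (fst p), snd p)) (smash_proj X' Y (f (fst p), snd p))"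
    "\<And>p. p \<in> topspace (fst (smash X Y)) \<Longrightarrow> K (1, p) = p"
    "\<And>t. t \<in> {0..1} \<Longrightarrow> K (t, snd (smash X Y)) = snd (smash X Y)"
proof -
  obtain H where H: "continuous_map (cyl (fst X)) (fst X) H" "\<And>x. H (0, x) = g (f x)"
    "\<And>x. H (1, x) = x" "\<And>t. t \<in> {0..1} \<Longrightarrow> H (t, snd X) = snd X"
    using H by (rule phomotopicE) auto
  have g0: "g (snd X') = snd X"
    and gX: "\<And>x. x \<in> topspace (fst X') \<Longrightarrow> g x \<in> topspace (fst X)"
    using g continuous_map_funspace by (fastforce simp: pmap_def)+
  show ?thesis
  proof (rule that[OF smash_homotopy[OF X Y H(1,4)]])
    fix p assume p: "p \<in> topspace (fst (smash X Y))"
    note p = topspace_smashD[OF X Y p]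
    have *: "smash_proj X Y (g (f (fst p)), snd p) =
      smash_proj X Y (g (fst (smash_proj X' Y (f (fst p), snd p))), snd (smash_proj X' Y (f (fst p), snd p)))"
    \<comment> \<open>A point that is collapsed halfway is sent by \<open>g\<close> onto the axes,
      hence collapsed at the end as well.\<close>
    proof (cases "(f (fst p), snd p) \<in> axes X' Y")
      case True
      then have "(g (f (fst p)), snd p) \<in> axes X Y"
        using p g0 gX by (auto simp: axes_def)
      moreover have "(snd X, snd Y) \<in> axes X Y"
        using X by (auto simp: axes_def pspace_def)
      ultimately show ?thesis
        using True g0 by (simp add: collapse_def)
    qed (simp add: collapse_def)
    then show "(case (0, p) of (t, p) \<Rightarrow> smash_proj X Y (H (t, fst p), snd p)) =
      smash_proj X Y (g (fst (smash_proj X' Y (f (fst p), snd p))), snd (smash_proj X' Y (f (fst p), snd p)))"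
      by (simp add: H)
    show "(case (1, p) of (t, p) \<Rightarrow> smash_proj X Y (H (t, fst p), snd p)) = p"
      using p by (simp add: H)
  next
    fix t :: real assume "t \<in> {0..1}"
    then show "(case (t, snd (smash X Y)) of (t, p) \<Rightarrow> smash_proj X Y (H (t, fst p), snd p)) = snd (smash X Y)"
      by (simp add: H collapse_def)
  qed auto
qed

lemma smash_pequiv_left:
  assumes "pspace X" "pspace X'" "pspace Y" "X \<simeq>\<^sub>* X'"
  shows "smash X Y \<simeq>\<^sub>* smash X' Y"
proof -
  obtain f g where f: "pmap X X' f" "pmap X' X g" "phomotopic X X (g \<circ> f) id" "phomotopic X' X' (f \<circ> g) id"
    using assms unfolding phomotopy_equivalent_def by blast
  obtain H where H: "continuous_map (cyl (fst (smash X Y))) (fst (smash X Y)) H"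
    "\<And>p. p \<in> topspace (fst (smash X Y)) \<Longrightarrow>
      H (0, p) = (\<lambda>p. smash_proj X Y (g (fst p), snd p)) (smash_proj X' Y (f (fst p), snd p))"
    "\<And>p. p \<in> topspace (fst (smash X Y)) \<Longrightarrow> H (1, p) = p"
    "\<And>t. t \<in> {0..1} \<Longrightarrow> H (t, snd (smash X Y)) = snd (smash X Y)"
    using smash_pequiv_aux[OF assms(1,3) f(1-3)] by metis
  obtain K where K: "continuous_map (cyl (fst (smash X' Y))) (fst (smash X' Y)) K"
    "\<And>p. p \<in> topspace (fst (smash X' Y)) \<Longrightarrow>
      K (0, p) = (\<lambda>p. smash_proj X' Y (f (fst p), snd p)) (smash_proj X Y (g (fst p), snd p))"
    "\<And>p. p \<in> topspace (fst (smash X' Y)) \<Longrightarrow> K (1, p) = p"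
    "\<And>t. t \<in> {0..1} \<Longrightarrow> K (t, snd (smash X' Y)) = snd (smash X' Y)"
    using smash_pequiv_aux[OF assms(2,3) f(2,1,4)] by metis
  show ?thesis
    by (rule pequivI[OF pspace_smash pspace_smash smash_pmap[OF _ _ f(1)] smash_pmap[OF _ _ f(2)] H K])
       (use assms in auto)
qed

lemma smash_commute_pmap:
  assumes "pspace X" "pspace Y"
  shows "pmap (smash X Y) (smash Y X) prod.swap"
proof -
  have "continuous_map (prod_topology (fst X) (fst Y)) (prod_topology (fst Y) (fst X)) prod.swap"
    unfolding prod.swap_def by (intro continuous_intros)
  from continuous_map_compose[OF this continuous_map_smash_proj]
  have *: "pmap (prod_topology (fst X) (fst Y), (snd X, snd Y)) (smash Y X) (smash_proj Y X \<circ> prod.swap)"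
    by (simp add: pmap_def collapse_def)
  have *: "pmap (smash X Y) (smash Y X) (smash_proj Y X \<circ> prod.swap)"
    unfolding smash_def[of X]
    by (rule pmap_pquot[OF pspace_prod[OF assms] *]) (auto simp: axes_def collapse_def)
  have "smash_proj Y X (prod.swap p) = prod.swap p" if "p \<in> topspace (fst (smash X Y))" for p
    using topspace_smashD[OF assms that]
    by (cases p) (auto simp: collapse_def axes_def split: if_splits)
  then show ?thesis
    using * continuous_map_eq[of _ _ "smash_proj Y X \<circ> prod.swap" prod.swap] by (auto simp: pmap_def)
qed

lemma smash_commute:
  assumes "pspace X" "pspace Y"
  shows "smash X Y \<simeq>\<^sub>* smash Y X"
  by (rule phomeo_imp_pequiv[OF _ _ smash_commute_pmap smash_commute_pmap])
     (use assms in \<open>auto intro: pspace_smash\<close>)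

lemma smash_pequiv:
  assumes "pspace X" "pspace X'" "pspace Y" "pspace Y'" "X \<simeq>\<^sub>* X'" "Y \<simeq>\<^sub>* Y'"
  shows "smash X Y \<simeq>\<^sub>* smash X' Y'"
  using assms
  by (meson smash_pequiv_left smash_commute pequiv_trans)

lemma pcontractible_smash:
  assumes X: "pspace X" and Y: "pspace Y" and "pcontractible X"
  shows "pcontractible (smash X Y)"
proof -
  obtain H where H: "continuous_map (cyl (fst X)) (fst X) H" "\<And>x. H (0, x) = x"
    "\<And>x. H (1, x) = snd X" "\<And>t. t \<in> {0..1} \<Longrightarrow> H (t, snd X) = snd X"
    using pcontractible_imp_phomotopic[OF assms(3)] by (rule phomotopicE) auto
  have "smash_proj X Y (snd X, snd p) = (snd X, snd Y)" if "p \<in> topspace (fst (smash X Y))" for p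
    using topspace_smashD[OF X Y that] by (intro smash_proj_axes) (auto simp: axes_def)
  then show ?thesis
    by (intro phomotopic_imp_pcontractible[OF pspace_smash phomotopicI[OF _ smash_homotopy[OF X Y H(1,4)]]])
       (use X Y topspace_smashD(3)[OF X Y] in \<open>auto intro: pspace_smash simp: H smash_proj_base\<close>)
qed

lemma pcontractible_smash_right:
  assumes "pspace X" "pspace Y" "pcontractible Y"
  shows "pcontractible (smash X Y)"
  using assms pcontractible_smash smash_commute pcontractible_pequiv by metis

lemma collapse_in: "x \<in> A \<Longrightarrow> collapse X A x = snd X"
  and collapse_notin: "x \<notin> A \<Longrightarrow> collapse X A x = x"
  by (simp_all add: collapse_def)

section \<open>Wedges and suspensions\<close>

lemma snd_wedge [simp]: "snd (wedge X Y) = (snd X, snd Y)"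
  by (simp add: wedge_def)

lemma topspace_wedge: "pspace X \<Longrightarrow> pspace Y \<Longrightarrow> topspace (fst (wedge X Y)) = axes X Y"
  by (auto simp: wedge_def axes_def pspace_def)

lemma pspace_wedge: "pspace X \<Longrightarrow> pspace Y \<Longrightarrow> pspace (wedge X Y)"
  by (simp add: pspace_def topspace_wedge[unfolded pspace_def] axes_def)

lemma openin_wedge:
  assumes "openin (fst X) U" "openin (fst Y) V"
  shows "openin (fst (wedge X Y)) (U \<times> V \<inter> axes X Y)"
  using assms by (auto simp: wedge_def openin_subtopology openin_prod_Times_iff intro!: exI[of _ "U \<times> V"])

lemma continuous_map_wedge_prod:
  assumes X: "pspace X" and Y: "pspace Y"
    and fX: "continuous_map (prod_topology W (fst X)) Z (\<lambda>p. f (fst p, (snd p, snd Y)))"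
    and fY: "continuous_map (prod_topology W (fst Y)) Z (\<lambda>p. f (fst p, (snd X, snd p)))"
  shows "continuous_map (prod_topology W (fst (wedge X Y))) Z f"
  unfolding continuous_map_def
proof (intro conjI allI impI funcsetI)
  fix p assume "p \<in> topspace (prod_topology W (fst (wedge X Y)))"
  then obtain w x y where p: "p = (w, (x, y))" "w \<in> topspace W" "(x, y) \<in> axes X Y"
    by (cases p) (auto simp: topspace_wedge[OF X Y])
  then show "f p \<in> topspace Z"
    using continuous_map_funspace[OF fX] continuous_map_funspace[OF fY] by (auto simp: axes_def Pi_def)
next
  fix U assume U: "openin Z U"
  let ?P = "{p \<in> topspace (prod_topology W (fst (wedge X Y))). f p \<in> U}"
  define WX where "WX = {p \<in> topspace (prod_topology W (fst X)). f (fst p, (snd p, snd Y)) \<in> U}"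
  define WY where "WY = {p \<in> topspace (prod_topology W (fst Y)). f (fst p, (snd X, snd p)) \<in> U}"
  have WX: "openin (prod_topology W (fst X)) WX" and WY: "openin (prod_topology W (fst Y)) WY"
    unfolding WX_def WY_def
    by (rule openin_continuous_map_preimage[OF fX U], rule openin_continuous_map_preimage[OF fY U])
  have bX: "snd X \<in> topspace (fst X)" and bY: "snd Y \<in> topspace (fst Y)"
    using X Y by (auto simp: pspace_def)
  show "openin (prod_topology W (fst (wedge X Y))) ?P"
    unfolding openin_prod_topology_alt
  proof (intro allI impI)
    fix w z assume wz: "(w, z) \<in> ?P"
    obtain x y where xy: "z = (x, y)"
      by (cases z)
    from wz have z: "z = (x, y)" "(x, y) \<in> axes X Y" and w: "w \<in> topspace W" "f (w, (x, y)) \<in> U"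
      by (simp_all add: xy topspace_wedge[OF X Y])
    have "\<exists>N A B. openin W N \<and> openin (fst X) A \<and> openin (fst Y) B \<and> w \<in> N \<and> x \<in> A \<and> y \<in> B \<and>
        N \<times> (A \<times> B \<inter> axes X Y) \<subseteq> ?P"
    proof (cases "y = snd Y")
      case True
      then have mem54: "(w, x) \<in> WX"
        using w z bX by (auto simp: WX_def axes_def)
      obtain N A where NA: "openin W N" "openin (fst X) A" "w \<in> N" "x \<in> A" "N \<times> A \<subseteq> WX"
        using WX[unfolded openin_prod_topology_alt, rule_format, OF mem54] by blast
      show ?thesis
      \<comment> \<open>If \<open>A\<close> contains the base point, the basic neighbourhood spreads
        onto the other axis and must be cut down there by some \<open>B\<close>; otherwise it meets
        the axes only in \<open>A\<close> times the base point, and all of \<open>Y\<close> can be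
        allowed as second side.\<close>
      proof (cases "snd X \<in> A")
        case True
        then have "(w, snd X) \<in> WX"
          using NA by blast
        then have mem63: "(w, snd Y) \<in> WY"
          using bY by (auto simp: WX_def WY_def)
        obtain N' B where NB: "openin W N'" "openin (fst Y) B" "w \<in> N'" "snd Y \<in> B" "N' \<times> B \<subseteq> WY"
          using WY[unfolded openin_prod_topology_alt, rule_format, OF mem63] by blast
        have "(N \<inter> N') \<times> (A \<times> B \<inter> axes X Y) \<subseteq> ?P"
          using NA(5) NB(5) by (auto simp: topspace_wedge[OF X Y] axes_def WX_def WY_def)
        then show ?thesis
          using NA NB \<open>y = snd Y\<close> by (intro exI[of _ "N \<inter> N'"] exI[of _ A] exI[of _ B]) (auto intro: openin_Int)
      next
        case False
        then have "N \<times> (A \<times> topspace (fst Y) \<inter> axes X Y) \<subseteq> ?P"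
          using NA(5) by (auto simp: topspace_wedge[OF X Y] axes_def WX_def)
        then show ?thesis
          using NA \<open>y = snd Y\<close> bY by (intro exI[of _ N] exI[of _ A] exI[of _ "topspace (fst Y)"]) auto
      qed
    next
      case False
      then have x: "x = snd X"
        using z by (auto simp: axes_def)
      then have mem82: "(w, y) \<in> WY"
        using w z bY by (auto simp: WY_def axes_def)
      obtain N B where NB: "openin W N" "openin (fst Y) B" "w \<in> N" "y \<in> B" "N \<times> B \<subseteq> WY"
        using WY[unfolded openin_prod_topology_alt, rule_format, OF mem82] by blast
      show ?thesis
      proof (cases "snd Y \<in> B")
        case True
        then have "(w, snd Y) \<in> WY"
          using NB by blast
        then have mem91: "(w, snd X) \<in> WX"
          using bX by (auto simp: WX_def WY_def)
        obtain N' A where NA: "openin W N'" "openin (fst X) A" "w \<in> N'" "snd X \<in> A" "N' \<times> A \<subseteq> WX"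
          using WX[unfolded openin_prod_topology_alt, rule_format, OF mem91] by blast
        have "(N \<inter> N') \<times> (A \<times> B \<inter> axes X Y) \<subseteq> ?P"
          using NA(5) NB(5) by (auto simp: topspace_wedge[OF X Y] axes_def WX_def WY_def)
        then show ?thesis
          using NA NB x by (intro exI[of _ "N \<inter> N'"] exI[of _ A] exI[of _ B]) (auto intro: openin_Int)
      next
        case False
        then have "N \<times> (topspace (fst X) \<times> B \<inter> axes X Y) \<subseteq> ?P"
          using NB(5) by (auto simp: topspace_wedge[OF X Y] axes_def WY_def)
        then show ?thesis
          using NB x bX by (intro exI[of _ N] exI[of _ "topspace (fst X)"] exI[of _ B]) auto
      qed
    qed
    then obtain N A B where *: "openin W N" "openin (fst X) A" "openin (fst Y) B" "w \<in> N" "x \<in> A" "y \<in> B"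
        "N \<times> (A \<times> B \<inter> axes X Y) \<subseteq> ?P"
      by blast
    then show "\<exists>N V. openin W N \<and> openin (fst (wedge X Y)) V \<and> w \<in> N \<and> z \<in> V \<and> N \<times> V \<subseteq> ?P"
      using z by (intro exI[of _ N] exI[of _ "A \<times> B \<inter> axes X Y"]) (auto intro: openin_wedge)
  qed
qed

lemma continuous_map_cyl_snd_intro:
  "continuous_map X Z g \<Longrightarrow> continuous_map (cyl X) Z (\<lambda>p. g (snd p))"
  using continuous_map_compose[OF continuous_map_snd] by (auto simp: o_def)

lemma continuous_map_wedge:
  assumes "pspace X" "pspace Y"
    and "continuous_map (fst X) Z (\<lambda>x. f (x, snd Y))"
    and "continuous_map (fst Y) Z (\<lambda>y. f (snd X, y))"
  shows "continuous_map (fst (wedge X Y)) Z f"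
  by (rule continuous_map_cyl_snd, rule continuous_map_wedge_prod[OF assms(1,2)])
     (use assms(3,4)[THEN continuous_map_cyl_snd_intro] in simp_all)

lemma continuous_map_into_wedge:
  assumes "pspace X" "pspace Y"
  shows "continuous_map (fst X) (fst (wedge X Y)) (\<lambda>x. (x, snd Y))"
    and "continuous_map (fst Y) (fst (wedge X Y)) (\<lambda>y. (snd X, y))"
  using assms unfolding wedge_def
  by (auto intro!: continuous_map_into_subtopology continuous_map_pairedI simp: axes_def pspace_def)

lemma continuous_map_cyl_compose:
  assumes "continuous_map X Y f" "continuous_map (cyl Y) Z H"
  shows "continuous_map (cyl X) Z (\<lambda>p. H (fst p, f (snd p)))"
proof -
  have "continuous_map (cyl X) (cyl Y) (\<lambda>p. (fst p, f (snd p)))"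
    using assms(1)
    by (intro continuous_map_pairedI continuous_map_fst continuous_map_compose[OF continuous_map_snd, unfolded o_def])
  from continuous_map_compose[OF this assms(2)] show ?thesis
    by (simp add: o_def)
qed

lemma pmap_wedge:
  assumes "pspace X" "pspace Y" "pspace X'" "pspace Y'" "pmap X X' f" "pmap Y Y' g"
  shows "pmap (wedge X Y) (wedge X' Y') (map_prod f g)"
proof -
  have "continuous_map (fst X) (fst (wedge X' Y')) (\<lambda>x. (f x, snd Y'))"
    "continuous_map (fst Y) (fst (wedge X' Y')) (\<lambda>y. (snd X', g y))"
    using assms continuous_map_compose[OF _ continuous_map_into_wedge(1)[of X' Y'], of _ f]
      continuous_map_compose[OF _ continuous_map_into_wedge(2)[of X' Y'], of _ g]
    by (auto simp: pmap_def o_def)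
  then show ?thesis
    using assms by (auto simp: pmap_def intro!: continuous_map_wedge)
qed

lemma wedge_homotopy:
  assumes "pspace X" "pspace Y"
    and "continuous_map (cyl (fst X)) (fst X) H" "\<And>t. t \<in> {0..1} \<Longrightarrow> H (t, snd X) = snd X"
    and "continuous_map (cyl (fst Y)) (fst Y) K" "\<And>t. t \<in> {0..1} \<Longrightarrow> K (t, snd Y) = snd Y"
  shows "continuous_map (cyl (fst (wedge X Y))) (fst (wedge X Y)) (\<lambda>(t, (x, y)). (H (t, x), K (t, y)))"
proof (rule continuous_map_wedge_prod[OF assms(1,2)])
  show "continuous_map (cyl (fst X)) (fst (wedge X Y)) (\<lambda>p. case (fst p, snd p, snd Y) of (t, x, y) \<Rightarrow> (H (t, x), K (t, y)))"
    by (rule continuous_map_eq[OF continuous_map_compose[OF assms(3) continuous_map_into_wedge(1)[OF assms(1,2)]]])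
       (use assms(6) in auto)
  show "continuous_map (cyl (fst Y)) (fst (wedge X Y)) (\<lambda>p. case (fst p, snd X, snd p) of (t, x, y) \<Rightarrow> (H (t, x), K (t, y)))"
    by (rule continuous_map_eq[OF continuous_map_compose[OF assms(5) continuous_map_into_wedge(2)[OF assms(1,2)]]])
       (use assms(4) in auto)
qed

lemma wedge_pequiv_aux:
  assumes "pspace X" "pspace Y" "phomotopic X X f id" "phomotopic Y Y g id"
  obtains K where "continuous_map (cyl (fst (wedge X Y))) (fst (wedge X Y)) K"
    "\<And>p. K (0, p) = map_prod f g p" "\<And>p. K (1, p) = p"
    "\<And>t. t \<in> {0..1} \<Longrightarrow> K (t, snd (wedge X Y)) = snd (wedge X Y)"
proof -
  obtain H where H: "continuous_map (cyl (fst X)) (fst X) H" "\<And>x. H (0, x) = f x"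
    "\<And>x. H (1, x) = x" "\<And>t. t \<in> {0..1} \<Longrightarrow> H (t, snd X) = snd X"
    using assms(3) by (rule phomotopicE) auto
  obtain K where K: "continuous_map (cyl (fst Y)) (fst Y) K" "\<And>x. K (0, x) = g x"
    "\<And>x. K (1, x) = x" "\<And>t. t \<in> {0..1} \<Longrightarrow> K (t, snd Y) = snd Y"
    using assms(4) by (rule phomotopicE) auto
  show ?thesis
    by (rule that[OF wedge_homotopy[OF assms(1,2) H(1,4) K(1,4)]]) (auto simp: H K split: prod.splits)
qed

lemma wedge_pequiv:
  assumes ps: "pspace X" "pspace Y" "pspace X'" "pspace Y'" and "X \<simeq>\<^sub>* X'" "Y \<simeq>\<^sub>* Y'"
  shows "wedge X Y \<simeq>\<^sub>* wedge X' Y'"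
proof -
  obtain f g where f: "pmap X X' f" "pmap X' X g" "phomotopic X X (g \<circ> f) id" "phomotopic X' X' (f \<circ> g) id"
    using assms unfolding phomotopy_equivalent_def by blast
  obtain h k where h: "pmap Y Y' h" "pmap Y' Y k" "phomotopic Y Y (k \<circ> h) id" "phomotopic Y' Y' (h \<circ> k) id"
    using assms unfolding phomotopy_equivalent_def by blast
  obtain H where H: "continuous_map (cyl (fst (wedge X Y))) (fst (wedge X Y)) H"
    "\<And>p. H (0, p) = map_prod (g \<circ> f) (k \<circ> h) p" "\<And>p. H (1, p) = p"
    "\<And>t. t \<in> {0..1} \<Longrightarrow> H (t, snd (wedge X Y)) = snd (wedge X Y)"
    using wedge_pequiv_aux[OF ps(1,2) f(3) h(3)] by metis
  obtain K where K: "continuous_map (cyl (fst (wedge X' Y'))) (fst (wedge X' Y')) K"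
    "\<And>p. K (0, p) = map_prod (f \<circ> g) (h \<circ> k) p" "\<And>p. K (1, p) = p"
    "\<And>t. t \<in> {0..1} \<Longrightarrow> K (t, snd (wedge X' Y')) = snd (wedge X' Y')"
    using wedge_pequiv_aux[OF ps(3,4) f(4) h(4)] by metis
  show ?thesis
    by (rule pequivI[OF pspace_wedge pspace_wedge pmap_wedge[OF ps f(1) h(1)]
          pmap_wedge[OF ps(3,4,1,2) f(2) h(2)] H(1) _ _ H(4) K(1) _ _ K(4)])
       (use ps in \<open>auto simp: H K\<close>)
qed

section \<open>Reduced suspensions\<close>

abbreviation cylp :: "'a pspace \<Rightarrow> (real \<times> 'a) pspace" where
  "cylp A \<equiv> (cyl (fst A), (0, snd A))"

lemma pspace_cylp: "pspace A \<Longrightarrow> pspace (cylp A)"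
  by (simp add: pspace_def)

abbreviation susp_set :: "'a pspace \<Rightarrow> (real \<times> 'a) set" where
  "susp_set A \<equiv> {0, 1} \<times> topspace (fst A) \<union> {0..1} \<times> {snd A}"

lemma susp_eq: "susp A = pquot (cylp A) (susp_set A)"
  by (simp add: susp_def)

lemma snd_susp [simp]: "snd (susp A) = (0, snd A)"
  by (simp add: susp_def)

lemma pspace_susp: "pspace A \<Longrightarrow> pspace (susp A)"
  unfolding susp_eq by (intro pspace_pquot pspace_cylp)

lemma susp_homotopy:
  assumes A: "pspace A" and H: "continuous_map (cyl (fst A)) (fst B) H"
    and base: "\<And>t. t \<in> {0..1} \<Longrightarrow> H (t, snd A) = snd B"
  shows "continuous_map (cyl (fst (susp A))) (fst (susp B))
    (\<lambda>(s, p). collapse (cylp B) (susp_set B) (fst p, H (s, snd p)))"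
proof -
  have "continuous_map (cyl (cyl (fst A))) (cyl (fst B)) (\<lambda>q. (fst (snd q), H (fst q, snd (snd q))))"
  proof (intro continuous_map_pairedI)
    show "continuous_map (cyl (cyl (fst A))) (top_of_set {0..1}) (\<lambda>q. fst (snd q))"
      by (intro continuous_map_compose[OF continuous_map_snd continuous_map_fst, unfolded o_def])
    show "continuous_map (cyl (cyl (fst A))) (fst B) (\<lambda>q. H (fst q, snd (snd q)))"
      by (rule continuous_map_cyl_compose[OF continuous_map_snd H])
  qed
  from continuous_map_compose[OF this pmap_collapse[unfolded pmap_def, THEN conjunct1, of "cylp B", simplified]]
  have *: "continuous_map (cyl (cyl (fst A))) (fst (susp B))
      (\<lambda>(s, p). collapse (cylp B) (susp_set B) (fst p, H (s, snd p)))"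
    by (simp add: o_def case_prod_unfold susp_eq)
  have HX: "H (t, x) \<in> topspace (fst B)" if "t \<in> {0..1}" "x \<in> topspace (fst A)" for t x
    using continuous_map_funspace[OF H] that by auto
  show ?thesis
    unfolding susp_eq[of A]
    by (rule continuous_map_pquot_cyl[OF pspace_cylp[OF A]])
       (use * HX A base in \<open>auto simp: collapse_def pspace_def\<close>)
qed

lemma susp_pmap:
  assumes A: "pspace A" and f: "pmap A B f"
  shows "pmap (susp A) (susp B) (\<lambda>p. collapse (cylp B) (susp_set B) (fst p, f (snd p)))"
proof -
  have "continuous_map (cyl (fst A)) (fst B) (\<lambda>p. f (snd p))"
    using f continuous_map_cyl_snd_intro by (auto simp: pmap_def)
  from susp_homotopy[OF A this] f
  have "continuous_map (cyl (fst (susp A))) (fst (susp B))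
     (\<lambda>q. (\<lambda>p. collapse (cylp B) (susp_set B) (fst p, f (snd p))) (snd q))"
    by (simp add: pmap_def case_prod_unfold)
  from continuous_map_cyl_snd[OF this] f show ?thesis
    by (simp add: pmap_def collapse_def)
qed

lemma topspace_suspD:
  assumes "pspace A" "p \<in> topspace (fst (susp A))"
  shows "fst p \<in> {0..1}" "snd p \<in> topspace (fst A)" "collapse (cylp A) (susp_set A) p = p"
  using topspace_pquotD[OF pspace_cylp, of A p "susp_set A"] assms
  by (auto simp: susp_eq mem_Times_iff)

lemma susp_pequiv_aux:
  assumes A: "pspace A" and f: "pmap A B f" and g: "pmap B A g" and H: "phomotopic A A (g \<circ> f) id"
  obtains K where "continuous_map (cyl (fst (susp A))) (fst (susp A)) K"
    "\<And>p. p \<in> topspace (fst (susp A)) \<Longrightarrow> K (0, p) =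
      (\<lambda>p. collapse (cylp A) (susp_set A) (fst p, g (snd p)))
      (collapse (cylp B) (susp_set B) (fst p, f (snd p)))"
    "\<And>p. p \<in> topspace (fst (susp A)) \<Longrightarrow> K (1, p) = p"
    "\<And>t. t \<in> {0..1} \<Longrightarrow> K (t, snd (susp A)) = snd (susp A)"
proof -
  obtain H where H: "continuous_map (cyl (fst A)) (fst A) H" "\<And>x. H (0, x) = g (f x)"
    "\<And>x. H (1, x) = x" "\<And>t. t \<in> {0..1} \<Longrightarrow> H (t, snd A) = snd A"
    using H by (rule phomotopicE) auto
  have g0: "g (snd B) = snd A" and fX: "\<And>x. x \<in> topspace (fst A) \<Longrightarrow> f x \<in> topspace (fst B)"
    and gX: "\<And>x. x \<in> topspace (fst B) \<Longrightarrow> g x \<in> topspace (fst A)"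
    using f g continuous_map_funspace by (fastforce simp: pmap_def)+
  show ?thesis
  proof (rule that[OF susp_homotopy[OF A H(1,4)]])
    fix p assume p: "p \<in> topspace (fst (susp A))"
    note p = topspace_suspD[OF A p]
    have *: "(fst p, f (snd p)) \<in> susp_set B \<Longrightarrow> (fst p, g (f (snd p))) \<in> susp_set A"
      using p g0 gX by auto
    show "(case (0, p) of (s, p) \<Rightarrow> collapse (cylp A) (susp_set A) (fst p, H (s, snd p))) =
      collapse (cylp A) (susp_set A)
       (fst (collapse (cylp B) (susp_set B) (fst p, f (snd p))),
        g (snd (collapse (cylp B) (susp_set B) (fst p, f (snd p)))))"
    proof (cases "(fst p, f (snd p)) \<in> susp_set B")
      case True
      have "(0, snd A) \<in> susp_set A"
        by simp
      then show ?thesis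
        using *[OF True] True by (simp only: H collapse_in prod.case fst_conv snd_conv g0)
    qed (simp only: H collapse_notin prod.case fst_conv snd_conv not_False_eq_True)
    show "(case (1, p) of (s, p) \<Rightarrow> collapse (cylp A) (susp_set A) (fst p, H (s, snd p))) = p"
      using p by (simp add: H)
  next
    fix t :: real assume "t \<in> {0..1}"
    then show "(case (t, snd (susp A)) of (s, p) \<Rightarrow> collapse (cylp A) (susp_set A) (fst p, H (s, snd p))) = snd (susp A)"
      by (simp add: H collapse_def)
  qed auto
qed

lemma susp_pequiv:
  assumes "pspace A" "pspace B" "A \<simeq>\<^sub>* B"
  shows "susp A \<simeq>\<^sub>* susp B"
proof -
  obtain f g where f: "pmap A B f" "pmap B A g" "phomotopic A A (g \<circ> f) id" "phomotopic B B (f \<circ> g) id"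
    using assms unfolding phomotopy_equivalent_def by blast
  obtain H where H: "continuous_map (cyl (fst (susp A))) (fst (susp A)) H"
    "\<And>p. p \<in> topspace (fst (susp A)) \<Longrightarrow> H (0, p) =
      (\<lambda>p. collapse (cylp A) (susp_set A) (fst p, g (snd p)))
      (collapse (cylp B) (susp_set B) (fst p, f (snd p)))"
    "\<And>p. p \<in> topspace (fst (susp A)) \<Longrightarrow> H (1, p) = p"
    "\<And>t. t \<in> {0..1} \<Longrightarrow> H (t, snd (susp A)) = snd (susp A)"
    using susp_pequiv_aux[OF assms(1) f(1-3)] by metis
  obtain K where K: "continuous_map (cyl (fst (susp B))) (fst (susp B)) K"
    "\<And>p. p \<in> topspace (fst (susp B)) \<Longrightarrow> K (0, p) =
      (\<lambda>p. collapse (cylp B) (susp_set B) (fst p, f (snd p)))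
      (collapse (cylp A) (susp_set A) (fst p, g (snd p)))"
    "\<And>p. p \<in> topspace (fst (susp B)) \<Longrightarrow> K (1, p) = p"
    "\<And>t. t \<in> {0..1} \<Longrightarrow> K (t, snd (susp B)) = snd (susp B)"
    using susp_pequiv_aux[OF assms(2) f(2,1,4)] by metis
  show ?thesis
    by (rule pequivI[OF pspace_susp pspace_susp susp_pmap[OF _ f(1)] susp_pmap[OF _ f(2)] H K])
       (use assms in auto)
qed

section \<open>Mapping cones\<close>

text \<open>Chooses representatives of the reduced mapping cone inside the wedge of \<open>X\<close>
  and the cylinder: the end \<open>t = 0\<close> is attached along \<open>f\<close>, while the end
  \<open>t = 1\<close> and the line over the base point shrink to the base point. The points
  \<open>(x, 0, snd A)\<close> form the copy of \<open>X\<close>.\<close>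

definition cone_proj :: "('a \<Rightarrow> 'b) \<Rightarrow> 'a pspace \<Rightarrow> 'b \<times> real \<times> 'a \<Rightarrow> 'b \<times> real \<times> 'a" where
  "cone_proj f A = (\<lambda>(x, t, a). if a = snd A \<or> t = 1 then (x, 0, snd A)
     else if t = 0 then (f a, 0, snd A) else (x, t, a))"

definition mcone :: "('a \<Rightarrow> 'b) \<Rightarrow> 'a pspace \<Rightarrow> 'b pspace \<Rightarrow> ('b \<times> real \<times> 'a) pspace" where
  "mcone f A X = (quot_topology (fst (wedge X (cylp A))) (cone_proj f A), (snd X, 0, snd A))"

text \<open>Glues a homotopy on \<open>X\<close> and a homotopy on the cylinder to one on the
  mapping cone; \<open>s\<close> is the time. The test \<open>p = (0, snd A)\<close> recognizes the
  representatives that lie in \<open>X\<close>.\<close>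

definition cone_ext :: "'a pspace \<Rightarrow> (real \<times> 'b \<Rightarrow> 'c) \<Rightarrow> (real \<times> real \<times> 'a \<Rightarrow> 'c) \<Rightarrow> real \<times> 'b \<times> real \<times> 'a \<Rightarrow> 'c"
where
  "cone_ext A H K = (\<lambda>(s, x, p). if p = (0, snd A) then H (s, x) else K (s, p))"

lemma snd_mcone [simp]: "snd (mcone f A X) = (snd X, 0, snd A)"
  by (simp add: mcone_def)

lemma quotient_map_mcone:
  "quotient_map (fst (wedge X (cylp A))) (fst (mcone f A X)) (cone_proj f A)"
  by (simp add: mcone_def quotient_map_quot_topology)

lemma continuous_map_pair_real:
  assumes "continuous_map T euclideanreal \<phi>" "\<And>p. p \<in> topspace T \<Longrightarrow> \<phi> p \<in> S" "continuous_map T Y \<psi>"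
  shows "continuous_map T (prod_topology (top_of_set S) Y) (\<lambda>p. (\<phi> p, \<psi> p))"
  using assms by (intro continuous_map_pairedI) (auto simp: continuous_map_in_subtopology)

lemma continuous_map_cyl_cyl:
  "continuous_map (cyl (cyl X)) euclideanreal fst"
  "continuous_map (cyl (cyl X)) euclideanreal (\<lambda>p. fst (snd p))"
  "continuous_map (cyl (cyl X)) X (\<lambda>p. snd (snd p))"
  by (intro continuous_map_fst[THEN continuous_map_into_fulltopology]
      continuous_map_compose[OF continuous_map_snd continuous_map_fst[THEN continuous_map_into_fulltopology], unfolded o_def]
      continuous_map_compose[OF continuous_map_snd continuous_map_snd, unfolded o_def])+

context
  fixes A :: "'a pspace" and X :: "'b pspace"
  assumes A: "pspace A" and X: "pspace X"
begin

lemma bases: "snd A \<in> topspace (fst A)" "snd X \<in> topspace (fst X)"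
  using A X by (auto simp: pspace_def)

lemma mcone_cases:
  assumes "pmap A X f" "z \<in> topspace (fst (mcone f A X))"
  obtains (base) x where "x \<in> topspace (fst X)" "z = (x, 0, snd A)"
  | (cone) t a where "0 < t" "t < 1" "a \<in> topspace (fst A)" "a \<noteq> snd A" "z = (snd X, t, a)"
proof -
  have "z \<in> cone_proj f A ` axes X (cylp A)"
    using assms(2) quotient_imp_surjective_map[OF quotient_map_mcone[of X A f]]
    by (simp add: topspace_wedge[OF X pspace_cylp[OF A]])
  then obtain q where "q \<in> axes X (cylp A)" "z = cone_proj f A q"
    by blast
  then obtain x t a where xta: "(x, t, a) \<in> axes X (cylp A)" "z = cone_proj f A (x, t, a)"
    by (cases q) auto
  have "f a \<in> topspace (fst X)"
    using assms(1) xta(1) bases continuous_map_funspace[of "fst A" "fst X" f] by (auto simp: pmap_def axes_def)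
  then show ?thesis
    using xta bases base[of x] base[of "f a"] cone[of t a]
    by (auto simp: cone_proj_def axes_def split: if_splits)
qed

lemma pspace_mcone: "pspace (mcone f A X)"
proof -
  have "cone_proj f A (snd X, 0, snd A) = (snd X, 0, snd A)"
    by (simp add: cone_proj_def)
  then show ?thesis
    using quotient_imp_surjective_map[OF quotient_map_mcone[of X A f]] bases
    by (force simp: pspace_def topspace_wedge[OF X pspace_cylp[OF A]] axes_def)
qed

lemma continuous_map_mcone_base: "continuous_map (fst X) (fst (mcone f A X)) (\<lambda>x. (x, 0, snd A))"
proof -
  have "continuous_map (fst X) (fst (wedge X (cylp A))) (\<lambda>x. (x, 0, snd A))"
    using continuous_map_into_wedge(1)[OF X pspace_cylp[OF A]] by simp
  from continuous_map_compose[OF this quotient_imp_continuous_map[OF quotient_map_mcone]]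
  show ?thesis
    by (simp add: o_def cone_proj_def)
qed

lemma continuous_map_mcone_cone: "continuous_map (cyl (fst A)) (fst (mcone f A X)) (\<lambda>p. cone_proj f A (snd X, p))"
proof -
  have "continuous_map (cyl (fst A)) (fst (wedge X (cylp A))) (\<lambda>p. (snd X, p))"
    using continuous_map_into_wedge(2)[OF X pspace_cylp[OF A]] by simp
  from continuous_map_compose[OF this quotient_imp_continuous_map[OF quotient_map_mcone]]
  show ?thesis
    by (simp add: o_def)
qed

text \<open>\<open>K0\<close>, \<open>K1\<close> and \<open>Kb\<close> are the matching conditions
  for the three identifications made by \<open>cone_proj\<close>: gluing along \<open>f\<close>,
  collapsing the far end, and collapsing the line over the base point. Under them the glued function
  is unchanged by \<open>cone_proj\<close>.\<close>

lemma continuous_map_cone_ext: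
  assumes f: "pmap A X f" and H: "continuous_map (cyl (fst X)) Z H"
    and K: "continuous_map (cyl (cyl (fst A))) Z K"
    and K0: "\<And>s a. s \<in> {0..1} \<Longrightarrow> a \<in> topspace (fst A) \<Longrightarrow> K (s, 0, a) = H (s, f a)"
    and K1: "\<And>s a. s \<in> {0..1} \<Longrightarrow> a \<in> topspace (fst A) \<Longrightarrow> K (s, 1, a) = H (s, snd X)"
    and Kb: "\<And>s t. s \<in> {0..1} \<Longrightarrow> t \<in> {0..1} \<Longrightarrow> K (s, t, snd A) = H (s, snd X)"
  shows "continuous_map (cyl (fst (mcone f A X))) Z (cone_ext A H K)"
proof (rule continuous_compose_quotient_map[OF quotient_map_cyl[OF quotient_map_mcone]])
  have f0: "f (snd A) = snd X"
    using f by (simp add: pmap_def)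
  have "continuous_map (cyl (fst (wedge X (cylp A)))) Z (cone_ext A H K)"
  proof (rule continuous_map_wedge_prod[OF X pspace_cylp[OF A]])
    show "continuous_map (cyl (fst X)) Z (\<lambda>p. cone_ext A H K (fst p, snd p, snd (cylp A)))"
      using H by (simp add: cone_ext_def)
    show "continuous_map (cyl (fst (cylp A))) Z (\<lambda>p. cone_ext A H K (fst p, snd X, snd p))"
      using K by (simp, elim continuous_map_eq) (auto simp: cone_ext_def Kb)
  qed
  then show "continuous_map (cyl (fst (wedge X (cylp A)))) Z (cone_ext A H K \<circ> (\<lambda>(t, x). (t, cone_proj f A x)))"
  proof (rule continuous_map_eq)
    fix q assume "q \<in> topspace (cyl (fst (wedge X (cylp A))))"
    then show "cone_ext A H K q = (cone_ext A H K \<circ> (\<lambda>(t, x). (t, cone_proj f A x))) q"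
      by (auto simp: topspace_wedge[OF X pspace_cylp[OF A]] axes_def cone_ext_def cone_proj_def K0 K1 Kb f0)
  qed
qed

lemma continuous_map_cone_ext0:
  assumes f: "pmap A X f" and u: "continuous_map (fst X) Z u"
    and w: "continuous_map (cyl (fst A)) Z w"
    and "\<And>a. a \<in> topspace (fst A) \<Longrightarrow> w (0, a) = u (f a)"
    and "\<And>a. a \<in> topspace (fst A) \<Longrightarrow> w (1, a) = u (snd X)"
    and "\<And>t. t \<in> {0..1} \<Longrightarrow> w (t, snd A) = u (snd X)"
  shows "continuous_map (fst (mcone f A X)) Z (\<lambda>z. cone_ext A (\<lambda>p. u (snd p)) (\<lambda>p. w (snd p)) (0, z))"
proof (rule continuous_map_cyl_snd)
  have "continuous_map (cyl (fst (mcone f A X))) Z (cone_ext A (\<lambda>p. u (snd p)) (\<lambda>p. w (snd p)))"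
    by (rule continuous_map_cone_ext[OF f])
       (use assms in \<open>auto intro: continuous_map_cyl_snd_intro\<close>)
  then show "continuous_map (cyl (fst (mcone f A X))) Z (\<lambda>p. cone_ext A (\<lambda>p. u (snd p)) (\<lambda>p. w (snd p)) (0, snd p))"
    by (rule continuous_map_eq) (auto simp: cone_ext_def)
qed

lemma cone_ext_cone_proj:
  assumes "pmap A X f" "a \<in> topspace (fst A)" "t \<in> {0..1}"
    and "\<And>a. a \<in> topspace (fst A) \<Longrightarrow> K (s, 0, a) = H (s, f a)"
    and "\<And>a. a \<in> topspace (fst A) \<Longrightarrow> K (s, 1, a) = H (s, snd X)"
    and "\<And>t. t \<in> {0..1} \<Longrightarrow> K (s, t, snd A) = H (s, snd X)"
  shows "cone_ext A H K (s, cone_proj f A (snd X, t, a)) = K (s, t, a)"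
  using assms by (auto simp: cone_ext_def cone_proj_def)

text \<open>The cone on \<open>f\<close> preceded by a homotopy that starts at \<open>f\<close>, traversed backwards.\<close>

definition cone_path :: "('a \<Rightarrow> 'b) \<Rightarrow> (real \<times> 'a \<Rightarrow> 'b) \<Rightarrow> real \<times> 'a \<Rightarrow> 'b \<times> real \<times> 'a" where
  "cone_path f h = (\<lambda>p. if fst p \<le> 0 then (h (- fst p, snd p), 0, snd A)
     else cone_proj f A (snd X, fst p, snd p))"

lemma continuous_map_cone_path:
  assumes f: "pmap A X f" and h: "continuous_map (cyl (fst A)) (fst X) h"
    and h0: "\<And>a. a \<in> topspace (fst A) \<Longrightarrow> h (0, a) = f a"
  shows "continuous_map (prod_topology (top_of_set {-1..1}) (fst A)) (fst (mcone f A X)) (cone_path f h)"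
  unfolding cone_path_def
proof (rule continuous_map_cases_le)
  let ?P = "prod_topology (top_of_set {-1..1::real}) (fst A)"
  show fst: "continuous_map ?P euclideanreal fst"
    using continuous_map_fst continuous_map_in_subtopology by blast
  show "continuous_map ?P euclideanreal (\<lambda>p. 0)"
    by simp
  have "continuous_map (subtopology ?P {p \<in> topspace ?P. fst p \<le> 0}) (cyl (fst A)) (\<lambda>p. (- fst p, snd p))"
    using fst by (intro continuous_map_pair_real continuous_intros continuous_map_from_subtopology) auto
  from continuous_map_compose[OF continuous_map_compose[OF this h] continuous_map_mcone_base]
  show "continuous_map (subtopology ?P {p \<in> topspace ?P. fst p \<le> 0}) (fst (mcone f A X))
      (\<lambda>p. (h (- fst p, snd p), 0, snd A))"
    by (simp add: o_def)
  have "continuous_map (subtopology ?P {p \<in> topspace ?P. 0 \<le> fst p}) (cyl (fst A)) (\<lambda>p. (fst p, snd p))"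
    using fst by (intro continuous_map_pair_real continuous_intros continuous_map_from_subtopology) auto
  from continuous_map_compose[OF this continuous_map_mcone_cone]
  show "continuous_map (subtopology ?P {p \<in> topspace ?P. 0 \<le> fst p}) (fst (mcone f A X))
      (\<lambda>p. cone_proj f A (snd X, fst p, snd p))"
    by (simp add: o_def)
qed (use f h0 in \<open>auto simp: cone_proj_def pmap_def\<close>)

text \<open>The map of cones induced by a homotopy of attaching maps: the identity on
  \<open>X\<close>, while the cone coordinate is stretched from [0,1] to [-1,1] by
  \<open>2 * t - 1\<close>, so that its first half runs along the homotopy and its second half along
  the cone on \<open>g\<close>.\<close>

definition cone_map :: "('a \<Rightarrow> 'b) \<Rightarrow> (real \<times> 'a \<Rightarrow> 'b) \<Rightarrow> 'b \<times> real \<times> 'a \<Rightarrow> 'b \<times> real \<times> 'a" where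
  "cone_map g h = (\<lambda>z. cone_ext A (\<lambda>p. (snd p, 0, snd A))
     (\<lambda>p. cone_path g h (2 * fst (snd p) - 1, snd (snd p))) (0, z))"

context
  fixes f g :: "'a \<Rightarrow> 'b" and h k :: "real \<times> 'a \<Rightarrow> 'b"
  assumes f: "pmap A X f" and g: "pmap A X g"
    and h: "continuous_map (cyl (fst A)) (fst X) h"
    and k: "continuous_map (cyl (fst A)) (fst X) k"
    and h0: "\<And>a. a \<in> topspace (fst A) \<Longrightarrow> h (0, a) = f a"
    and h1: "\<And>a. a \<in> topspace (fst A) \<Longrightarrow> h (1, a) = g a"
    and hb: "\<And>t. t \<in> {0..1} \<Longrightarrow> h (t, snd A) = snd X"
    and k_def: "\<And>t a. t \<in> {0..1} \<Longrightarrow> a \<in> topspace (fst A) \<Longrightarrow> k (t, a) = h (1 - t, a)"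
begin

lemma kb: "t \<in> {0..1} \<Longrightarrow> k (t, snd A) = snd X"
  using hb[of "1 - t"] k_def[of t "snd A"] bases by auto

lemma cone_path_k:
  shows "a \<in> topspace (fst A) \<Longrightarrow> cone_path g k (-1, a) = (f a, 0, snd A)"
    and "a \<in> topspace (fst A) \<Longrightarrow> cone_path g k (1, a) = (snd X, 0, snd A)"
    and "r \<in> {-1..1} \<Longrightarrow> cone_path g k (r, snd A) = (snd X, 0, snd A)"
  using h0 kb[of "- r"] by (auto simp: cone_path_def cone_proj_def k_def)

lemma cone_path_h:
  shows "a \<in> topspace (fst A) \<Longrightarrow> cone_path f h (0, a) = (f a, 0, snd A)"
    and "a \<in> topspace (fst A) \<Longrightarrow> cone_path f h (1, a) = (snd X, 0, snd A)"
    and "a \<in> topspace (fst A) \<Longrightarrow> cone_path f h (-1, a) = (g a, 0, snd A)"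
    and "r \<in> {-1..1} \<Longrightarrow> cone_path f h (r, snd A) = (snd X, 0, snd A)"
  using h0 h1 hb[of "- r"] by (auto simp: cone_path_def cone_proj_def)

lemma pmap_cone_map: "pmap (mcone f A X) (mcone g A X) (cone_map g k)"
  unfolding pmap_def
proof
  have "continuous_map (cyl (fst A)) (prod_topology (top_of_set {-1..1}) (fst A)) (\<lambda>p. (2 * fst p - 1, snd p))"
    by (intro continuous_map_pair_real continuous_intros continuous_map_fst[THEN continuous_map_into_fulltopology]) auto
  moreover have "continuous_map (prod_topology (top_of_set {-1..1}) (fst A)) (fst (mcone g A X)) (cone_path g k)"
    by (rule continuous_map_cone_path[OF g k]) (use h1 k_def in auto)
  ultimately have "continuous_map (cyl (fst A)) (fst (mcone g A X)) (\<lambda>p. cone_path g k (2 * fst p - 1, snd p))"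
    using continuous_map_compose by (fastforce simp: o_def)
  from continuous_map_cone_ext0[OF f continuous_map_mcone_base this]
  show "continuous_map (fst (mcone f A X)) (fst (mcone g A X)) (cone_map g k)"
    unfolding cone_map_def by (auto simp: cone_path_k)
qed (simp add: cone_map_def cone_ext_def)

lemma cone_map_base: "cone_map g k (x, 0, snd A) = (x, 0, snd A)"
  by (simp add: cone_map_def cone_ext_def)

lemma cone_map_homotopy:
  obtains K where "continuous_map (cyl (fst (mcone f A X))) (fst (mcone f A X)) K"
    "\<And>z. z \<in> topspace (fst (mcone f A X)) \<Longrightarrow> K (0, z) = cone_map f h (cone_map g k z)"
    "\<And>z. z \<in> topspace (fst (mcone f A X)) \<Longrightarrow> K (1, z) = z"
    "\<And>t. t \<in> {0..1} \<Longrightarrow> K (t, snd (mcone f A X)) = snd (mcone f A X)"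
proof -
  \<comment> \<open>Over a point \<open>a\<close> the composite follows \<open>cone_path f h\<close>
    from 0 back to -1 while t \<le> 1/2, and forward from -1 to 1 afterwards, at positions
    \<open>- (2 * t)\<close> and \<open>4 * t - 3\<close>; the larger of the two is the active one.
    \<open>\<theta>\<close> deforms this detour linearly to the straight run \<open>t\<close>, with
    both endpoints fixed.\<close>
  define \<theta> where "\<theta> = (\<lambda>s t::real. (1 - s) * max (- (2 * t)) (4 * t - 3) + s * t)"
  have \<theta>: "\<theta> s t \<in> {-1..1}" if "s \<in> {0..1}" "t \<in> {0..1}" for s t
  proof -
    have "(1 - s) * max (- (2 * t)) (4 * t - 3) \<le> (1 - s) * 1"
      by (rule mult_left_mono) (use that in auto)
    moreover have "(1 - s) * (-1) \<le> (1 - s) * max (- (2 * t)) (4 * t - 3)"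
      by (rule mult_left_mono) (use that in auto)
    moreover have "0 \<le> s * t" "s * t \<le> s * 1"
      using that by (auto intro: mult_left_le)
    ultimately show ?thesis
      using that by (auto simp: \<theta>_def)
  qed
  have \<theta>01: "\<theta> s 0 = 0" "\<theta> s 1 = 1" for s
    by (auto simp: \<theta>_def)
  define K where "K = (\<lambda>p. cone_path f h (\<theta> (fst p) (fst (snd p)), snd (snd p)))"
  let ?C = "fst (mcone f A X)"
  note c1 = continuous_map_cyl_cyl(1)[of "fst A"] and c2 = continuous_map_cyl_cyl(2)[of "fst A"]
    and c3 = continuous_map_cyl_cyl(3)[of "fst A"]
  have "continuous_map (cyl (cyl (fst A))) (prod_topology (top_of_set {-1..1}) (fst A))
      (\<lambda>p. (\<theta> (fst p) (fst (snd p)), snd (snd p)))"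
  proof (rule continuous_map_pair_real[OF _ _ c3])
    show "continuous_map (cyl (cyl (fst A))) euclideanreal (\<lambda>p. \<theta> (fst p) (fst (snd p)))"
      unfolding \<theta>_def by (intro continuous_intros continuous_map_real_max c1 c2)
  qed (use \<theta> in auto)
  from continuous_map_compose[OF this continuous_map_cone_path[OF f h h0]]
  have Kc: "continuous_map (cyl (cyl (fst A))) ?C K"
    by (simp add: o_def K_def)
  have Hc: "continuous_map (cyl (fst X)) ?C (\<lambda>p. (snd p, 0, snd A))"
    by (rule continuous_map_cyl_snd_intro[OF continuous_map_mcone_base])
  have cont: "continuous_map (cyl ?C) ?C (cone_ext A (\<lambda>p. (snd p, 0, snd A)) K)"
    by (rule continuous_map_cone_ext[OF f Hc Kc]) (use \<theta> in \<open>auto simp: K_def \<theta>01 cone_path_h\<close>)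
  show ?thesis
  proof (rule that[OF cont])
    fix z assume "z \<in> topspace ?C"
    then show "cone_ext A (\<lambda>p. (snd p, 0, snd A)) K (0, z) = cone_map f h (cone_map g k z)"
    proof (cases rule: mcone_cases[OF f, consumes 1, case_names base cone])
      case (cone t a)
      have e: "cone_map g k z = cone_path g k (2 * t - 1, a)"
        using cone by (simp add: cone_map_def cone_ext_def)
      show ?thesis
      proof (cases "t \<le> 1/2")
        case True
        then have "cone_map g k z = (h (2 * t, a), 0, snd A)"
          unfolding e using cone k_def[of "1 - 2 * t" a] by (simp add: cone_path_def)
        moreover have "\<theta> 0 t = - (2 * t)"
          using True by (simp add: \<theta>_def max_def)
        ultimately show ?thesis
          using cone by (simp add: cone_ext_def K_def cone_path_def cone_map_def)
      next
        case False
        then have "cone_map g k z = cone_proj g A (snd X, 2 * t - 1, a)"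
          unfolding e by (simp add: cone_path_def)
        moreover have "cone_map f h (cone_proj g A (snd X, 2 * t - 1, a)) = cone_path f h (2 * (2 * t - 1) - 1, a)"
          unfolding cone_map_def
          by (subst cone_ext_cone_proj[OF g]) (use False cone in \<open>auto simp: cone_path_h\<close>)
        ultimately show ?thesis
          using cone False by (simp add: cone_ext_def K_def \<theta>_def max_def algebra_simps)
      qed
    qed (simp add: cone_ext_def cone_map_base cone_map_def)
  next
    fix z assume "z \<in> topspace ?C"
    then show "cone_ext A (\<lambda>p. (snd p, 0, snd A)) K (1, z) = z"
      by (cases rule: mcone_cases[OF f, consumes 1, case_names base cone]) (auto simp: cone_ext_def K_def \<theta>_def cone_path_def cone_proj_def)
  next
    fix t :: real assume "t \<in> {0..1}"
    then show "cone_ext A (\<lambda>p. (snd p, 0, snd A)) K (t, snd (mcone f A X)) = snd (mcone f A X)"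
      by (simp add: cone_ext_def)
  qed
qed

end

lemma mcone_pequiv:
  assumes f: "pmap A X f" and g: "pmap A X g" and "phomotopic A X f g"
  shows "mcone f A X \<simeq>\<^sub>* mcone g A X"
proof -
  obtain h where h: "continuous_map (cyl (fst A)) (fst X) h" "\<And>a. h (0, a) = f a" "\<And>a. h (1, a) = g a"
    "\<And>t. t \<in> {0..1} \<Longrightarrow> h (t, snd A) = snd X"
    using assms(3) by (rule phomotopicE) auto
  \<comment> \<open>Reversing the homotopy exchanges the roles of \<open>f\<close> and
    \<open>g\<close>, so one lemma yields both composites.\<close>
  define k where "k = (\<lambda>p. h (1 - fst p, snd p))"
  have "continuous_map (cyl (fst A)) (cyl (fst A)) (\<lambda>p. (1 - fst p, snd p))"
    by (intro continuous_map_pair_real continuous_intros continuous_map_fst[THEN continuous_map_into_fulltopology]) auto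
  from continuous_map_compose[OF this h(1)] have k: "continuous_map (cyl (fst A)) (fst X) k"
    by (simp add: k_def o_def)
  have kh: "k (t, a) = h (1 - t, a)" "h (t, a) = k (1 - t, a)" for t a
    by (simp_all add: k_def)
  have k': "\<And>a. k (0, a) = g a" "\<And>a. k (1, a) = f a" "\<And>t. t \<in> {0..1} \<Longrightarrow> k (t, snd A) = snd X"
    using h by (auto simp: k_def)
  obtain H where H: "continuous_map (cyl (fst (mcone f A X))) (fst (mcone f A X)) H"
    "\<And>z. z \<in> topspace (fst (mcone f A X)) \<Longrightarrow> H (0, z) = cone_map f h (cone_map g k z)"
    "\<And>z. z \<in> topspace (fst (mcone f A X)) \<Longrightarrow> H (1, z) = z"
    "\<And>t. t \<in> {0..1} \<Longrightarrow> H (t, snd (mcone f A X)) = snd (mcone f A X)"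
    using cone_map_homotopy[OF f g h(1) k h(2,3,4) kh(1)] by metis
  obtain K where K: "continuous_map (cyl (fst (mcone g A X))) (fst (mcone g A X)) K"
    "\<And>z. z \<in> topspace (fst (mcone g A X)) \<Longrightarrow> K (0, z) = cone_map g k (cone_map f h z)"
    "\<And>z. z \<in> topspace (fst (mcone g A X)) \<Longrightarrow> K (1, z) = z"
    "\<And>t. t \<in> {0..1} \<Longrightarrow> K (t, snd (mcone g A X)) = snd (mcone g A X)"
    using cone_map_homotopy[OF g f k h(1) k' kh(2)] by metis
  show ?thesis
    by (rule pequivI[OF pspace_mcone pspace_mcone pmap_cone_map[OF f g h(1) k h(2,3,4) kh(1)]
          pmap_cone_map[OF g f k h(1) k' kh(2)] H K])
qed

text \<open>For a constant map the attaching end is collapsed to the base point too, so on the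
  cylinder \<open>cone_proj\<close> is the collapsing map of the reduced suspension. Even the chosen
  representatives agree, and the identity is a homeomorphism.\<close>

lemma mcone_trivial: "mcone (\<lambda>_. snd X) A X \<simeq>\<^sub>* wedge X (susp A)"
proof -
  let ?c = "\<lambda>_::'a. snd X"
  have c: "pmap A X ?c"
    using bases by (simp add: pmap_def)
  have col: "cone_proj ?c A (snd X, t, a) = (snd X, collapse (cylp A) (susp_set A) (t, a))"
    if "t \<in> {0..1}" "a \<in> topspace (fst A)" for t a
    using that by (auto simp: cone_proj_def collapse_def)
  have 1: "continuous_map (fst (mcone ?c A X)) (fst (wedge X (susp A))) (\<lambda>z. z)"
  proof -
    have "continuous_map (cyl (fst A)) (fst (susp A)) (collapse (cylp A) (susp_set A))"
      using pmap_collapse[of "cylp A" "susp_set A"] by (simp add: pmap_def susp_eq)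
    from continuous_map_compose[OF this continuous_map_into_wedge(2)[OF X pspace_susp[OF A]]]
    have w: "continuous_map (cyl (fst A)) (fst (wedge X (susp A))) (\<lambda>p. (snd X, collapse (cylp A) (susp_set A) p))"
      by (simp add: o_def)
    have u: "continuous_map (fst X) (fst (wedge X (susp A))) (\<lambda>x. (x, 0, snd A))"
      using continuous_map_into_wedge(1)[OF X pspace_susp[OF A]] by simp
    have "continuous_map (fst (mcone ?c A X)) (fst (wedge X (susp A)))
      (\<lambda>z. cone_ext A (\<lambda>p. (snd p, 0, snd A)) (\<lambda>p. (snd X, collapse (cylp A) (susp_set A) (snd p))) (0, z))"
      by (rule continuous_map_cone_ext0[OF c u w]) (auto simp: collapse_def bases)
    then show ?thesis
    proof (rule continuous_map_eq)
      fix z assume "z \<in> topspace (fst (mcone ?c A X))"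
      then show "cone_ext A (\<lambda>p. (snd p, 0, snd A)) (\<lambda>p. (snd X, collapse (cylp A) (susp_set A) (snd p))) (0, z) = z"
        by (cases rule: mcone_cases[OF c, consumes 1, case_names base cone]) (auto simp: cone_ext_def collapse_def)
    qed
  qed
  have 2: "continuous_map (fst (wedge X (susp A))) (fst (mcone ?c A X)) (\<lambda>z. z)"
  proof (rule continuous_map_wedge[OF X pspace_susp[OF A]])
    show "continuous_map (fst X) (fst (mcone ?c A X)) (\<lambda>x. (x, snd (susp A)))"
      using continuous_map_mcone_base by simp
    have "continuous_map (fst (susp A)) (fst (mcone ?c A X)) (\<lambda>p. cone_proj ?c A (snd X, p))"
      unfolding susp_eq
      by (rule continuous_map_pquot[OF pspace_cylp[OF A]])
         (use continuous_map_mcone_cone[of ?c] in \<open>auto simp: cone_proj_def\<close>)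
    then show "continuous_map (fst (susp A)) (fst (mcone ?c A X)) (\<lambda>y. (snd X, y))"
    proof (rule continuous_map_eq)
      fix p assume p: "p \<in> topspace (fst (susp A))"
      then show "cone_proj ?c A (snd X, p) = (snd X, p)"
        using topspace_suspD[OF A p] col[of "fst p" "snd p"] by simp
    qed
  qed
  show ?thesis
    by (rule phomeo_imp_pequiv[where f="\<lambda>z. z" and g="\<lambda>z. z", OF pspace_mcone pspace_wedge[OF X pspace_susp[OF A]]])
       (use 1 2 in \<open>auto simp: pmap_def\<close>)
qed

text \<open>The reduced mapping cylinder is a universal test space; hence the target type of the
  homotopies does not matter.\<close>

lemma pointed_HEP_extend:
  fixes Z :: "'c pspace"
  assumes i: "inclusion_map A X i" and g: "continuous_map (fst X) (fst Z) g" "g (snd X) = snd Z"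
    and h: "continuous_map (cyl (fst A)) (fst Z) h"
    and h0: "\<And>a. a \<in> topspace (fst A) \<Longrightarrow> h (0, a) = g (i a)"
    and hb: "\<And>t. t \<in> {0..1} \<Longrightarrow> h (t, snd A) = snd Z"
  obtains H where "continuous_map (cyl (fst X)) (fst Z) H"
    "\<And>x. x \<in> topspace (fst X) \<Longrightarrow> H (0, x) = g x"
    "\<And>t a. t \<in> {0..1} \<Longrightarrow> a \<in> topspace (fst A) \<Longrightarrow> H (t, i a) = h (t, a)"
proof -
  have inj: "inj_on i (topspace (fst A))" and i0: "i (snd A) = snd X"
    and hep: "pointed_HEP A X i"
    using i by (auto simp: inclusion_map_def pmap_def embedding_map_def dest: homeomorphic_imp_injective_map)
  \<comment> \<open>The reduced mapping cylinder is realized in \<open>real \<times> 'b\<close>: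
    \<open>(0, x)\<close> for points of \<open>X\<close> and \<open>(t, i a)\<close> for the
    cylinder. At \<open>t = 0\<close> the cylinder is glued to \<open>X\<close>, and injectivity of
    \<open>i\<close> keeps its points apart elsewhere.\<close>
  define \<phi> where "\<phi> = (\<lambda>(x, t::real, a). if a = snd A then (0, x) else (t, i a))"
  let ?W = "fst (wedge X (cylp A))"
  define C where "C = (quot_topology ?W \<phi>, (0::real, snd X))"
  have q: "quotient_map ?W (fst C) \<phi>"
    by (simp add: C_def quotient_map_quot_topology)
  have gC: "continuous_map (fst X) (fst C) (\<lambda>x. (0, x))"
    using continuous_map_compose[OF continuous_map_into_wedge(1)[OF X pspace_cylp[OF A]] quotient_imp_continuous_map[OF q]]
    by (simp add: o_def \<phi>_def)
  have hC: "continuous_map (cyl (fst A)) (fst C) (\<lambda>p. \<phi> (snd X, p))"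
    using continuous_map_compose[OF continuous_map_into_wedge(2)[OF X pspace_cylp[OF A]] quotient_imp_continuous_map[OF q]]
    by (simp add: o_def)
  have "pspace C \<and> pmap X C (\<lambda>x. (0, x))"
    using gC bases continuous_map_funspace[OF gC] by (auto simp: pspace_def pmap_def C_def)
  moreover have "\<forall>a\<in>topspace (fst A). \<phi> (snd X, 0, a) = (0, i a)" "\<forall>t\<in>{0..1}. \<phi> (snd X, t, snd A) = snd C"
    using i0 by (auto simp: \<phi>_def C_def)
  ultimately obtain H where H: "continuous_map (cyl (fst X)) (fst C) H"
    "\<And>x. x \<in> topspace (fst X) \<Longrightarrow> H (0, x) = (0, x)"
    "\<And>t a. t \<in> {0..1} \<Longrightarrow> a \<in> topspace (fst A) \<Longrightarrow> H (t, i a) = \<phi> (snd X, t, a)"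
    using hep[unfolded pointed_HEP_def, rule_format, of C "\<lambda>x. (0, x)" "\<lambda>p. \<phi> (snd X, p)"] hC by auto
  \<comment> \<open>\<open>g\<close> and \<open>h\<close> together give a map from the mapping
    cylinder to \<open>Z\<close>, along which the extension found in the cylinder is pushed forward;
    \<open>inv_into\<close> recovers the point of \<open>A\<close>.\<close>
  define k where "k = (\<lambda>(t, x). if t = 0 then g x else h (t, inv_into (topspace (fst A)) i x))"
  have k\<phi>: "k (\<phi> (snd X, t, a)) = h (t, a)" if "t \<in> {0..1}" "a \<in> topspace (fst A)" for t a
    using that h0[of a] hb[of t] g(2) i0 inj by (auto simp: k_def \<phi>_def inv_into_f_f)
  have k: "continuous_map (fst C) (fst Z) k"
  proof (rule continuous_compose_quotient_map[OF q], rule continuous_map_wedge[OF X pspace_cylp[OF A]])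
    show "continuous_map (fst X) (fst Z) (\<lambda>x. (k \<circ> \<phi>) (x, snd (cylp A)))"
      using g(1) by (simp add: \<phi>_def k_def)
    show "continuous_map (fst (cylp A)) (fst Z) (\<lambda>y. (k \<circ> \<phi>) (snd X, y))"
      using h by (simp, elim continuous_map_eq) (auto simp: k\<phi>)
  qed
  show ?thesis
    by (rule that[OF continuous_map_compose[OF H(1) k]]) (auto simp: H k\<phi>, simp add: k_def)
qed

text \<open>The extension property, applied to the cone over \<open>A\<close> as a homotopy in the
  mapping cone, moves \<open>X\<close> inside the mapping cone so that the image of \<open>A\<close>
  ends at the tip; the end map \<open>v\<close> therefore factors over the quotient. Its homotopy
  inverse \<open>u\<close> collapses the cone to the base point.\<close>

lemma mcone_pquot:
  assumes i: "inclusion_map A X i"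
  shows "pquot X (i ` topspace (fst A)) \<simeq>\<^sub>* mcone i A X"
proof -
  let ?B = "i ` topspace (fst A)" and ?C = "mcone i A X"
  have f: "pmap A X i" and i0: "i (snd A) = snd X"
    using i by (simp_all add: inclusion_map_def pmap_def)
  have B: "snd X \<in> ?B"
    using i0 bases by force
  obtain G where G: "continuous_map (cyl (fst X)) (fst ?C) G"
    "\<And>x. x \<in> topspace (fst X) \<Longrightarrow> G (0, x) = (x, 0, snd A)"
    "\<And>t a. t \<in> {0..1} \<Longrightarrow> a \<in> topspace (fst A) \<Longrightarrow> G (t, i a) = cone_proj i A (snd X, t, a)"
    by (rule pointed_HEP_extend[OF i continuous_map_mcone_base[of i] _ continuous_map_mcone_cone[of i]])
       (auto simp: cone_proj_def i0)
  have Gb: "G (t, snd X) = (snd X, 0, snd A)" if "t \<in> {0..1}" for t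
    using G(3)[of t "snd A"] that bases by (simp add: i0 cone_proj_def)
  have G1: "G (1, b) = (snd X, 0, snd A)" if "b \<in> ?B" for b
    using that G(3)[of 1] by (auto simp: cone_proj_def)
  define v where "v = (\<lambda>x. G (1, x))"
  have v: "pmap (pquot X ?B) ?C v"
  proof (rule pmap_pquot[OF X])
    show "pmap X ?C v"
      using continuous_map_o_Pair[OF G(1), of 1] Gb by (simp add: pmap_def v_def o_def)
  qed (use G1 in \<open>simp add: v_def\<close>)
  define u where "u = (\<lambda>z::'b \<times> real \<times> 'a. cone_ext A (\<lambda>p. collapse X ?B (snd p)) (\<lambda>p. snd X) (0, z))"
  have u: "pmap ?C (pquot X ?B) u"
  proof -
    have "continuous_map (fst ?C) (fst (pquot X ?B)) u"
      unfolding u_def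
      by (rule continuous_map_cone_ext0[OF f, of _ "collapse X ?B" "\<lambda>p. snd X"])
         (use pmap_collapse[of X ?B] B pspace_pquot[OF X, of ?B] in \<open>auto simp: pmap_def collapse_def pspace_def\<close>)
    then show ?thesis
      by (auto simp: pmap_def u_def cone_ext_def collapse_def)
  qed
  have uG: "u (G (t, b)) = snd X" if t: "t \<in> {0..1}" and b: "b \<in> ?B" for t b
  proof -
    obtain a where a: "a \<in> topspace (fst A)" "b = i a"
      using b by blast
    have "u (cone_proj i A (snd X, t, a)) = snd X"
      unfolding u_def by (subst cone_ext_cone_proj[OF f]) (use a t B in \<open>auto simp: collapse_def\<close>)
    then show ?thesis
      using a t G(3) by simp
  qed
  have Hc: "continuous_map (cyl (fst (pquot X ?B))) (fst (pquot X ?B)) (\<lambda>p. u (G p))"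
  proof (rule continuous_map_pquot_cyl[OF X])
    show "continuous_map (cyl (fst X)) (fst (pquot X ?B)) (\<lambda>p. u (G p))"
      using continuous_map_compose[OF G(1)] u by (fastforce simp: pmap_def o_def)
  qed (use uG B in simp)
  have uC: "u (x, 0, snd A) = collapse X ?B x" for x
    by (simp add: u_def cone_ext_def)
  \<comment> \<open>At time \<open>s\<close> the cone coordinate \<open>t\<close> has moved the
    fraction \<open>s\<close> of the way to the tip 1. At \<open>t = 0\<close> the position is
    \<open>s\<close> itself, which matches \<open>G\<close> on the image of
    \<open>A\<close>.\<close>
  define K where "K = (\<lambda>p. cone_proj i A (snd X, fst p + fst (snd p) * (1 - fst p), snd (snd p)))"
  have *: "s + t * (1 - s) \<in> {0..1}" if "s \<in> {0..1}" "t \<in> {0..1}" for s t :: real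
  proof -
    have "t * (1 - s) \<le> 1 * (1 - s)"
      using that by (intro mult_right_mono) auto
    then show ?thesis
      using that by auto
  qed
  note c1 = continuous_map_cyl_cyl(1)[of "fst A"] and c2 = continuous_map_cyl_cyl(2)[of "fst A"]
    and c3 = continuous_map_cyl_cyl(3)[of "fst A"]
  have "continuous_map (cyl (cyl (fst A))) (cyl (fst A)) (\<lambda>p. (fst p + fst (snd p) * (1 - fst p), snd (snd p)))"
    by (rule continuous_map_pair_real[OF _ _ c3]) (use * in \<open>auto intro!: continuous_intros c1 c2\<close>)
  from continuous_map_compose[OF this continuous_map_mcone_cone]
  have K: "continuous_map (cyl (cyl (fst A))) (fst ?C) K"
    by (simp add: K_def o_def)
  have Kc: "continuous_map (cyl (fst ?C)) (fst ?C) (cone_ext A G K)"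
    by (rule continuous_map_cone_ext[OF f G(1) K]) (use * in \<open>auto simp: K_def G(3) Gb cone_proj_def\<close>)
  have "?C \<simeq>\<^sub>* pquot X ?B"
  proof (rule pequiv_sym, unfold phomotopy_equivalent_def, intro exI conjI)
    show "phomotopic (pquot X ?B) (pquot X ?B) (u \<circ> v) id"
      unfolding phomotopic_def
    proof (rule homotopic_with_symD, fold phomotopic_def, rule phomotopicI[OF pspace_pquot[OF X] Hc])
      show "u (G (0, x)) = id x" if "x \<in> topspace (fst (pquot X ?B))" for x
        using topspace_pquotD[OF X that] by (simp add: G(2) uC)
    qed (use uG B in \<open>auto simp: v_def\<close>)
    show "phomotopic ?C ?C (v \<circ> u) id"
      unfolding phomotopic_def
    proof (rule homotopic_with_symD, fold phomotopic_def, rule phomotopicI[OF pspace_mcone Kc])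
      fix z assume z: "z \<in> topspace (fst ?C)"
      show "cone_ext A G K (0, z) = id z"
        using z by (cases rule: mcone_cases[OF f, consumes 1, case_names base cone]) (auto simp: cone_ext_def G(2) K_def cone_proj_def)
      show "cone_ext A G K (1, z) = (v \<circ> u) z"
        using z
      proof (cases rule: mcone_cases[OF f, consumes 1, case_names base cone])
        case (base x)
        then show ?thesis
          using G1 B by (simp add: cone_ext_def uC v_def collapse_def)
      next
        case (cone t a)
        then show ?thesis
          using G1[OF B] by (simp add: cone_ext_def K_def cone_proj_def u_def v_def)
      qed
    qed (simp add: cone_ext_def Gb)
  qed (fact v u)+
  then show ?thesis
    by (rule pequiv_sym)
qed

text \<open>Both sides are mapping cones, one of \<open>i\<close> and one of the constant map, and
  cones of homotopic maps are equivalent.\<close>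

lemma pquot_null_pequiv:
  assumes i: "inclusion_map A X i" and "pnull A X i"
  shows "pquot X (i ` topspace (fst A)) \<simeq>\<^sub>* wedge X (susp A)"
proof -
  have "pmap A X i" "pmap A X (\<lambda>_. snd X)"
    using i bases by (auto simp: inclusion_map_def pmap_def)
  then have "mcone i A X \<simeq>\<^sub>* mcone (\<lambda>_. snd X) A X"
    using assms(2) by (intro mcone_pequiv) (auto simp: pnull_def)
  then show ?thesis
    using mcone_pquot[OF i] mcone_trivial pequiv_trans by blast
qed

text \<open>The contraction of \<open>A\<close> extends to a homotopy \<open>G\<close> of the
  identity of \<open>X\<close>. Its end map sends the image of \<open>A\<close> to the base point
  and so provides a homotopy inverse of the collapsing map.\<close>

lemma pquot_contractible_pequiv:
  assumes i: "inclusion_map A X i" and "pcontractible A"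
  shows "pquot X (i ` topspace (fst A)) \<simeq>\<^sub>* X"
proof -
  let ?B = "i ` topspace (fst A)"
  have ic: "continuous_map (fst A) (fst X) i" and i0: "i (snd A) = snd X"
    using i by (auto simp: inclusion_map_def pmap_def)
  have B: "snd X \<in> ?B"
    using i0 bases by force
  obtain c where c: "continuous_map (cyl (fst A)) (fst A) c" "\<And>x. c (0, x) = x"
    "\<And>x. c (1, x) = snd A" "\<And>t. t \<in> {0..1} \<Longrightarrow> c (t, snd A) = snd A"
    using pcontractible_imp_phomotopic[OF assms(2)] by (rule phomotopicE) auto
  obtain G where G: "continuous_map (cyl (fst X)) (fst X) G"
    "\<And>x. x \<in> topspace (fst X) \<Longrightarrow> G (0, x) = x"
    "\<And>t a. t \<in> {0..1} \<Longrightarrow> a \<in> topspace (fst A) \<Longrightarrow> G (t, i a) = i (c (t, a))"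
    by (rule pointed_HEP_extend[OF i _ _ continuous_map_compose[OF c(1) ic], of "\<lambda>x. x"])
       (auto simp: c i0)
  have Gb: "G (t, snd X) = snd X" if "t \<in> {0..1}" for t
    using G(3)[of t "snd A"] that bases by (simp add: i0 c)
  have G1: "G (1, b) = snd X" if "b \<in> ?B" for b
    using that G(3)[of 1] by (auto simp: c i0)
  \<comment> \<open>\<open>G\<close> keeps the image of \<open>A\<close> inside itself at all times,
    so after collapsing it becomes a homotopy on the quotient.\<close>
  have GB: "G (t, b) \<in> ?B" if t: "t \<in> {0..1}" and b: "b \<in> ?B" for t b
  proof -
    obtain a where a: "a \<in> topspace (fst A)" "b = i a"
      using b by blast
    then have "c (t, a) \<in> topspace (fst A)"
      using funcset_mem[OF continuous_map_funspace[OF c(1)], of "(t, a)"] t by simp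
    then show ?thesis
      using a G(3)[of t a] t by simp
  qed
  define v where "v = (\<lambda>x. G (1, x))"
  have vX: "pmap X X v"
    using continuous_map_o_Pair[OF G(1), of 1] Gb by (simp add: pmap_def v_def o_def)
  have v: "pmap (pquot X ?B) X v"
    by (rule pmap_pquot[OF X vX]) (use G1 in \<open>simp add: v_def\<close>)
  have Hc: "continuous_map (cyl (fst (pquot X ?B))) (fst (pquot X ?B)) (\<lambda>p. collapse X ?B (G p))"
  proof (rule continuous_map_pquot_cyl[OF X])
    show "continuous_map (cyl (fst X)) (fst (pquot X ?B)) (\<lambda>p. collapse X ?B (G p))"
      using continuous_map_compose[OF G(1)] pmap_collapse[of X ?B] by (fastforce simp: pmap_def o_def)
  qed (use GB B in \<open>simp add: collapse_in\<close>)
  show ?thesis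
    unfolding phomotopy_equivalent_def
  proof (intro exI conjI)
    show "phomotopic (pquot X ?B) (pquot X ?B) (collapse X ?B \<circ> v) id"
      unfolding phomotopic_def
    proof (rule homotopic_with_symD, fold phomotopic_def, rule phomotopicI[OF pspace_pquot[OF X] Hc])
      show "collapse X ?B (G (0, x)) = id x" if "x \<in> topspace (fst (pquot X ?B))" for x
        using topspace_pquotD[OF X that] by (simp add: G(2))
    qed (use Gb B in \<open>auto simp: v_def collapse_def\<close>)
    show "phomotopic X X (v \<circ> collapse X ?B) id"
      unfolding phomotopic_def
    proof (rule homotopic_with_symD, fold phomotopic_def, rule phomotopicI[OF X G(1)])
      show "G (1, x) = (v \<circ> collapse X ?B) x" if "x \<in> topspace (fst X)" for x
        using G1 B by (simp add: v_def collapse_def)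
    qed (use Gb in \<open>auto simp: G(2)\<close>)
  qed (fact v pmap_collapse)+
qed

end

section \<open>Sequential multisets\<close>

text \<open>Index sets enter the definition of sequential partitions only through the multisets of their
  parts.\<close>

definition seqm :: "nat multiset \<Rightarrow> bool" where
  "seqm L \<longleftrightarrow> (\<forall>A B m. A \<subseteq># L \<and> B \<subseteq># L \<and> \<Sum>\<^sub># A = \<Sum>\<^sub># B \<and> m \<in># A \<and> (\<forall>x\<in>#A + B. x \<le> m) \<longrightarrow>
     (\<exists>J. J \<subseteq># B \<and> \<Sum>\<^sub># J = m))"

lemma seqmD:
  assumes "seqm L" "A \<subseteq># L" "B \<subseteq># L" "\<Sum>\<^sub># A = \<Sum>\<^sub># B" "m \<in># A" "\<And>x. x \<in># A \<Longrightarrow> x \<le> m"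
    "\<And>x. x \<in># B \<Longrightarrow> x \<le> m"
  obtains J where "J \<subseteq># B" "\<Sum>\<^sub># J = m"
proof -
  have "\<forall>x\<in>#A + B. x \<le> m"
    using assms(6,7) by auto
  then show ?thesis
    using assms(1-5) that unfolding seqm_def by blast
qed

lemma seqm_ex:
  assumes "seqm L" "A \<subseteq># L" "B \<subseteq># L" "\<Sum>\<^sub># A = \<Sum>\<^sub># B" "m \<in># A" "\<forall>x\<in>#A. x \<le> m"
    "\<forall>x\<in>#B. x \<le> m"
  shows "\<exists>J. J \<subseteq># B \<and> \<Sum>\<^sub># J = m"
  using assms unfolding seqm_def by (metis union_iff)

lemma seqm_mono: "seqm L \<Longrightarrow> L' \<subseteq># L \<Longrightarrow> seqm L'"
  unfolding seqm_def by (meson subset_mset.order_trans)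

lemma subset_mset_minusD:
  fixes A :: "'a multiset"
  assumes "A \<subseteq># add_mset c L"
  shows "A \<subseteq># L \<or> c \<in># A \<and> A - {#c#} \<subseteq># L"
proof (cases "c \<in># A")
  case True
  have "A - {#c#} \<subseteq># L"
  proof (rule mset_subset_eqI)
    fix x
    show "count (A - {#c#}) x \<le> count L x"
      using mset_subset_eq_count[OF assms, of x] by (cases "x = c") auto
  qed
  with True show ?thesis
    by simp
next
  case False
  have "A \<subseteq># L"
  proof (rule mset_subset_eqI)
    fix x
    show "count A x \<le> count L x"
      using mset_subset_eq_count[OF assms, of x] False by (cases "x = c") (auto simp: not_in_iff)
  qed
  then show ?thesis
    by simp
qed

lemma subset_mset_minus1I:
  fixes J :: "'a multiset"
  assumes "J \<subseteq># L" "m \<notin># J"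
  shows "J \<subseteq># L - {#m#}"
proof (rule mset_subset_eqI)
  fix x
  show "count J x \<le> count (L - {#m#}) x"
    using mset_subset_eq_count[OF assms(1), of x] assms(2) by (cases "x = m") (auto simp: not_in_iff)
qed

lemma sum_mset_minus1: "(c::nat) \<in># A \<Longrightarrow> \<Sum>\<^sub># A = c + \<Sum>\<^sub># (A - {#c#})"
  using sum_mset.insert[of "\<lambda>x. x" c "A - {#c#}"] by (simp add: insert_DiffM)

lemma le_sum_mset: "(x::nat) \<in># A \<Longrightarrow> x \<le> \<Sum>\<^sub># A"
  by (simp add: sum_mset_minus1)

lemma sum_mset_mono_nat: "(A::nat multiset) \<subseteq># B \<Longrightarrow> \<Sum>\<^sub># A \<le> \<Sum>\<^sub># B"
  using sum_mset.union[of A "B - A"] by (simp add: subset_mset.add_diff_inverse)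

text \<open>A relation in the merged multiset lifts to \<open>L\<close> by expanding the new copy of
  the sum back to \<open>I\<close>; copies on both sides cancel. An old copy of the sum in
  \<open>L - I\<close> settles the case where the new copy itself is the maximal element.
  \<open>E\<close> brings the answer down again: a representation of a larger part that is found in
  \<open>L\<close> cannot use elements of \<open>I\<close>.\<close>

lemma seqm_merge:
  assumes L: "seqm L" and I: "I \<subseteq># L" and c: "\<Sum>\<^sub># I \<in># L - I"
    and E: "\<And>p B i. p \<in># L \<Longrightarrow> \<Sum>\<^sub># I < p \<Longrightarrow> B \<subseteq># L - {#p#} \<Longrightarrow> \<Sum>\<^sub># B = p \<Longrightarrow> i \<in># I \<Longrightarrow> i \<notin># B"
  shows "seqm (add_mset (\<Sum>\<^sub># I) (L - I))"
  unfolding seqm_def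
proof (intro allI impI, elim conjE)
  define c where "c = \<Sum>\<^sub># I"
  fix A B m
  assume "A \<subseteq># add_mset (\<Sum>\<^sub># I) (L - I)" "B \<subseteq># add_mset (\<Sum>\<^sub># I) (L - I)"
  then have A: "A \<subseteq># add_mset c (L - I)" and B: "B \<subseteq># add_mset c (L - I)"
    by (simp_all add: c_def)
  assume sum: "\<Sum>\<^sub># A = \<Sum>\<^sub># B" and mA: "m \<in># A" and max: "\<forall>x\<in>#A + B. x \<le> m"
  have LI: "L - I \<subseteq># L"
    by simp
  note toL = subset_mset.order_trans[OF _ LI]
  note AD = subset_mset_minusD[OF A] and BD = subset_mset_minusD[OF B]
  have shrink: "C - {#c#} \<subseteq># L - I" if "C \<subseteq># L - I" for C
    using subset_mset.order_trans[OF diff_subset_eq_self that] .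
  have swap: "C - {#c#} + I \<subseteq># L" "\<Sum>\<^sub># (C - {#c#} + I) = \<Sum>\<^sub># C"
    if "c \<in># C" "C - {#c#} \<subseteq># L - I" for C
    using subset_mset.add_mono[OF that(2) subset_mset.order_refl[of I]] I sum_mset_minus1[OF that(1)]
    by (simp_all add: c_def subset_mset.diff_add)
  have Ile: "i \<le> c" if "i \<in># I" for i
    using le_sum_mset[OF that] by (simp add: c_def)
  show "\<exists>J. J \<subseteq># B \<and> \<Sum>\<^sub># J = m"
  proof (cases "m \<in># B")
    case True
    then show ?thesis
      by (intro exI[of _ "{#m#}"]) simp
  next
    case mB: False
    show ?thesis
    proof (cases "B \<subseteq># L - I")
      case B': True
      then have BL: "B \<subseteq># L"
        by (rule toL)
      show ?thesis
      proof (cases "A \<subseteq># L")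
        case True
        then show ?thesis
          using max by (intro seqm_ex[OF L True BL sum mA]) auto
      next
        case False
        then have cA: "c \<in># A" "A - {#c#} \<subseteq># L - I"
          using AD toL by blast+
        \<comment> \<open>If \<open>m = c\<close>, a single occurrence of \<open>c\<close> in
          \<open>A\<close> could be read as the old copy in \<open>L - I\<close>, and
          \<open>A\<close> would already lie in \<open>L\<close>. So the maximal element is still
          present after one \<open>c\<close> has been expanded.\<close>
        have m: "m \<in># A - {#c#}"
        proof (cases "m = c")
          case True
          show ?thesis
          proof (rule ccontr)
            assume "\<not> ?thesis"
            then have "count A c - 1 = 0" "count A c > 0"
              using cA(1) True by (auto simp: not_in_iff)
            then have "count A c = 1"
              by linarith
            have "A \<subseteq># L - I"
            proof (rule mset_subset_eqI)
              fix x
              show "count A x \<le> count (L - I) x"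
              proof (cases "x = c")
                case True
                then show ?thesis
                  using \<open>count A c = 1\<close> assms(3) by (simp add: c_def Suc_le_eq flip: count_greater_zero_iff)
              next
                case False
                then show ?thesis
                  using mset_subset_eq_count[OF cA(2), of x] by simp
              qed
            qed
            then show False
              using False toL by blast
          qed
        next
          case False
          then show ?thesis
            using mA by (simp add: in_diff_count)
        qed
        have "c \<le> m"
          using cA(1) max by auto
        show ?thesis
        proof (rule seqm_ex[OF L swap(1)[OF cA] BL])
          show "\<forall>x\<in>#A - {#c#} + I. x \<le> m"
            using max Ile \<open>c \<le> m\<close> by (auto dest: in_diffD intro: order.trans)
        qed (use m max sum swap(2)[OF cA] in auto)
      qed
    next
      case False
      then have cB: "c \<in># B" "B - {#c#} \<subseteq># L - I"
        using BD by blast+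
      then have cm: "c < m"
        using max mB by (metis le_neq_implies_less union_iff)
      show ?thesis
      proof (cases "c \<in># A")
        case True
        have A': "A - {#c#} \<subseteq># L - I"
        proof (cases "A \<subseteq># L - I")
          case True
          then show ?thesis
            by (rule shrink)
        next
          case False
          then show ?thesis
            using AD by blast
        qed
        have "m \<in># A - {#c#}"
          using mA cm by (simp add: in_diff_count)
        moreover have "\<Sum>\<^sub># (A - {#c#}) = \<Sum>\<^sub># (B - {#c#})"
          using sum sum_mset_minus1[OF True] sum_mset_minus1[OF cB(1)] by simp
        moreover have "A - {#c#} \<subseteq># L" "B - {#c#} \<subseteq># L"
          using A' cB(2) toL by blast+
        moreover have "\<forall>x\<in>#A - {#c#}. x \<le> m" "\<forall>x\<in>#B - {#c#}. x \<le> m"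
          using max by (auto dest: in_diffD)
        ultimately have "\<exists>J. J \<subseteq># B - {#c#} \<and> \<Sum>\<^sub># J = m"
          by (intro seqm_ex[OF L])
        then show ?thesis
          by (auto intro: subset_mset.order_trans[OF _ diff_subset_eq_self])
      next
        case False
        then have AL: "A \<subseteq># L"
          using AD toL by blast
        have "\<forall>x\<in>#B - {#c#} + I. x \<le> m"
          using max cm by (auto dest!: in_diffD Ile)
        then have "\<exists>J. J \<subseteq># B - {#c#} + I \<and> \<Sum>\<^sub># J = m"
          by (intro seqm_ex[OF L AL swap(1)[OF cB]]) (use max sum swap(2)[OF cB] mA in auto)
        then obtain J where J: "J \<subseteq># B - {#c#} + I" "\<Sum>\<^sub># J = m"
          by blast
        have "m \<notin># J"
        proof
          assume "m \<in># J"
          then have "m \<in># B - {#c#} + I"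
            using J(1) mset_subset_eqD by metis
          then show False
            using mB Ile cm by (meson in_diffD leD union_iff)
        qed
        have "J \<subseteq># L"
          by (rule subset_mset.order_trans[OF J(1) swap(1)[OF cB]])
        then have "J \<subseteq># L - {#m#}"
          using \<open>m \<notin># J\<close> by (rule subset_mset_minus1I)
        moreover have "m \<in># L"
          using AL mA mset_subset_eqD by metis
        \<comment> \<open>\<open>J\<close> represents \<open>m > c\<close> without using
          \<open>m\<close> itself, so \<open>E\<close> forbids all elements of \<open>I\<close> in
          it, and \<open>J\<close> lives in the unexpanded part of \<open>B\<close>.\<close>
        ultimately have disj: "i \<notin># J" if "i \<in># I" for i
          using E[of m J i] that J(2) cm by (simp add: c_def)
        have "J \<subseteq># B - {#c#}"
        proof (rule mset_subset_eqI)
          fix x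
          show "count J x \<le> count (B - {#c#}) x"
          proof (cases "x \<in># J")
            case True
            then have "count I x = 0"
              using disj by (metis not_in_iff)
            then show ?thesis
              using mset_subset_eq_count[OF J(1), of x] by simp
          qed (simp add: not_in_iff)
        qed
        then show ?thesis
          using J(2) by (auto intro: subset_mset.order_trans[OF _ diff_subset_eq_self])
      qed
    qed
  qed
qed

section \<open>Multisets of parts and index sets\<close>

definition wt :: "nat list \<Rightarrow> nat set \<Rightarrow> nat" where
  "wt l A = (\<Sum>i\<in>A. part l i)"

definition parts_of :: "nat list \<Rightarrow> nat set \<Rightarrow> nat multiset" where
  "parts_of l A = image_mset (part l) (mset_set A)"

lemma sum_parts_of [simp]: "\<Sum>\<^sub># (parts_of l A) = wt l A"
  by (simp add: parts_of_def wt_def sum_unfold_sum_mset)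

lemma set_parts_of: "finite A \<Longrightarrow> x \<in># parts_of l A \<longleftrightarrow> (\<exists>i\<in>A. x = part l i)"
  by (auto simp: parts_of_def)

lemma mset_eq_parts_of: "mset l = parts_of l {1..length l}"
proof -
  have "l = map (part l) [1..<Suc (length l)]"
    by (rule nth_equalityI) (auto simp: part_def simp del: upt_Suc)
  then have "mset l = image_mset (part l) (mset [1..<Suc (length l)])"
    by (metis mset_map)
  also have "mset [1..<Suc (length l)] = mset_set {1..length l}"
    by (metis atLeastLessThanSuc_atLeastAtMost mset_upt)
  finally show ?thesis
    by (simp add: parts_of_def)
qed

lemma parts_of_mono: "finite B \<Longrightarrow> A \<subseteq> B \<Longrightarrow> parts_of l A \<subseteq># parts_of l B"
  unfolding parts_of_def by (intro image_mset_subseteq_mono subset_imp_msubset_mset_set)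

lemma parts_of_union:
  "finite A \<Longrightarrow> finite B \<Longrightarrow> A \<inter> B = {} \<Longrightarrow> parts_of l (A \<union> B) = parts_of l A + parts_of l B"
  by (simp add: parts_of_def mset_set_Union)

text \<open>A submultiset of an image lifts to a submultiset of \<open>mset_set V\<close>, which has
  no repetitions and hence is a set. This turns statements about multisets of parts back into
  statements about indices.\<close>

lemma parts_of_subset:
  assumes "finite V" "B \<subseteq># parts_of l V"
  obtains B' where "B' \<subseteq> V" "B = parts_of l B'"
proof -
  have "parts_of l V = B + (parts_of l V - B)"
    using assms(2) by simp
  then obtain M N where "mset_set V = M + N" "B = image_mset (part l) M"
    unfolding parts_of_def by (meson image_mset_eq_plusD)
  moreover from this have "M \<subseteq># mset_set V"
    by simp
  moreover from this have "M = mset_set (set_mset M)"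
    using assms(1) by (intro multiset_eqI) (metis count_mset_set(1,3) count_mset_set' finite_set_mset
        le_zero_eq less_one mset_subset_eq_count not_in_iff le_neq_implies_less)
  moreover have "set_mset M \<subseteq> V"
    using set_mset_mono[OF \<open>M \<subseteq># mset_set V\<close>] assms(1) by simp
  ultimately show ?thesis
    using that by (metis parts_of_def)
qed

lemma seqm_index:
  assumes "seqm (mset l)" "A \<subseteq> {1..length l}" "B \<subseteq> {1..length l}" "wt l A = wt l B" "q \<in> A"
    and "\<And>x. x \<in> A \<union> B \<Longrightarrow> part l x \<le> part l q"
  obtains J where "J \<subseteq> B" "wt l J = part l q"
proof -
  have fin: "finite A" "finite B"
    using assms(2,3) finite_subset by blast+
  have "parts_of l A \<subseteq># mset l" "parts_of l B \<subseteq># mset l"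
    using assms(2,3) by (auto simp: mset_eq_parts_of intro: parts_of_mono)
  then obtain J where "J \<subseteq># parts_of l B" "\<Sum>\<^sub># J = part l q"
    by (rule seqmD[OF assms(1), of "parts_of l A" "parts_of l B" "part l q"])
       (use assms(4-6) fin in \<open>auto simp: set_parts_of\<close>)
  then show ?thesis
    using parts_of_subset[OF fin(2)] that by (metis sum_parts_of)
qed

lemma part_mono: "sorted l \<Longrightarrow> 1 \<le> i \<Longrightarrow> i \<le> j \<Longrightarrow> j \<le> length l \<Longrightarrow> part l i \<le> part l j"
  unfolding part_def by (auto intro: sorted_nth_mono)

text \<open>For sorted parts the largest index carries the largest part. If that index lies in
  \<open>B'\<close>, its part alone is the required sum; otherwise the definition applies to
  it.\<close>

lemma sequential_imp_seqm:
  assumes "sequential l"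
  shows "seqm (mset l)"
  unfolding seqm_def
proof (intro allI impI, elim conjE)
  fix A B m
  assume AB: "A \<subseteq># mset l" "B \<subseteq># mset l" and sum: "\<Sum>\<^sub># A = \<Sum>\<^sub># B" and m: "m \<in># A" and max: "\<forall>x\<in>#A + B. x \<le> m"
  obtain A' where A': "A' \<subseteq> {1..length l}" "A = parts_of l A'"
    using AB(1) parts_of_subset by (metis finite_atLeastAtMost mset_eq_parts_of)
  obtain B' where B': "B' \<subseteq> {1..length l}" "B = parts_of l B'"
    using AB(2) parts_of_subset by (metis finite_atLeastAtMost mset_eq_parts_of)
  have fin: "finite A'" "finite B'"
    using A'(1) B'(1) finite_subset by blast+
  obtain i where i: "i \<in> A'" "m = part l i"
    using m fin by (auto simp: A' set_parts_of)
  define q where "q = Max (A' \<union> B')"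
  have q: "q \<in> A' \<union> B'"
    unfolding q_def by (rule Max_in) (use i fin in auto)
  have iq: "i \<le> q"
    unfolding q_def by (rule Max_ge) (use i fin in auto)
  have "part l i \<le> part l q"
    using assms q iq i A'(1) B'(1) by (intro part_mono) (auto simp: sequential_def number_partition_def)
  moreover have "part l q \<in># A + B"
    using q fin by (auto simp: A' B' set_parts_of)
  then have "part l q \<le> m"
    using max by blast
  ultimately have mq: "part l q = m"
    using i by simp
  show "\<exists>J. J \<subseteq># B \<and> \<Sum>\<^sub># J = m"
  proof (cases "q \<in> A'")
    case True
    then obtain J where "J \<subseteq> B'" "part l q = (\<Sum>j\<in>J. part l j)"
      using assms A'(1) B'(1) sum q_def unfolding sequential_def A'(2) B'(2) sum_parts_of wt_def by metis
    then show ?thesis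
      using fin mq B'(2) by (intro exI[of _ "parts_of l J"]) (auto simp: parts_of_mono wt_def)
  next
    case False
    then have "m \<in># B"
      using q mq fin by (auto simp: B' set_parts_of)
    then show ?thesis
      by (intro exI[of _ "{#m#}"]) simp
  qed
qed

section \<open>Cuts of weight vectors\<close>

definition positive :: "nat list \<Rightarrow> bool" where
  "positive l \<longleftrightarrow> (\<forall>x\<in>set l. x > 0)"

lemma positive_part: "positive l \<Longrightarrow> i \<in> {1..length l} \<Longrightarrow> part l i > 0"
  by (auto simp: positive_def part_def)

lemma wt_eq_0: "positive l \<Longrightarrow> A \<subseteq> {1..length l} \<Longrightarrow> wt l A = 0 \<Longrightarrow> A = {}"
  using finite_subset[of A "{1..length l}"] positive_part[of l]
  by (fastforce simp: wt_def)

lemma wt_Un: "finite A \<Longrightarrow> finite B \<Longrightarrow> A \<inter> B = {} \<Longrightarrow> wt l (A \<union> B) = wt l A + wt l B"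
  by (simp add: wt_def sum.union_disjoint)

lemma wt_Diff: "finite B \<Longrightarrow> A \<subseteq> B \<Longrightarrow> wt l (B - A) = wt l B - wt l A"
  by (simp add: wt_def sum_diff_nat finite_subset)

lemma wt_mono: "finite B \<Longrightarrow> A \<subseteq> B \<Longrightarrow> wt l A \<le> wt l B"
  by (simp add: wt_def sum_mono2)

lemma wt_psubset: "positive l \<Longrightarrow> B \<subseteq> {1..length l} \<Longrightarrow> A \<subseteq> B \<Longrightarrow> wt l A = wt l B \<Longrightarrow> A = B"
  using wt_eq_0[of l "B - A"] wt_Diff[of B A l] finite_subset[of B "{1..length l}"] by auto

lemma wt_empty [simp]: "wt l {} = 0" and wt_single [simp]: "wt l {i} = part l i"
  by (simp_all add: wt_def)

lemma tern_support: "x \<in> tern n \<Longrightarrow> Plus x \<subseteq> {1..n}" "x \<in> tern n \<Longrightarrow> Minus x \<subseteq> {1..n}"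
  by (force simp: tern_def Plus_def Minus_def)+

lemma Plus_Minus_disjoint: "Plus x \<inter> Minus x = {}"
  by (auto simp: Plus_def Minus_def)

lemma sum_tern:
  assumes "x \<in> tern n" "V \<subseteq> {1..n}"
  shows "(\<Sum>i\<in>V. x i * int (part l i)) = int (wt l (Plus x \<inter> V)) - int (wt l (Minus x \<inter> V))"
proof -
  have V: "finite V"
    using assms(2) finite_subset by blast
  have "(\<Sum>i\<in>V. x i * int (part l i)) =
      (\<Sum>i\<in>V. (if i \<in> Plus x then int (part l i) else 0) - (if i \<in> Minus x then int (part l i) else 0))"
    by (rule sum.cong) (use assms in \<open>auto simp: Plus_def Minus_def tern_def\<close>)
  also have "\<dots> = int (wt l (Plus x \<inter> V)) - int (wt l (Minus x \<inter> V))"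
    by (simp add: sum_subtractf wt_def flip: sum.inter_restrict[OF V] Int_commute[of V])
  finally show ?thesis .
qed

lemma S_vec_iff: "x \<in> S_vec l \<longleftrightarrow> x \<in> tern (length l) \<and> wt l (Plus x) = wt l (Minus x)"
proof (cases "x \<in> tern (length l)")
  case True
  have "Plus x \<inter> {1..length l} = Plus x" "Minus x \<inter> {1..length l} = Minus x"
    using tern_support[OF True] by blast+
  then show ?thesis
    using sum_tern[OF True, of "{1..length l}" l] True by (simp add: S_vec_def)
qed (simp add: S_vec_def)

definition vec_of :: "nat set \<Rightarrow> nat set \<Rightarrow> vect" where
  "vec_of A B i = (if i \<in> A then 1 else if i \<in> B then -1 else 0)"

lemma vec_of:
  assumes "A \<subseteq> {1..n}" "B \<subseteq> {1..n}" "A \<inter> B = {}"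
  shows "vec_of A B \<in> tern n" "Plus (vec_of A B) = A" "Minus (vec_of A B) = B"
  using assms by (auto simp: vec_of_def tern_def Plus_def Minus_def)

section \<open>Linear spans and cuts\<close>

lemma lin_span_superset: "s \<in> S \<Longrightarrow> (\<lambda>i. real_of_int (s i)) \<in> lin_span S"
  unfolding lin_span_def by (intro CollectI exI[of _ "{s}"] exI[of _ "\<lambda>_. 1"]) auto

lemma lin_span_mono: "S \<subseteq> T \<Longrightarrow> lin_span S \<subseteq> lin_span T"
  unfolding lin_span_def by blast

lemma lin_span_add:
  assumes "v \<in> lin_span S" "w \<in> lin_span S"
  shows "(\<lambda>i. v i + w i) \<in> lin_span S"
proof -
  obtain A c where A: "finite A" "A \<subseteq> S" "v = (\<lambda>i. \<Sum>s\<in>A. c s * real_of_int (s i))"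
    using assms(1) by (auto simp: lin_span_def)
  obtain B d where B: "finite B" "B \<subseteq> S" "w = (\<lambda>i. \<Sum>s\<in>B. d s * real_of_int (s i))"
    using assms(2) by (auto simp: lin_span_def)
  define e where "e s = (if s \<in> A then c s else 0) + (if s \<in> B then d s else 0)" for s
  have "v i + w i = (\<Sum>s\<in>A \<union> B. e s * real_of_int (s i))" for i
  proof -
    have "(\<Sum>s\<in>A \<union> B. e s * real_of_int (s i)) =
        (\<Sum>s\<in>A \<union> B. (if s \<in> A then c s * real_of_int (s i) else 0)) +
        (\<Sum>s\<in>A \<union> B. (if s \<in> B then d s * real_of_int (s i) else 0))"
      unfolding sum.distrib[symmetric] by (rule sum.cong) (auto simp: e_def algebra_simps)
    also have "(\<Sum>s\<in>A \<union> B. (if s \<in> A then c s * real_of_int (s i) else 0)) = v i"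
      using A B by (subst sum.inter_restrict[symmetric]) (auto intro!: sum.cong)
    also have "(\<Sum>s\<in>A \<union> B. (if s \<in> B then d s * real_of_int (s i) else 0)) = w i"
      using A B by (subst sum.inter_restrict[symmetric]) (auto intro!: sum.cong)
    finally show ?thesis
      by simp
  qed
  then show ?thesis
    using A B unfolding lin_span_def by (intro CollectI exI[of _ "A \<union> B"] exI[of _ e]) auto
qed

lemma lin_span_scale:
  assumes "v \<in> lin_span S"
  shows "(\<lambda>i. r * v i) \<in> lin_span S"
proof -
  obtain A c where A: "finite A" "A \<subseteq> S" "v = (\<lambda>i. \<Sum>s\<in>A. c s * real_of_int (s i))"
    using assms by (auto simp: lin_span_def)
  then show ?thesis
    unfolding lin_span_def
    by (intro CollectI exI[of _ A] exI[of _ "\<lambda>s. r * c s"]) (auto simp: sum_distrib_left mult.assoc)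
qed

lemma lin_span_tspan: "lin_span (tspan n S) \<subseteq> lin_span S"
proof
  fix v assume "v \<in> lin_span (tspan n S)"
  then obtain A c where A: "finite A" "A \<subseteq> tspan n S" "v = (\<lambda>i. \<Sum>s\<in>A. c s * real_of_int (s i))"
    by (auto simp: lin_span_def)
  have "(\<lambda>i. \<Sum>s\<in>A. c s * real_of_int (s i)) \<in> lin_span S"
    using A(1,2)
  proof (induction A)
    case empty
    show ?case
      unfolding lin_span_def by (intro CollectI exI[of _ "{}"]) auto
  next
    case (insert a A)
    then have "(\<lambda>i. c a * real_of_int (a i)) \<in> lin_span S"
      by (intro lin_span_scale) (simp add: tspan_def)
    from lin_span_add[OF this insert.IH] insert show ?case
      by simp
  qed
  then show "v \<in> lin_span S"
    using A by simp
qed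

lemma tspan_superset: "S \<subseteq> tern n \<Longrightarrow> S \<subseteq> tspan n S"
  using lin_span_superset[of _ S] unfolding tspan_def by blast

lemma tspan_mono: "S \<subseteq> T \<Longrightarrow> tspan n S \<subseteq> tspan n T"
  using lin_span_mono[of S T] unfolding tspan_def by blast

lemma tspan_tspan: "S \<subseteq> tern n \<Longrightarrow> tspan n (tspan n S) = tspan n S"
proof
  show "tspan n (tspan n S) \<subseteq> tspan n S"
    using lin_span_tspan[of n S] unfolding tspan_def[of n "tspan n S"] unfolding tspan_def[of n S] by blast
  show "tspan n S \<subseteq> tspan n (tspan n S)"
    by (rule tspan_superset) (simp add: tspan_def)
qed

lemma cuts_tspan: "S \<in> cuts n \<Longrightarrow> tspan n S = S" "S \<in> cuts n \<Longrightarrow> S \<subseteq> tern n"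
  by (auto simp: cuts_def)

lemma tspan_subset_cut: "S \<in> cuts n \<Longrightarrow> R \<subseteq> S \<Longrightarrow> tspan n R \<subseteq> S"
  using tspan_mono[of R S n] cuts_tspan by blast

lemma tspan_in_cuts:
  assumes "S \<in> cuts n" "R \<subseteq> S"
  shows "tspan n R \<in> cuts n"
proof -
  have "R \<subseteq> tern n"
    using assms cuts_tspan(2) by blast
  from tspan_tspan[OF this] tspan_subset_cut[OF assms] assms(1) show ?thesis
    unfolding cuts_def by blast
qed

lemma S_vec_in_cuts:
  assumes "positive l"
  shows "S_vec l \<in> cuts (length l)"
proof -
  let ?n = "length l"
  have sub: "S_vec l \<subseteq> tern ?n"
    by (auto simp: S_vec_def)
  have "x \<in> S_vec l" if "x \<in> tspan ?n (S_vec l)" for x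
  proof -
    have "(\<lambda>i. real_of_int (x i)) \<in> lin_span (S_vec l)"
      using that by (simp add: tspan_def)
    then obtain A c where A: "finite A" "A \<subseteq> S_vec l"
      "(\<lambda>i. real_of_int (x i)) = (\<lambda>i. \<Sum>s\<in>A. c s * real_of_int (s i))"
      unfolding lin_span_def mem_Collect_eq by (elim exE conjE)
    have "real_of_int (\<Sum>i=1..?n. x i * int (part l i)) = (\<Sum>i=1..?n. (\<Sum>s\<in>A. c s * real_of_int (s i)) * real (part l i))"
      using fun_cong[OF A(3)] by simp
    also have "\<dots> = (\<Sum>s\<in>A. c s * real_of_int (\<Sum>i=1..?n. s i * int (part l i)))"
      by (simp add: sum_distrib_left sum_distrib_right mult.assoc sum.swap[of _ A])
    also have "\<dots> = 0"
      using A(2) by (intro sum.neutral ballI) (auto simp: S_vec_def subset_iff simp del: of_int_sum)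
    finally show ?thesis
      using that by (simp only: of_int_eq_0_iff) (simp add: S_vec_def tspan_def)
  qed
  then have "tspan ?n (S_vec l) = S_vec l"
    using tspan_superset[OF sub] by blast
  moreover have "Plus x \<noteq> {} \<and> Minus x \<noteq> {}" if x: "x \<in> S_vec l" "x \<noteq> (\<lambda>_. 0)" for x
  proof -
    have t: "x \<in> tern ?n" and w: "wt l (Plus x) = wt l (Minus x)"
      using x by (auto simp: S_vec_iff)
    have "Plus x = {} \<longleftrightarrow> Minus x = {}"
      using wt_eq_0[OF assms tern_support(1)[OF t]] wt_eq_0[OF assms tern_support(2)[OF t]] w by auto
    moreover have "Plus x \<union> Minus x \<noteq> {}"
      using x(2) t by (auto simp: tern_def Plus_def Minus_def fun_eq_iff)
    ultimately show ?thesis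
      by blast
  qed
  ultimately show ?thesis
    using sub by (auto simp: cuts_def)
qed

section \<open>Closures of partitions\<close>

lemma Pt_finite: "\<pi> \<in> Pt A \<Longrightarrow> finite A \<Longrightarrow> finite \<pi>"
  by (auto simp: Pt_def intro: finite_elements)

lemma Pt_block:
  assumes "\<pi> \<in> Pt A" "B \<in> \<pi>"
  shows "B \<subseteq> A" "B \<noteq> {}"
  using assms by (auto simp: Pt_def partition_on_def)

lemma Pt_disjoint: "\<pi> \<in> Pt A \<Longrightarrow> B \<in> \<pi> \<Longrightarrow> C \<in> \<pi> \<Longrightarrow> B \<noteq> C \<Longrightarrow> B \<inter> C = {}"
  by (auto simp: Pt_def partition_on_def disjoint_def)

lemma Pt_Union: "\<pi> \<in> Pt A \<Longrightarrow> \<Union>\<pi> = A"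
  by (auto simp: Pt_def partition_on_def)

text \<open>The closure of \<open>\<pi>\<close> with respect to \<open>S_vec l\<close> depends only on the weights of the blocks: exchanges
  preserve weights, and two index sets of equal weight can be exchanged in a single step.\<close>

definition block_map :: "(nat set \<Rightarrow> nat) \<Rightarrow> nat set set \<Rightarrow> nat set set \<Rightarrow> (nat set \<Rightarrow> nat set) \<Rightarrow> bool" where
  "block_map w \<pi> \<rho> f \<longleftrightarrow> f ` \<pi> \<subseteq> \<rho> \<and> (\<forall>E\<in>\<rho>. w E = (\<Sum>B\<in>{B\<in>\<pi>. f B = E}. w B))"

text \<open>An equality of image multisets amounts to a matching of the elements upstairs;
  \<open>k\<close> records the partner of each element of \<open>R\<close>.\<close>

lemma image_mset_match:
  assumes "finite R" "image_mset f (mset_set R) = image_mset g P"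
  shows "\<exists>k. P = image_mset k (mset_set R) \<and> (\<forall>E\<in>R. f E = g (k E))"
  using assms
proof (induction R arbitrary: P)
  case (insert x R)
  then have "image_mset g P = add_mset (f x) (image_mset f (mset_set R))"
    by simp
  then obtain a P1 where P: "P = add_mset a P1" "g a = f x" "image_mset g P1 = image_mset f (mset_set R)"
    by (metis msed_map_invR)
  obtain k where k: "P1 = image_mset k (mset_set R)" "\<forall>E\<in>R. f E = g (k E)"
    using insert.IH P(3) by metis
  have "image_mset (k(x := a)) (mset_set R) = image_mset k (mset_set R)"
    using insert.hyps by (intro image_mset_cong) auto
  then have "P = image_mset (k(x := a)) (mset_set (insert x R))"
    using P(1) k(1) insert.hyps by simp
  moreover have "\<forall>E\<in>insert x R. f E = g ((k(x := a)) E)"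
    using P(2) k(2) insert.hyps by auto
  ultimately show ?case
    by blast
qed auto

text \<open>Invariant of the closure: each multisubset in \<open>C\<close> owns a group of blocks of
  \<open>\<pi>\<close> of the same total weight. A join unites two groups, and an exchange along
  \<open>x\<close> keeps the weight because \<open>Plus x\<close> and \<open>Minus x\<close> weigh
  the same.\<close>

lemma Down_weights:
  assumes "C \<in> Down (coll_of \<pi>) (S_vec l)" "finite \<pi>"
  shows "\<exists>P. \<Sum>\<^sub># P = mset_set \<pi> \<and> image_mset (\<lambda>B. \<Sum>\<^sub># (image_mset (part l) B)) C =
    image_mset (\<lambda>k. \<Sum>\<^sub># (image_mset (wt l) k)) P"
  using assms(1)
proof (induction rule: Down.induct)
  case start
  have "image_mset (\<lambda>B. \<Sum>\<^sub># (image_mset (part l) B)) (coll_of \<pi>) = image_mset (wt l) (mset_set \<pi>)"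
    by (simp add: coll_of_def image_mset.compositionality o_def sum_unfold_sum_mset[symmetric] wt_def[abs_def])
  then show ?case
    by (intro exI[of _ "image_mset (\<lambda>B. {#B#}) (mset_set \<pi>)"])
       (simp add: image_mset.compositionality o_def)
next
  case (join B1 B2 C)
  then obtain P where P: "\<Sum>\<^sub># P = mset_set \<pi>" "image_mset (\<lambda>k. \<Sum>\<^sub># (image_mset (wt l) k)) P =
      add_mset (\<Sum>\<^sub># (image_mset (part l) B1)) (add_mset (\<Sum>\<^sub># (image_mset (part l) B2))
       (image_mset (\<lambda>B. \<Sum>\<^sub># (image_mset (part l) B)) C))"
    by auto
  obtain k1 P1 where k1: "P = add_mset k1 P1" "\<Sum>\<^sub># (image_mset (wt l) k1) = \<Sum>\<^sub># (image_mset (part l) B1)"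
      "image_mset (\<lambda>k. \<Sum>\<^sub># (image_mset (wt l) k)) P1 = add_mset (\<Sum>\<^sub># (image_mset (part l) B2))
       (image_mset (\<lambda>B. \<Sum>\<^sub># (image_mset (part l) B)) C)"
    using msed_map_invR[OF P(2)] by blast
  obtain k2 P2 where k2: "P1 = add_mset k2 P2" "\<Sum>\<^sub># (image_mset (wt l) k2) = \<Sum>\<^sub># (image_mset (part l) B2)"
      "image_mset (\<lambda>k. \<Sum>\<^sub># (image_mset (wt l) k)) P2 =
       image_mset (\<lambda>B. \<Sum>\<^sub># (image_mset (part l) B)) C"
    using msed_map_invR[OF k1(3)] by blast
  show ?case
    using P(1) k1 k2 by (intro exI[of _ "add_mset (k1 + k2) P2"]) (simp add: add.assoc)
next
  case (exch B C x)
  have "wt l (Plus x) = wt l (Minus x)"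
    using exch.hyps by (simp add: S_vec_iff)
  then have "\<Sum>\<^sub># (image_mset (part l) (B - mset_set (Plus x) + mset_set (Minus x))) = \<Sum>\<^sub># (image_mset (part l) B)"
    using sum_mset_mono_nat[OF image_mset_subseteq_mono[OF exch.hyps(3)], of "part l"]
    by (simp add: image_mset_Diff[OF exch.hyps(3)] sum_mset_diff[OF image_mset_subseteq_mono[OF exch.hyps(3)]]
        wt_def sum_unfold_sum_mset)
  then show ?case
    using exch.IH by simp
qed

lemma down_imp_block_map:
  assumes \<pi>: "\<pi> \<in> Pt {1..length l}" and \<rho>: "\<rho> \<in> down (length l) \<pi> (S_vec l)"
  shows "\<exists>f. block_map (wt l) \<pi> \<rho> f"
proof -
  have fin: "finite \<pi>" "finite \<rho>"
    using assms Pt_finite by (auto simp: down_def)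
  obtain P where P: "\<Sum>\<^sub># P = mset_set \<pi>" "image_mset (\<lambda>B. \<Sum>\<^sub># (image_mset (part l) B)) (coll_of \<rho>) =
      image_mset (\<lambda>k. \<Sum>\<^sub># (image_mset (wt l) k)) P"
    using Down_weights[OF _ fin(1)] \<rho> unfolding down_def by blast
  have "image_mset (\<lambda>B. \<Sum>\<^sub># (image_mset (part l) B)) (coll_of \<rho>) = image_mset (wt l) (mset_set \<rho>)"
    by (simp add: coll_of_def image_mset.compositionality o_def sum_unfold_sum_mset[symmetric] wt_def[abs_def])
  then have "image_mset (wt l) (mset_set \<rho>) = image_mset (\<lambda>k. \<Sum>\<^sub># (image_mset (wt l) k)) P"
    using P(2) by simp
  from image_mset_match[OF fin(2) this]
  obtain k where k: "P = image_mset k (mset_set \<rho>)" "\<forall>E\<in>\<rho>. wt l E = \<Sum>\<^sub># (image_mset (wt l) (k E))"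
    by blast
  have sum: "(\<Sum>E\<in>\<rho>. k E) = mset_set \<pi>"
    using P(1) k(1) by (simp add: sum_unfold_sum_mset)
  \<comment> \<open>The groups add up to \<open>mset_set \<pi>\<close>, which has no repetitions, so
    every block lies in exactly one group, once; the owner of that group is its image under
    \<open>f\<close>.\<close>
  have count: "(\<Sum>E\<in>\<rho>. count (k E) B) = (if B \<in> \<pi> then 1 else 0)" for B
    using arg_cong[OF sum, of "\<lambda>M. count M B"] fin by (simp add: count_sum count_mset_set')
  have ex1: "\<exists>E\<in>\<rho>. B \<in># k E" if "B \<in> \<pi>" for B
  proof (rule ccontr)
    assume "\<not> ?thesis"
    then have "(\<Sum>E\<in>\<rho>. count (k E) B) = 0"
      by (simp add: not_in_iff)
    then show False
      using count[of B] that by simp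
  qed
  have le: "count (k E) B \<le> (if B \<in> \<pi> then 1 else 0)" if "E \<in> \<rho>" for E B
    using member_le_sum[OF that, of "\<lambda>E. count (k E) B"] fin(2) count[of B] by simp
  have uniq: "E = E'" if "E \<in> \<rho>" "E' \<in> \<rho>" "B \<in># k E" "B \<in># k E'" for E E' B
  proof (rule ccontr)
    assume "E \<noteq> E'"
    then have "count (k E) B + count (k E') B \<le> (\<Sum>E\<in>\<rho>. count (k E) B)"
      using sum_mono2[of \<rho> "{E, E'}" "\<lambda>E. count (k E) B"] that fin(2) by simp
    moreover have "count (k E) B > 0" "count (k E') B > 0"
      using that by simp_all
    moreover have "(\<Sum>E\<in>\<rho>. count (k E) B) \<le> 1"
      using count[of B] by simp
    ultimately show False
      by linarith
  qed
  define f where "f B = (SOME E. E \<in> \<rho> \<and> B \<in># k E)" for B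
  have f: "f B \<in> \<rho> \<and> B \<in># k (f B)" if "B \<in> \<pi>" for B
    unfolding f_def by (rule someI_ex) (use ex1[OF that] in blast)
  have "wt l E = (\<Sum>B\<in>{B\<in>\<pi>. f B = E}. wt l B)" if E: "E \<in> \<rho>" for E
  proof -
    have in\<pi>: "B \<in> \<pi>" if "B \<in># k E" for B
      using le[OF E, of B] that by (cases "B \<in> \<pi>") (auto simp: count_eq_zero_iff)
    have "k E = mset_set {B\<in>\<pi>. f B = E}"
    proof (rule multiset_eqI)
      fix B
      have "B \<in># k E \<longleftrightarrow> B \<in> \<pi> \<and> f B = E"
        using in\<pi> f uniq[OF E] by metis
      moreover have "count (k E) B = 1" if "B \<in># k E"
        using le[OF E, of B] that in\<pi>[OF that] by (simp add: Suc_le_eq le_antisym)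
      ultimately show "count (k E) B = count (mset_set {B\<in>\<pi>. f B = E}) B"
        using fin(1) by (auto simp: count_mset_set' not_in_iff)
    qed
    then show ?thesis
      using k(2) E by (simp add: sum_unfold_sum_mset)
  qed
  then show ?thesis
    using f by (auto simp: block_map_def)
qed

lemma Down_joins:
  assumes "finite K" "K \<noteq> {}" "image_mset mset_set (mset_set K) + D \<in> Down A S"
  shows "add_mset (\<Sum>B\<in>K. mset_set B) D \<in> Down A S"
  using assms
proof (induction K arbitrary: D rule: finite_ne_induct)
  case (insert x F)
  then have "image_mset mset_set (mset_set F) + add_mset (mset_set x) D \<in> Down A S"
    by simp
  from Down.join[OF insert.IH[OF this]] show ?case
    using insert.hyps by (simp add: add.commute)
qed simp

lemma sum_mset_set_Union:
  assumes "finite K" "\<And>B. B \<in> K \<Longrightarrow> finite B" "\<And>B C. B \<in> K \<Longrightarrow> C \<in> K \<Longrightarrow> B \<noteq> C \<Longrightarrow> B \<inter> C = {}"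
  shows "(\<Sum>B\<in>K. mset_set B) = mset_set (\<Union>K)"
  using assms
proof (induction K)
  case (insert x K)
  have "x \<inter> \<Union>K = {}"
    using insert.prems(2) insert.hyps by blast
  then show ?case
    using insert by (simp add: mset_set_Union)
qed simp

lemma wt_Union:
  assumes "finite K" "\<And>B. B \<in> K \<Longrightarrow> finite B" "\<And>B C. B \<in> K \<Longrightarrow> C \<in> K \<Longrightarrow> B \<noteq> C \<Longrightarrow> B \<inter> C = {}"
  shows "(\<Sum>B\<in>K. wt l B) = wt l (\<Union>K)"
  unfolding wt_def by (rule sum.Union_disjoint[symmetric, simplified]) (use assms in auto)

lemma block_map_imp_down:
  assumes l: "positive l" and \<pi>: "\<pi> \<in> Pt {1..length l}" and \<rho>: "\<rho> \<in> Pt {1..length l}"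
    and f: "block_map (wt l) \<pi> \<rho> f"
  shows "\<rho> \<in> down (length l) \<pi> (S_vec l)"
proof -
  let ?D = "Down (coll_of \<pi>) (S_vec l)"
  have fin: "finite \<pi>" "finite \<rho>" "\<And>B. B \<in> \<pi> \<Longrightarrow> finite B" "\<And>B. B \<in> \<rho> \<Longrightarrow> finite B"
    using Pt_finite[OF \<pi>] Pt_finite[OF \<rho>] finite_subset[OF Pt_block(1)[OF \<pi>]]
      finite_subset[OF Pt_block(1)[OF \<rho>]] by simp_all
  \<comment> \<open>Invariant: the blocks in \<open>R\<close> have been produced, and the blocks of
    \<open>\<pi>\<close> assigned to other targets are still untouched.\<close>
  have "image_mset mset_set (mset_set R) + image_mset mset_set (mset_set {B\<in>\<pi>. f B \<notin> R}) \<in> ?D"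
    if "R \<subseteq> \<rho>" for R
    using finite_subset[OF that fin(2)] that
  proof (induction R)
    case empty
    show ?case
      using Down.start[of "coll_of \<pi>" "S_vec l"] by (simp add: coll_of_def)
  next
    case (insert E R)
    define K where "K = {B\<in>\<pi>. f B = E}"
    let ?rest = "image_mset mset_set (mset_set R) + image_mset mset_set (mset_set {B\<in>\<pi>. f B \<notin> insert E R})"
    have split: "{B\<in>\<pi>. f B \<notin> R} = K \<union> {B\<in>\<pi>. f B \<notin> insert E R}"
      using insert.hyps by (auto simp: K_def)
    have "mset_set {B\<in>\<pi>. f B \<notin> R} = mset_set K + mset_set {B\<in>\<pi>. f B \<notin> insert E R}"
      unfolding split by (rule mset_set_Union) (auto simp: K_def fin)
    then have "image_mset mset_set (mset_set K) + ?rest \<in> ?D"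
      using insert by (simp add: ac_simps)
    moreover have wK: "wt l E = (\<Sum>B\<in>K. wt l B)"
      using f insert.prems by (auto simp: block_map_def K_def)
    have E: "E \<subseteq> {1..length l}" "E \<noteq> {}"
      using Pt_block[OF \<rho>] insert.prems by auto
    \<comment> \<open>A join needs a first block: \<open>E\<close> has positive weight, so something
      is assigned to it.\<close>
    have "K \<noteq> {}"
      using wK wt_eq_0[OF l E(1)] E(2) by auto
    ultimately have *: "add_mset (\<Sum>B\<in>K. mset_set B) ?rest \<in> ?D"
      by (intro Down_joins) (auto simp: K_def fin)
    define U where "U = \<Union>K"
    have Kd: "finite K" "\<And>B. B \<in> K \<Longrightarrow> finite B" "\<And>B C. B \<in> K \<Longrightarrow> C \<in> K \<Longrightarrow> B \<noteq> C \<Longrightarrow> B \<inter> C = {}"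
      using fin Pt_disjoint[OF \<pi>] by (auto simp: K_def)
    have U: "(\<Sum>B\<in>K. mset_set B) = mset_set U" "wt l E = wt l U"
      using sum_mset_set_Union[OF Kd] wt_Union[OF Kd] wK by (auto simp: U_def)
    have "U \<subseteq> {1..length l}"
      using Pt_block(1)[OF \<pi>] by (auto simp: U_def K_def)
    then have UE: "U \<subseteq> {1..length l}" "finite U" "finite E"
      using finite_subset[OF E(1)] finite_subset by auto
    \<comment> \<open>\<open>U\<close> and \<open>E\<close> weigh the same, so trading their set
      differences is a relation; the common part is left alone because a vector cannot carry both
      signs at one index.\<close>
    let ?x = "vec_of (U - E) (E - U)"
    have x: "?x \<in> tern (length l)" "Plus ?x = U - E" "Minus ?x = E - U"
      using UE(1) E(1) by (intro vec_of; auto)+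
    have "wt l (U - E) + wt l (U \<inter> E) = wt l (E - U) + wt l (U \<inter> E)"
    proof -
      have "wt l ((U - E) \<union> (U \<inter> E)) = wt l (U - E) + wt l (U \<inter> E)"
        "wt l ((E - U) \<union> (U \<inter> E)) = wt l (E - U) + wt l (U \<inter> E)"
        using UE by (intro wt_Un; auto)+
      moreover have "(U - E) \<union> (U \<inter> E) = U" "(E - U) \<union> (U \<inter> E) = E"
        by auto
      ultimately show ?thesis
        using U(2) by simp
    qed
    then have xS: "?x \<in> S_vec l"
      using x UE E by (auto simp: S_vec_iff)
    have "add_mset (mset_set U - mset_set (Plus ?x) + mset_set (Minus ?x)) ?rest \<in> ?D"
      using x UE E * U by (intro Down.exch[OF _ xS]) (auto intro: subset_imp_msubset_mset_set)
    moreover have "mset_set U - mset_set (Plus ?x) + mset_set (Minus ?x) = mset_set E"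
      unfolding x using UE by (intro multiset_eqI) (auto simp: count_mset_set')
    ultimately show ?case
      using insert.hyps by simp
  qed
  from this[of \<rho>] have "image_mset mset_set (mset_set \<rho>) + image_mset mset_set (mset_set {B\<in>\<pi>. f B \<notin> \<rho>}) \<in> ?D"
    by simp
  moreover have "{B\<in>\<pi>. f B \<notin> \<rho>} = {}"
    using f by (auto simp: block_map_def)
  ultimately show ?thesis
    using \<rho> by (simp add: down_def coll_of_def)
qed

lemma down_iff:
  assumes "positive l" "\<pi> \<in> Pt {1..length l}"
  shows "\<rho> \<in> down (length l) \<pi> (S_vec l) \<longleftrightarrow> \<rho> \<in> Pt {1..length l} \<and> (\<exists>f. block_map (wt l) \<pi> \<rho> f)"
  using block_map_imp_down[OF assms] down_imp_block_map[OF assms(2)] by (auto simp: down_def)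

lemma Down_trans: "C \<in> Down B S \<Longrightarrow> B \<in> Down A S \<Longrightarrow> C \<in> Down A S"
proof (induction rule: Down.induct)
  case (exch B C x)
  then show ?case
    by (intro Down.exch)
qed (auto intro: Down.join)

lemma Down_mono: "C \<in> Down A S \<Longrightarrow> S \<subseteq> T \<Longrightarrow> C \<in> Down A T"
proof (induction rule: Down.induct)
  case (exch B C x)
  then show ?case
    by (intro Down.exch) auto
qed (auto intro: Down.join Down.start)

text \<open>Exchanges along vectors of a smaller set are still exchanges in \<open>S\<close>. The
  smaller sets matter because the vectors left after a collapse may span less than
  \<open>S\<close>.\<close>

lemma closed_parts_down:
  assumes "R \<subseteq> S"
  shows "closed_parts n R (down n \<pi> S)"
proof -
  have "x \<in> down n \<pi> S" if "\<rho> \<in> down n \<pi> S" "x \<in> down n \<rho> R" for \<rho> x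
    using that Down_trans[OF Down_mono[OF _ assms], of "coll_of x" "coll_of \<rho>" "coll_of \<pi>"]
    by (simp add: down_def)
  moreover have "x \<in> down n x R" if "x \<in> down n \<pi> S" for x
    using that by (simp add: down_def Down.start)
  moreover have "down n \<pi> S \<subseteq> Pt {1..n}"
    by (auto simp: down_def)
  ultimately show ?thesis
    unfolding closed_parts_def by blast
qed

lemma closed_parts_empty: "closed_parts n S {}"
  by (simp add: closed_parts_def)

text \<open>The cut spanned by the remaining vectors lies between them and \<open>S\<close>, so
  removing from it the vectors with partition in \<open>\<Gamma>\<close> leaves the same remainder.
  \<open>Frel\<close> is defined through this spanned cut, \<open>FQ\<close> through
  \<open>S\<close>.\<close>

lemma Q_relative_cut:
  assumes S: "S \<in> cuts n" and c: "\<And>R. R \<subseteq> S \<Longrightarrow> closed_parts n R \<Gamma>"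
  shows "relative_cut n (Q n S \<Gamma>)" "Q n (tspan n (fst (Q n S \<Gamma>))) \<Gamma> = Q n S \<Gamma>"
    "tspan n (fst (Q n S \<Gamma>)) \<in> cuts n" "tspan n (fst (Q n S \<Gamma>)) \<subseteq> S"
proof -
  let ?R = "rel_minus n S \<Gamma>"
  have R: "?R \<subseteq> S"
    by (auto simp: rel_minus_def)
  show cut: "tspan n (fst (Q n S \<Gamma>)) \<in> cuts n" and sub: "tspan n (fst (Q n S \<Gamma>)) \<subseteq> S"
    using tspan_in_cuts[OF S R] tspan_subset_cut[OF S R] by (auto simp: Q_def)
  have "?R \<subseteq> tspan n ?R"
    using R cuts_tspan(2)[OF S] by (intro tspan_superset) blast
  then have eq: "rel_minus n (tspan n ?R) \<Gamma> = ?R"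
    using sub by (auto simp: rel_minus_def Q_def)
  then show "Q n (tspan n (fst (Q n S \<Gamma>))) \<Gamma> = Q n S \<Gamma>"
    by (simp add: Q_def)
  show "relative_cut n (Q n S \<Gamma>)"
    using eq cut c[OF sub] R cuts_tspan(2)[OF S]
    by (auto simp: relative_cut_def Q_def closed_parts_def)
qed

lemma wt_op_blocks:
  assumes "\<pi> \<in> OPt {1..length l}" "J \<subseteq> {1..length \<pi>}"
  shows "wt l (\<Union>j\<in>J. \<pi> ! (j - 1)) = wt (map (wt l) \<pi>) J"
proof -
  have dist: "distinct \<pi>" and P: "set \<pi> \<in> Pt {1..length l}"
    using assms(1) by (auto simp: OPt_def Pt_def)
  have in\<pi>: "\<pi> ! (j - 1) \<in> set \<pi>" "j - 1 < length \<pi>" "1 \<le> j" if "j \<in> J" for j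
    using that assms(2) by (auto simp: subset_iff Suc_le_eq)
  have "wt l (\<Union>j\<in>J. \<pi> ! (j - 1)) = (\<Sum>j\<in>J. wt l (\<pi> ! (j - 1)))"
    unfolding wt_def
  proof (rule sum.UNION_disjoint)
    show "finite J"
      using assms(2) finite_subset by blast
    show "\<forall>j\<in>J. finite (\<pi> ! (j - 1))"
      using Pt_block(1)[OF P in\<pi>(1)] finite_subset by blast
    show "\<forall>i\<in>J. \<forall>j\<in>J. i \<noteq> j \<longrightarrow> \<pi> ! (i - 1) \<inter> \<pi> ! (j - 1) = {}"
    proof (intro ballI impI)
      fix i j assume ij: "i \<in> J" "j \<in> J" "i \<noteq> j"
      then have "i - 1 \<noteq> j - 1"
        using in\<pi>(3)[of i] in\<pi>(3)[of j] by linarith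
      then have "\<pi> ! (i - 1) \<noteq> \<pi> ! (j - 1)"
        using in\<pi>(2) ij dist by (simp add: nth_eq_iff_index_eq)
      then show "\<pi> ! (i - 1) \<inter> \<pi> ! (j - 1) = {}"
        using Pt_disjoint[OF P in\<pi>(1) in\<pi>(1)] ij by blast
    qed
  qed
  also have "\<dots> = wt (map (wt l) \<pi>) J"
    unfolding wt_def[of "map _ _"] using in\<pi>(2) by (intro sum.cong) (auto simp: part_def)
  finally show ?thesis .
qed

text \<open>A vector on the blocks and its pullback, which is constant on each block, have the same
  weight in either sign, since weights add up over disjoint blocks; so being a relation means the
  same on both levels.\<close>

lemma merge_S_vec:
  assumes \<pi>: "\<pi> \<in> OPt {1..length l}"
  shows "merge \<pi> (S_vec l) = S_vec (map (wt l) \<pi>)"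
proof -
  let ?n = "length l" and ?m = "length \<pi>"
  have dist: "distinct \<pi>" and P: "set \<pi> \<in> Pt {1..?n}"
    using \<pi> by (auto simp: OPt_def Pt_def)
  define blk where "blk j = \<pi> ! (j - 1)" for j
  have blk_in: "blk j \<in> set \<pi>" if "j \<in> {1..?m}" for j
    using that by (auto simp: blk_def)
  have blk_inj: "blk j \<inter> blk j' = {}" if "j \<in> {1..?m}" "j' \<in> {1..?m}" "j \<noteq> j'" for j j'
  proof (rule Pt_disjoint[OF P blk_in[OF that(1)] blk_in[OF that(2)]])
    show "blk j \<noteq> blk j'"
      using that dist by (cases j; cases j') (auto simp: blk_def nth_eq_iff_index_eq)
  qed
  have blk_ex: "\<exists>j\<in>{1..?m}. i \<in> blk j" if "i \<in> {1..?n}" for i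
  proof -
    have "i \<in> \<Union>(set \<pi>)"
      unfolding Pt_Union[OF P] by (rule that)
    then obtain j where "j < ?m" "i \<in> \<pi> ! j"
      by (auto simp: in_set_conv_nth)
    then show ?thesis
      by (intro bexI[of _ "Suc j"]) (auto simp: blk_def)
  qed
  have blk_sub: "blk j \<subseteq> {1..?n}" if "j \<in> {1..?m}" for j
    by (rule Pt_block(1)[OF P blk_in[OF that]])
  have wt_UN: "wt l (\<Union>j\<in>J. blk j) = wt (map (wt l) \<pi>) J" if "J \<subseteq> {1..?m}" for J
    unfolding blk_def by (rule wt_op_blocks[OF \<pi> that])
  have compat: "wt l (Plus s) = wt (map (wt l) \<pi>) (Plus t)" "wt l (Minus s) = wt (map (wt l) \<pi>) (Minus t)"
    if s: "s \<in> tern ?n" and t: "t \<in> tern ?m" and st: "\<And>j i. j \<in> {1..?m} \<Longrightarrow> i \<in> blk j \<Longrightarrow> s i = t j" for s t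
  proof -
    have "{i. s i = c} = (\<Union>j\<in>{j. t j = c}. blk j)" if "c \<noteq> 0" for c
    proof (intro set_eqI iffI)
      fix i assume "i \<in> {i. s i = c}"
      then have "i \<in> {1..?n}" "s i = c"
        using s that by (auto simp: tern_def)
      then obtain j where "j \<in> {1..?m}" "i \<in> blk j"
        using blk_ex by blast
      then show "i \<in> (\<Union>j\<in>{j. t j = c}. blk j)"
        using st \<open>s i = c\<close> by auto
    next
      fix i assume "i \<in> (\<Union>j\<in>{j. t j = c}. blk j)"
      then obtain j where j: "t j = c" "i \<in> blk j"
        by auto
      then have "j \<in> {1..?m}"
        using t that by (auto simp: tern_def)
      then show "i \<in> {i. s i = c}"
        using st[of j i] j by simp
    qed
    from this[of 1] this[of "-1"]
    have "Plus s = (\<Union>j\<in>Plus t. blk j)" "Minus s = (\<Union>j\<in>Minus t. blk j)"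
      by (simp_all add: Plus_def Minus_def)
    then show "wt l (Plus s) = wt (map (wt l) \<pi>) (Plus t)" "wt l (Minus s) = wt (map (wt l) \<pi>) (Minus t)"
      using wt_UN[OF tern_support(1)[OF t]] wt_UN[OF tern_support(2)[OF t]] by simp_all
  qed
  have ex: "\<exists>s\<in>tern ?n. \<forall>j\<in>{1..?m}. \<forall>i\<in>blk j. s i = t j" if t: "t \<in> tern ?m" for t
  proof -
    define ix where "ix i = (SOME j. j \<in> {1..?m} \<and> i \<in> blk j)" for i
    have ix: "ix i \<in> {1..?m} \<and> i \<in> blk (ix i)" if "i \<in> {1..?n}" for i
      unfolding ix_def by (rule someI_ex) (use blk_ex[OF that] in blast)
    have ix_eq: "ix i = j" if "j \<in> {1..?m}" "i \<in> blk j" for i j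
    proof (rule ccontr)
      assume "ix i \<noteq> j"
      moreover have "i \<in> {1..?n}"
        using blk_sub[OF that(1)] that(2) by (rule subsetD)
      ultimately show False
        using ix[of i] blk_inj[OF that(1), of "ix i"] that(2) by (metis IntI empty_iff)
    qed
    define s where "s i = (if i \<in> {1..?n} then t (ix i) else 0)" for i
    have "s \<in> tern ?n"
      using t ix by (simp add: tern_def s_def)
    moreover have "s i = t j" if "j \<in> {1..?m}" "i \<in> blk j" for i j
      using ix_eq[OF that] blk_sub[OF that(1)] that by (auto simp: s_def)
    ultimately show ?thesis
      by blast
  qed
  show ?thesis
  proof (intro set_eqI iffI)
    fix t assume "t \<in> merge \<pi> (S_vec l)"
    then obtain s where t: "t \<in> tern ?m" and s: "s \<in> S_vec l" and st: "\<forall>j\<in>{1..?m}. \<forall>i\<in>blk j. s i = t j"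
      unfolding merge_def blk_def by blast
    from s have "s \<in> tern ?n"
      by (simp add: S_vec_iff)
    from compat[OF this t] s t st show "t \<in> S_vec (map (wt l) \<pi>)"
      by (simp add: S_vec_iff)
  next
    fix t assume t: "t \<in> S_vec (map (wt l) \<pi>)"
    then have t': "t \<in> tern ?m"
      by (simp add: S_vec_iff)
    obtain s where s: "s \<in> tern ?n" and st: "\<forall>j\<in>{1..?m}. \<forall>i\<in>blk j. s i = t j"
      using ex[OF t'] by blast
    from compat[OF s t'] st t s have "s \<in> S_vec l"
      by (simp add: S_vec_iff)
    with st t' show "t \<in> merge \<pi> (S_vec l)"
      unfolding merge_def blk_def by blast
  qed
qed

section \<open>Splitting off the last parts\<close>

lemma part_append:
  "i \<in> {1..length xs} \<Longrightarrow> part (xs @ ys) i = part xs i"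
  "i \<ge> 1 \<Longrightarrow> part (xs @ ys) (length xs + i) = part ys i"
  by (auto simp: part_def nth_append)

lemma wt_append:
  "A \<subseteq> {1..length xs} \<Longrightarrow> wt (xs @ ys) A = wt xs A"
  "0 \<notin> B \<Longrightarrow> wt (xs @ ys) ((+) (length xs) ` B) = wt ys B"
proof -
  show "A \<subseteq> {1..length xs} \<Longrightarrow> wt (xs @ ys) A = wt xs A"
    unfolding wt_def by (rule sum.cong) (auto simp: part_append)
  assume "0 \<notin> B"
  then have *: "1 \<le> i" if "i \<in> B" for i
    using that by (cases i) auto
  have "wt (xs @ ys) ((+) (length xs) ` B) = (\<Sum>i\<in>B. part (xs @ ys) (length xs + i))"
    unfolding wt_def by (subst sum.reindex) (auto simp: o_def)
  also have "\<dots> = wt ys B"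
    unfolding wt_def by (intro sum.cong) (auto simp: part_append * simp del: One_nat_def)
  finally show "wt (xs @ ys) ((+) (length xs) ` B) = wt ys B" .
qed

lemma restrict_part_Pt:
  assumes "\<pi> \<in> Pt A" "B \<subseteq> A"
  shows "restrict_part B \<pi> \<in> Pt B"
proof -
  have "\<Union>(restrict_part B \<pi>) = \<Union>\<pi> \<inter> B"
    by (auto simp: restrict_part_def)
  then have "\<Union>(restrict_part B \<pi>) = B"
    using assms by (auto simp: Pt_Union[OF assms(1)])
  moreover have "disjoint (restrict_part B \<pi>)"
    unfolding disjoint_def restrict_part_def using Pt_disjoint[OF assms(1)] by auto
  ultimately show ?thesis
    by (auto simp: Pt_def partition_on_def restrict_part_def)
qed

definition add_singles :: "nat set \<Rightarrow> nat set set \<Rightarrow> nat set set" where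
  "add_singles B \<nu> = \<nu> \<union> (\<lambda>i. {i}) ` B"

lemma add_singles_Pt:
  assumes "\<nu> \<in> Pt A" "A \<inter> B = {}"
  shows "add_singles B \<nu> \<in> Pt (A \<union> B)"
proof -
  have "disjoint (add_singles B \<nu>)"
    unfolding disjoint_def add_singles_def
    using Pt_disjoint[OF assms(1)] Pt_block(1)[OF assms(1)] assms(2) by auto blast+
  then show ?thesis
    using Pt_Union[OF assms(1)] Pt_block(2)[OF assms(1)]
    by (auto simp: Pt_def partition_on_def add_singles_def)
qed

lemma one_block_eq: "one_block n A = insert A ((\<lambda>i. {i}) ` ({1..n} - A))"
  by (auto simp: one_block_def)

lemma one_block_Pt: "A \<subseteq> {1..n} \<Longrightarrow> A \<noteq> {} \<Longrightarrow> one_block n A \<in> Pt {1..n}"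
  by (auto simp: one_block_eq Pt_def partition_on_def disjoint_def)

text \<open>The easy inclusion, for arbitrary appended parts: a block map for the first
  \<open>N\<close> indices is extended by sending each appended singleton to the block that contains
  it. The two portions of a block then contribute their weights separately.\<close>

lemma down_add_singles:
  fixes rest zs :: "nat list"
  defines "N \<equiv> length rest" and "l \<equiv> rest @ zs"
  assumes l: "positive l" and \<nu>: "\<nu> \<in> Pt {1..N}" and \<rho>: "\<rho> \<in> Pt {1..length l}"
    and res: "restrict_part {1..N} \<rho> \<in> down N \<nu> (S_vec rest)"
  shows "\<rho> \<in> down (length l) (add_singles {N+1..length l} \<nu>) (S_vec l)"
proof -
  let ?B = "{N+1..length l}"
  let ?\<pi> = "add_singles ?B \<nu>"
  have len: "{1..length l} = {1..N} \<union> ?B" "{1..N} \<inter> ?B = {}"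
    by (auto simp: N_def l_def)
  have \<pi>: "?\<pi> \<in> Pt {1..length l}"
    unfolding len(1) by (rule add_singles_Pt[OF \<nu> len(2)])
  have "positive rest"
    using l by (auto simp: positive_def l_def)
  then obtain f where f: "f ` \<nu> \<subseteq> restrict_part {1..N} \<rho>"
    "\<And>E. E \<in> restrict_part {1..N} \<rho> \<Longrightarrow> wt rest E = (\<Sum>C\<in>{C\<in>\<nu>. f C = E}. wt rest C)"
    using res \<nu> down_iff[of rest \<nu>] by (auto simp: N_def block_map_def)
  define blk where "blk A = (SOME E. E \<in> \<rho> \<and> A \<subseteq> E)" for A
  have blkI: "blk A = E" if "E \<in> \<rho>" "A \<subseteq> E" "A \<noteq> {}" for A E
    unfolding blk_def by (rule some_equality) (use that Pt_disjoint[OF \<rho> that(1)] in blast)+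
  have blk_ex: "\<exists>E\<in>\<rho>. {i} \<subseteq> E" if "i \<in> {1..length l}" for i
    using Pt_Union[OF \<rho>] that by auto
  \<comment> \<open>\<open>f C\<close> is only the trace of a block of \<open>\<rho>\<close> on the
    first \<open>N\<close> indices; \<open>blk\<close> recovers the block itself.\<close>
  define g where "g C = (if C \<in> \<nu> then blk (f C) else blk C)" for C
  have fC: "\<exists>E\<in>\<rho>. f C = E \<inter> {1..N} \<and> f C \<noteq> {} \<and> blk (f C) = E" if "C \<in> \<nu>" for C
  proof -
    have "f C \<in> restrict_part {1..N} \<rho>"
      using f(1) that by blast
    then obtain E where E: "E \<in> \<rho>" "f C = E \<inter> {1..N}" "f C \<noteq> {}"
      by (auto simp: restrict_part_def)
    then show ?thesis
      using blkI[OF E(1), of "f C"] by auto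
  qed
  have "block_map (wt l) ?\<pi> \<rho> g"
    unfolding block_map_def
  proof (intro conjI ballI)
    show "g ` ?\<pi> \<subseteq> \<rho>"
    proof
      fix E assume "E \<in> g ` ?\<pi>"
      then obtain C where C: "C \<in> ?\<pi>" "E = g C"
        by blast
      show "E \<in> \<rho>"
      proof (cases "C \<in> \<nu>")
        case True
        then show ?thesis
          using fC[OF True] C(2) by (auto simp: g_def)
      next
        case False
        then obtain i where "i \<in> ?B" "C = {i}"
          using C(1) by (auto simp: add_singles_def)
        then show ?thesis
          using blk_ex[of i] blkI False C(2) len(1) by (fastforce simp: g_def)
      qed
    qed
  next
    fix E assume E: "E \<in> \<rho>"
    have Efin: "E \<subseteq> {1..length l}" "finite E"
      using Pt_block(1)[OF \<rho> E] finite_subset by auto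
    have not\<nu>: "{i} \<notin> \<nu>" if "i \<in> ?B" for i
      using Pt_block(1)[OF \<nu>, of "{i}"] that by auto
    have eq1: "{C\<in>?\<pi>. g C = E} = {C\<in>\<nu>. f C = E \<inter> {1..N}} \<union> (\<lambda>i. {i}) ` (E \<inter> ?B)" (is "?L = ?R1 \<union> ?R2")
    proof -
      have g\<nu>: "g C = E \<longleftrightarrow> f C = E \<inter> {1..N}" if C: "C \<in> \<nu>" for C
      proof -
        obtain E' where E': "E' \<in> \<rho>" "f C = E' \<inter> {1..N}" "f C \<noteq> {}" "blk (f C) = E'"
          using fC[OF C] by blast
        then have "E' = E \<longleftrightarrow> f C = E \<inter> {1..N}"
          using Pt_disjoint[OF \<rho> E'(1) E] by blast
        then show ?thesis
          using E' C by (simp add: g_def)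
      qed
      have gB: "g {i} = E \<longleftrightarrow> i \<in> E" if i: "i \<in> ?B" for i
      proof -
        obtain E' where E': "E' \<in> \<rho>" "{i} \<subseteq> E'"
          using blk_ex[of i] i len(1) by blast
        then have "g {i} = E'"
          using blkI[OF E'] not\<nu>[OF i] by (simp add: g_def)
        then show ?thesis
          using Pt_disjoint[OF \<rho> E'(1) E] E' by blast
      qed
      show ?thesis
        unfolding add_singles_def using g\<nu> gB by blast
    qed
    have fin\<nu>: "finite \<nu>"
      using Pt_finite[OF \<nu>] by simp
    have "?R1 \<inter> ?R2 = {}"
      using not\<nu> by auto
    then have "(\<Sum>C\<in>?L. wt l C) = (\<Sum>C\<in>?R1. wt l C) + (\<Sum>C\<in>?R2. wt l C)"
      unfolding eq1 using fin\<nu> Efin by (intro sum.union_disjoint) auto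
    also have "(\<Sum>C\<in>?R2. wt l C) = wt l (E \<inter> ?B)"
      by (subst sum.reindex) (auto simp: wt_def inj_on_def)
    also have "(\<Sum>C\<in>?R1. wt l C) = wt l (E \<inter> {1..N})"
    proof (cases "E \<inter> {1..N} = {}")
      case True
      then have "?R1 = {}"
        using fC by force
      then show ?thesis
        using True by (metis sum.empty wt_empty)
    next
      case False
      then have "E \<inter> {1..N} \<in> restrict_part {1..N} \<rho>"
        using E by (auto simp: restrict_part_def)
      from f(2)[OF this] have "wt rest (E \<inter> {1..N}) = (\<Sum>C\<in>?R1. wt rest C)"
        by simp
      moreover have "(\<Sum>C\<in>?R1. wt rest C) = (\<Sum>C\<in>?R1. wt l C)"
        using Pt_block(1)[OF \<nu>] by (intro sum.cong) (auto simp: l_def N_def wt_append)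
      moreover have "wt rest (E \<inter> {1..N}) = wt l (E \<inter> {1..N})"
        by (simp add: l_def N_def wt_append)
      ultimately show ?thesis
        by simp
    qed
    also have "wt l (E \<inter> {1..N}) + wt l (E \<inter> ?B) = wt l E"
    proof -
      have "wt l ((E \<inter> {1..N}) \<union> (E \<inter> ?B)) = wt l (E \<inter> {1..N}) + wt l (E \<inter> ?B)"
        using Efin by (intro wt_Un) auto
      moreover have "(E \<inter> {1..N}) \<union> (E \<inter> ?B) = E"
        using Efin len(1) by auto
      ultimately show ?thesis
        by simp
    qed
    finally show "wt l E = (\<Sum>C\<in>?L. wt l C)"
      by simp
  qed
  then show ?thesis
    using block_map_imp_down[OF l \<pi> \<rho>] by blast
qed

lemma vects_times_split:
  assumes s: "s \<in> tern N" and t: "t \<in> tern k"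
  defines "v \<equiv> (\<lambda>i. if i \<le> N then s i else t (i - N))"
  shows "v \<in> tern (N + k)" "Plus v = Plus s \<union> (+) N ` Plus t" "Minus v = Minus s \<union> (+) N ` Minus t"
proof -
  have "t (i - N) = 0" if "i > N + k" for i
  proof -
    have "i - N \<notin> {1..k}"
      using that by auto
    then show ?thesis
      using t unfolding tern_def by blast
  qed
  moreover have "t (i - N) \<in> {-1, 0, 1}" if "N < i" "i \<le> N + k" for i
  proof -
    have "i - N \<in> {1..k}"
      using that by auto
    then show ?thesis
      using t unfolding tern_def by blast
  qed
  moreover have "s 0 = 0"
    using s by (simp add: tern_def)
  ultimately show "v \<in> tern (N + k)"
    using s unfolding tern_def v_def by (auto simp: Suc_le_eq)
  have "{i. v i = c} = {i. s i = c} \<union> (+) N ` {i. t i = c}" if "c \<noteq> 0" for c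
  proof (intro set_eqI iffI)
    fix i assume i: "i \<in> {i. v i = c}"
    show "i \<in> {i. s i = c} \<union> (+) N ` {i. t i = c}"
    proof (cases "i \<le> N")
      case False
      then have "i = N + (i - N)" "t (i - N) = c"
        using i by (auto simp: v_def)
      then show ?thesis
        by blast
    qed (use i in \<open>simp add: v_def\<close>)
  next
    fix i assume "i \<in> {i. s i = c} \<union> (+) N ` {i. t i = c}"
    then consider "s i = c" | j where "i = N + j" "t j = c"
      by blast
    then show "i \<in> {i. v i = c}"
    proof cases
      case 1
      then have "i \<in> {1..N}"
        using s that unfolding tern_def by auto
      then show ?thesis
        using 1 by (simp add: v_def)
    next
      case 2
      then have "j \<in> {1..k}"
        using t that unfolding tern_def by auto
      then show ?thesis
        using 2 by (simp add: v_def)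
    qed
  qed
  from this[of 1] this[of "-1"]
  show "Plus v = Plus s \<union> (+) N ` Plus t" "Minus v = Minus s \<union> (+) N ` Minus t"
    by (simp_all add: Plus_def Minus_def)
qed

lemma tern_split:
  assumes v: "v \<in> tern (N + k)"
  obtains s t where "s \<in> tern N" "t \<in> tern k" "v = (\<lambda>i. if i \<le> N then s i else t (i - N))"
    "Plus s = Plus v \<inter> {1..N}" "Minus s = Minus v \<inter> {1..N}"
proof -
  define s where "s = (\<lambda>i. if i \<le> N then v i else 0)"
  define t where "t = (\<lambda>i. if i = 0 then 0 else v (N + i))"
  have v0: "v 0 = 0"
    using v by (simp add: tern_def)
  have "s \<in> tern N" "t \<in> tern k" "v = (\<lambda>i. if i \<le> N then s i else t (i - N))"
    using v by (auto simp: s_def t_def tern_def)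
  moreover have "Plus s = Plus v \<inter> {1..N}" "Minus s = Minus v \<inter> {1..N}"
    using v0 by (auto simp: Plus_def Minus_def s_def Suc_le_eq intro!: Nat.gr0I)
  ultimately show ?thesis
    using that by blast
qed

lemma wt_split:
  assumes s: "s \<in> tern (length xs)" and t: "t \<in> tern (length ys)"
    and v: "v = (\<lambda>i. if i \<le> length xs then s i else t (i - length xs))"
  shows "wt (xs @ ys) (Plus v) = wt xs (Plus s) + wt ys (Plus t)"
    "wt (xs @ ys) (Minus v) = wt xs (Minus s) + wt ys (Minus t)"
proof -
  have *: "wt (xs @ ys) (A \<union> (+) (length xs) ` B) = wt xs A + wt ys B"
    if "A \<subseteq> {1..length xs}" "B \<subseteq> {1..length ys}" for A B
  proof -
    have "wt (xs @ ys) (A \<union> (+) (length xs) ` B) = wt (xs @ ys) A + wt (xs @ ys) ((+) (length xs) ` B)"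
      using that finite_subset[OF that(1)] finite_subset[OF that(2)] by (intro wt_Un) fastforce+
    moreover have "0 \<notin> B"
      using that(2) by auto
    ultimately show ?thesis
      using that(1) by (simp add: wt_append)
  qed
  show "wt (xs @ ys) (Plus v) = wt xs (Plus s) + wt ys (Plus t)"
    "wt (xs @ ys) (Minus v) = wt xs (Minus s) + wt ys (Minus t)"
    unfolding v using vects_times_split[OF s t] *[OF tern_support(1)[OF s] tern_support(1)[OF t]]
      *[OF tern_support(2)[OF s] tern_support(2)[OF t]] by simp_all
qed

text \<open>Whether a vector is removed depends on its partition; when the family is described by
  restrictions, this equation reduces the decision for a product vector to its first factor.\<close>

lemma restrict_vect_partition:
  assumes v: "v \<in> tern (N + k)" and s: "Plus s = Plus v \<inter> {1..N}" "Minus s = Minus v \<inter> {1..N}" "s \<in> tern N"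
  shows "restrict_part {1..N} (vect_partition (N + k) v) = vect_partition N s"
proof -
  have s0: "s i = 0 \<longleftrightarrow> v i = 0" if "i \<in> {1..N}" for i
  proof -
    have "v i \<in> {-1, 0, 1}" "s i \<in> {-1, 0, 1}"
      using v s(3) that by (auto simp: tern_def)
    moreover have "s i = 1 \<longleftrightarrow> v i = 1" "s i = -1 \<longleftrightarrow> v i = -1"
      using s(1,2) that by (auto simp: Plus_def Minus_def)
    ultimately show ?thesis
      by auto
  qed
  have "restrict_part {1..N} (vect_partition (N + k) v) =
      ({Plus v \<inter> {1..N}, Minus v \<inter> {1..N}} - {{}}) \<union> ((\<lambda>i. {i} \<inter> {1..N}) ` {i \<in> {1..N+k}. v i = 0} - {{}})"
    unfolding restrict_part_def vect_partition_def by auto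
  also have "(\<lambda>i. {i} \<inter> {1..N}) ` {i \<in> {1..N+k}. v i = 0} - {{}} = (\<lambda>i. {i}) ` {i \<in> {1..N}. v i = 0}"
    by (intro set_eqI iffI) (auto split: if_splits simp: image_iff)
  also have "{i \<in> {1..N}. v i = 0} = {i \<in> {1..N}. s i = 0}"
    using s0 by blast
  finally show ?thesis
    unfolding vect_partition_def s by (simp add: image_Collect)
qed

lemma vect_partition_Pt:
  assumes "v \<in> tern n"
  shows "vect_partition n v \<in> Pt {1..n}"
proof -
  have "\<Union>(vect_partition n v) = {1..n}"
  proof (intro set_eqI iffI)
    fix i assume "i \<in> \<Union>(vect_partition n v)"
    then consider "i \<in> Plus v" | "i \<in> Minus v" | "i \<in> {1..n}"
      by (auto simp: vect_partition_def)
    then show "i \<in> {1..n}"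
      using tern_support[OF assms] by cases blast+
  next
    fix i assume i: "i \<in> {1..n}"
    then consider "i \<in> Plus v" | "i \<in> Minus v" | "v i = 0"
      using assms unfolding tern_def Plus_def Minus_def by blast
    then show "i \<in> \<Union>(vect_partition n v)"
      using i by cases (auto simp: vect_partition_def)
  qed
  moreover have "disjoint (vect_partition n v)"
    unfolding disjoint_def vect_partition_def by (auto simp: Plus_def Minus_def)
  ultimately show ?thesis
    by (auto simp: Pt_def partition_on_def vect_partition_def)
qed

lemma FQ_empty: "FQ F M n S {} = F (n, S)"
  by (simp add: FQ_def pquot_empty)

lemma merge_cut_S_vec: "\<pi> \<in> OPt {1..length l} \<Longrightarrow> merge_cut \<pi> (S_vec l) = cut_of (map (wt l) \<pi>)"
  by (simp add: merge_cut_def cut_of_def merge_S_vec)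

lemma positive_map_wt:
  assumes "positive l" "\<pi> \<in> OPt {1..length l}"
  shows "positive (map (wt l) \<pi>)"
proof -
  have "set \<pi> \<in> Pt {1..length l}"
    using assms(2) by (simp add: OPt_def Pt_def)
  then have "0 < wt l B" if "B \<in> set \<pi>" for B
    using Pt_block[OF _ that] wt_eq_0[OF assms(1), of B] by auto
  then show ?thesis
    by (auto simp: positive_def)
qed

section \<open>Resonance functors on products\<close>

context
  fixes F :: "cut \<Rightarrow> 'a pspace" and M :: "cut \<Rightarrow> cut \<Rightarrow> nat set list \<Rightarrow> 'a \<Rightarrow> 'a"
  assumes rf: "resonance_functor F M"
begin

lemma pspace_F: "n \<ge> 1 \<Longrightarrow> S \<in> cuts n \<Longrightarrow> pspace (F (n, S))"
  using rf unfolding resonance_functor_def pfunctor_def by blast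

lemma pspace_cut_of: "l \<noteq> [] \<Longrightarrow> positive l \<Longrightarrow> pspace (F (cut_of l))"
  unfolding cut_of_def by (intro pspace_F S_vec_in_cuts) (auto simp: Suc_le_eq)

lemma pspace_FQ: "n \<ge> 1 \<Longrightarrow> S \<in> cuts n \<Longrightarrow> pspace (FQ F M n S \<Gamma>)"
  unfolding FQ_def by (intro pspace_pquot pspace_F)

lemma FQ_cong:
  assumes "n \<ge> 1" "S \<in> cuts n" "T \<in> cuts n" "closed_parts n S \<Gamma>" "closed_parts n T \<Gamma>" "Q n S \<Gamma> = Q n T \<Gamma>"
  shows "FQ F M n S \<Gamma> \<simeq>\<^sub>* FQ F M n T \<Gamma>"
proof -
  have "axiom_A2 F M"
    using rf by (simp add: resonance_functor_def)
  then show ?thesis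
    unfolding axiom_A2_def using assms by metis
qed

lemma Frel_Q:
  assumes n: "n \<ge> 1" and S: "S \<in> cuts n" and c: "\<And>R. R \<subseteq> S \<Longrightarrow> closed_parts n R \<Gamma>"
  shows "relative_cut n (Q n S \<Gamma>)" "Frel F M n (Q n S \<Gamma>) \<simeq>\<^sub>* FQ F M n S \<Gamma>" "pspace (Frel F M n (Q n S \<Gamma>))"
proof -
  note q = Q_relative_cut[OF S c]
  show "relative_cut n (Q n S \<Gamma>)"
    by (rule q(1))
  have "snd (Q n S \<Gamma>) = \<Gamma>"
    by (simp add: Q_def)
  then show "Frel F M n (Q n S \<Gamma>) \<simeq>\<^sub>* FQ F M n S \<Gamma>" "pspace (Frel F M n (Q n S \<Gamma>))"
    unfolding Frel_def using FQ_cong[OF n q(3) S c[OF q(4)] c[OF order.refl] q(2)] pspace_FQ[OF n q(3)]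
    by simp_all
qed

text \<open>Axiom A3 with an absolute second factor. By \<open>bal\<close> every surviving vector is
  balanced on the first \<open>N\<close> indices, hence also on the others, so the survivors are
  precisely the products of survivors of \<open>rest\<close> with relations of
  \<open>zs\<close>.\<close>

lemma FQ_append:
  fixes rest zs :: "nat list"
  defines "N \<equiv> length rest" and "k \<equiv> length zs" and "l \<equiv> rest @ zs"
  assumes ne: "rest \<noteq> []" "zs \<noteq> []" and l: "positive l"
    and c\<Lambda>: "\<And>R. R \<subseteq> S_vec rest \<Longrightarrow> closed_parts N R \<Lambda>"
    and c\<Gamma>: "\<And>R. R \<subseteq> S_vec l \<Longrightarrow> closed_parts (N + k) R \<Gamma>"
    and \<Gamma>: "\<Gamma> = {\<rho> \<in> Pt {1..N + k}. restrict_part {1..N} \<rho> \<in> \<Lambda>}"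
    and bal: "\<And>v. v \<in> S_vec l \<Longrightarrow> vect_partition (N + k) v \<notin> \<Gamma> \<Longrightarrow>
      wt l (Plus v \<inter> {1..N}) = wt l (Minus v \<inter> {1..N})"
  shows "FQ F M (N + k) (S_vec l) \<Gamma> \<simeq>\<^sub>* smash (FQ F M N (S_vec rest) \<Lambda>) (F (cut_of zs))"
proof -
  have pos: "positive rest" "positive zs"
    using l by (auto simp: positive_def l_def)
  have Nk: "N \<ge> 1" "k \<ge> 1"
    using ne by (auto simp: N_def k_def Suc_le_eq)
  have cuts: "S_vec rest \<in> cuts N" "S_vec zs \<in> cuts k" "S_vec l \<in> cuts (N + k)"
    using S_vec_in_cuts[OF pos(1)] S_vec_in_cuts[OF pos(2)] S_vec_in_cuts[OF l] by (simp_all add: N_def k_def l_def)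
  let ?R = "Q N (S_vec rest) \<Lambda>" and ?R' = "Q k (S_vec zs) {}"
  note R = Frel_Q[OF Nk(1) cuts(1) c\<Lambda>] and R' = Frel_Q[OF Nk(2) cuts(2) closed_parts_empty]
  have "axiom_A3 F M"
    using rf by (simp add: resonance_functor_def)
  then have A3: "smash (Frel F M N ?R) (Frel F M k ?R') \<simeq>\<^sub>* Frel F M (N + k) (rel_times N k ?R ?R')"
    unfolding axiom_A3_def using Nk R(1) R'(1) by blast
  define V where "V = vects_times N (rel_minus N (S_vec rest) \<Lambda>) (S_vec zs)"
  have VI: "v \<in> V \<longleftrightarrow> v \<in> S_vec l \<and> vect_partition (N + k) v \<notin> \<Gamma>" for v
  proof
    assume "v \<in> V"
    then obtain s t where st: "s \<in> S_vec rest" "vect_partition N s \<notin> \<Lambda>" "t \<in> S_vec zs"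
      "v = (\<lambda>i. if i \<le> N then s i else t (i - N))"
      by (auto simp: V_def vects_times_def rel_minus_def)
    have tern: "s \<in> tern N" "t \<in> tern k"
      using st by (auto simp: S_vec_iff N_def k_def)
    note sp = vects_times_split[OF tern, folded st(4)]
    have "wt l (Plus v) = wt rest (Plus s) + wt zs (Plus t)" "wt l (Minus v) = wt rest (Minus s) + wt zs (Minus t)"
      using wt_split[of s rest t zs v] tern st(4) unfolding N_def k_def l_def by blast+
    then have "v \<in> S_vec l"
      using st(1,3) sp(1) by (simp add: S_vec_iff N_def k_def l_def)
    moreover have "Plus s = Plus v \<inter> {1..N}" "Minus s = Minus v \<inter> {1..N}"
      using sp(2,3) tern_support[OF tern(1)] tern_support[OF tern(2)] by auto
    then have "restrict_part {1..N} (vect_partition (N + k) v) = vect_partition N s"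
      using restrict_vect_partition[OF sp(1)] tern(1) by blast
    then have "vect_partition (N + k) v \<notin> \<Gamma>"
      using st(2) by (simp add: \<Gamma>)
    ultimately show "v \<in> S_vec l \<and> vect_partition (N + k) v \<notin> \<Gamma>"
      by blast
  next
    assume v: "v \<in> S_vec l \<and> vect_partition (N + k) v \<notin> \<Gamma>"
    then have vt: "v \<in> tern (N + k)" and wv: "wt l (Plus v) = wt l (Minus v)"
      by (auto simp: S_vec_iff N_def k_def l_def)
    obtain s t where st: "s \<in> tern N" "t \<in> tern k" "v = (\<lambda>i. if i \<le> N then s i else t (i - N))"
      "Plus s = Plus v \<inter> {1..N}" "Minus s = Minus v \<inter> {1..N}"
      using tern_split[OF vt] by blast
    have "wt l (Plus s) = wt l (Minus s)"
      using bal v st by simp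
    then have ws: "wt rest (Plus s) = wt rest (Minus s)"
      using tern_support[OF st(1)] by (simp add: l_def N_def wt_append)
    then have sS: "s \<in> S_vec rest"
      using st by (simp add: S_vec_iff N_def)
    have "wt l (Plus v) = wt rest (Plus s) + wt zs (Plus t)" "wt l (Minus v) = wt rest (Minus s) + wt zs (Minus t)"
      using wt_split[of s rest t zs v] st(1-3) unfolding N_def k_def l_def by blast+
    then have tS: "t \<in> S_vec zs"
      using st(2) ws wv by (simp add: S_vec_iff k_def)
    have "vect_partition N s \<notin> \<Lambda>"
      using v restrict_vect_partition[OF vt st(4,5,1)] vect_partition_Pt[OF vt] by (simp add: \<Gamma>)
    then show "v \<in> V"
      unfolding V_def vects_times_def rel_minus_def using sS tS st(3) by blast
  qed
  \<comment> \<open>The second family of the product is empty because nothing is collapsed in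
    \<open>zs\<close>; the first one only constrains the restriction to
    \<open>{1..N}\<close>.\<close>
  have parts: "parts_times {1..N} {N+1..N+k} \<Lambda> (Pt {N+1..N+k}) \<union>
      parts_times {1..N} {N+1..N+k} (Pt {1..N}) (shift_parts N {}) = \<Gamma>"
  proof -
    have "{1..N} \<union> {N+1..N+k} = {1..N+k}"
      by auto
    then show ?thesis
      using restrict_part_Pt[of _ "{1..N+k}" "{N+1..N+k}"]
      by (auto simp: parts_times_def shift_parts_def \<Gamma>)
  qed
  have "rel_minus k (S_vec zs) {} = S_vec zs"
    by (simp add: rel_minus_def)
  then have times: "rel_times N k ?R ?R' = (V, \<Gamma>)"
    using parts by (simp add: rel_times_def Q_def V_def)
  have VS: "V \<subseteq> S_vec l"
    using VI by blast
  have V: "tspan (N + k) V \<in> cuts (N + k)" "tspan (N + k) V \<subseteq> S_vec l" "V \<subseteq> tspan (N + k) V"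
    using tspan_in_cuts[OF cuts(3) VS] tspan_subset_cut[OF cuts(3) VS] tspan_superset[of V "N + k"]
      cuts_tspan(2)[OF cuts(3)] VS by auto
  \<comment> \<open>The product axiom yields the cut spanned by \<open>V\<close>, which may be
    smaller than \<open>S_vec l\<close>; both leave the same vectors after the removal, so A2
    identifies the spaces.\<close>
  have "Q (N + k) (tspan (N + k) V) \<Gamma> = Q (N + k) (S_vec l) \<Gamma>"
    using V VI by (auto simp: Q_def rel_minus_def)
  then have "FQ F M (N + k) (tspan (N + k) V) \<Gamma> \<simeq>\<^sub>* FQ F M (N + k) (S_vec l) \<Gamma>"
    using Nk V(1,2) cuts(3) c\<Gamma> by (intro FQ_cong) auto
  then have 1: "Frel F M (N + k) (rel_times N k ?R ?R') \<simeq>\<^sub>* FQ F M (N + k) (S_vec l) \<Gamma>"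
    by (simp add: times Frel_def)
  have "smash (Frel F M N ?R) (Frel F M k ?R') \<simeq>\<^sub>* smash (FQ F M N (S_vec rest) \<Lambda>) (F (cut_of zs))"
    using R R' pspace_FQ[OF Nk(1) cuts(1)] pspace_F[OF Nk(2) cuts(2)]
    by (intro smash_pequiv) (simp_all add: FQ_empty cut_of_def k_def)
  from pequiv_trans[OF pequiv_sym[OF 1] pequiv_trans[OF pequiv_sym[OF A3] this]] show ?thesis .
qed

lemma F_append:
  assumes "rest \<noteq> []" "zs \<noteq> []" "positive (rest @ zs)"
    and "\<And>v. v \<in> S_vec (rest @ zs) \<Longrightarrow>
      wt (rest @ zs) (Plus v \<inter> {1..length rest}) = wt (rest @ zs) (Minus v \<inter> {1..length rest})"
  shows "F (cut_of (rest @ zs)) \<simeq>\<^sub>* smash (F (cut_of rest)) (F (cut_of zs))"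
proof -
  have "FQ F M (length rest + length zs) (S_vec (rest @ zs)) {} \<simeq>\<^sub>*
      smash (FQ F M (length rest) (S_vec rest) {}) (F (cut_of zs))"
    by (rule FQ_append[OF assms(1-3) closed_parts_empty closed_parts_empty]) (use assms(4) in simp_all)
  then show ?thesis
    by (simp add: FQ_empty cut_of_def)
qed

lemma A1_inclusion:
  assumes "n \<ge> 1" "S \<in> cuts n" "\<pi> \<in> OPt {1..n}"
  shows "inclusion_map (F (merge_cut \<pi> S)) (F (n, S)) (incl M n S \<pi>)"
    "FQ F M n S (down n (set \<pi>) S) \<simeq>\<^sub>* pquot (F (n, S)) (incl_im F M n S \<pi>)"
  using assms rf pequiv_sym unfolding resonance_functor_def axiom_A1_def by blast+

lemma FQ_down_contractible:
  assumes "n \<ge> 1" "S \<in> cuts n" "\<pi> \<in> OPt {1..n}" "pspace (F (merge_cut \<pi> S))"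
    and "pcontractible (F (merge_cut \<pi> S))"
  shows "FQ F M n S (down n (set \<pi>) S) \<simeq>\<^sub>* F (n, S)"
  using pequiv_trans[OF A1_inclusion(2)[OF assms(1-3), unfolded incl_im_def]
      pquot_contractible_pequiv[OF assms(4) pspace_F[OF assms(1,2)] A1_inclusion(1)[OF assms(1-3)] assms(5)]] .

end

section \<open>Relations that involve the largest part\<close>

text \<open>The property of \<open>I(\<lambda>)\<close> that replaces lexicographic maximality; sets of minimal cardinality have it, too.\<close>

definition unmergeable :: "nat list \<Rightarrow> nat set \<Rightarrow> bool" where
  "unmergeable l I \<longleftrightarrow> I \<subseteq> {1..length l} \<and>
     (\<forall>q\<in>{1..length l} - I. \<forall>X\<subseteq>I. wt l X = part l q \<longrightarrow> card X \<le> 1)"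

text \<open>Induction on the size of \<open>X\<close>, peeling off a largest part. If it occurs in
  \<open>X\<close>, sequentiality supplies a subset of \<open>Y\<close> of the same weight, which is
  assigned to it. If it occurred only in \<open>Y\<close>, sequentiality would write it as a sum
  over a subset of \<open>X\<close>; unmergeability makes that subset a single index, so the part
  occurs in \<open>X\<close> after all.\<close>

lemma unmergeable_decompose:
  assumes l: "seqm (mset l)" "positive l" and I: "unmergeable l I"
    and "X \<subseteq> I" "Y \<subseteq> {1..length l} - I" "wt l X = wt l Y"
  shows "\<exists>g. g ` Y \<subseteq> X \<and> (\<forall>x\<in>X. part l x = wt l {y\<in>Y. g y = x})"
  using assms(4-)
proof (induction "card X" arbitrary: X Y rule: less_induct)
  case less
  have I': "I \<subseteq> {1..length l}"
    using I by (simp add: unmergeable_def)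
  have XY: "X \<subseteq> {1..length l}" "Y \<subseteq> {1..length l}" "finite X" "finite Y"
    using less.prems I' finite_subset[of X "{1..length l}"] finite_subset[of Y "{1..length l}"] by auto
  show ?case
  proof (cases "X = {}")
    case True
    then have "Y = {}"
      using less.prems(3) wt_eq_0[OF l(2) XY(2)] by simp
    with True show ?thesis
      by simp
  next
    case False
    define m where "m = Max (part l ` (X \<union> Y))"
    have "m \<in> part l ` (X \<union> Y)"
      unfolding m_def by (rule Max_in) (use XY False in auto)
    then obtain z where z: "z \<in> X \<union> Y" "part l z = m"
      by auto
    have max: "part l x \<le> m" if "x \<in> X \<union> Y" for x
      unfolding m_def by (rule Max_ge) (use XY that in auto)
    show ?thesis
    proof (cases "\<exists>q\<in>X. part l q = m")
      case True
      then obtain q where q: "q \<in> X" "part l q = m"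
        by blast
      obtain J where J: "J \<subseteq> Y" "wt l J = part l q"
        by (rule seqm_index[OF l(1) XY(1,2) less.prems(3) q(1)]) (use max q in auto)
      have "wt l (X - {q}) = wt l (Y - J)"
        using wt_Diff[OF XY(3), of "{q}"] wt_Diff[OF XY(4) J(1)] q J less.prems(3) by simp
      moreover have "card (X - {q}) < card X"
        using q XY by (meson card_Diff1_less)
      ultimately obtain g where g: "g ` (Y - J) \<subseteq> X - {q}"
        "\<forall>x\<in>X - {q}. part l x = wt l {y\<in>Y - J. g y = x}"
        using less.hyps[of "X - {q}" "Y - J"] less.prems by blast
      define h where "h y = (if y \<in> J then q else g y)" for y
      have "{y\<in>Y. h y = q} = J"
        using g(1) J(1) by (auto simp: h_def)
      moreover have "{y\<in>Y. h y = x} = {y\<in>Y - J. g y = x}" if "x \<noteq> q" for x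
        using that by (auto simp: h_def)
      ultimately have "\<forall>x\<in>X. part l x = wt l {y\<in>Y. h y = x}"
        using g(2) J(2) by (metis DiffI empty_iff insertE)
      moreover have "h ` Y \<subseteq> X"
        using g(1) q by (auto simp: h_def)
      ultimately show ?thesis
        by blast
    next
      case False
      then have zY: "z \<in> Y"
        using z by blast
      obtain J where J: "J \<subseteq> X" "wt l J = part l z"
        by (rule seqm_index[OF l(1) XY(2,1) less.prems(3)[symmetric] zY]) (use max z in auto)
      have zI: "z \<in> {1..length l} - I"
        using zY less.prems(2) by blast
      moreover have "J \<subseteq> I"
        using J(1) less.prems(1) by blast
      ultimately have "card J \<le> 1"
        using I J(2) unfolding unmergeable_def by blast
      moreover have "J \<noteq> {}"
        using J(2) positive_part[OF l(2), of z] zI by auto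
      moreover have "finite J"
        using J(1) XY(3) finite_subset by blast
      ultimately have "card J = 1"
        using card_gt_0_iff[of J] by linarith
      then obtain x where "J = {x}"
        by (auto simp: card_1_singleton_iff)
      then show ?thesis
        using J z False by auto
    qed
  qed
qed

text \<open>\<open>I - J\<close> and \<open>J - I\<close> have equal weight, so the elements of
  \<open>J - I\<close> can be grouped to replace those of \<open>I - J\<close>. The block map sends
  \<open>I\<close> to \<open>E\<close>, every index of \<open>J - I\<close> to the block of the
  element it helps to replace, and every other singleton to its own block.\<close>

lemma down_one_block:
  assumes l: "seqm (mset l)" "positive l" and I: "unmergeable l I"
    and \<rho>: "\<rho> \<in> Pt {1..length l}" and E: "E \<in> \<rho>" and J: "J \<subseteq> E" "wt l J = wt l I" and "I \<noteq> {}"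
  shows "\<rho> \<in> down (length l) (one_block (length l) I) (S_vec l)"
proof -
  let ?V = "{1..length l}"
  have IV: "I \<subseteq> ?V" and EV: "E \<subseteq> ?V"
    using I Pt_block(1)[OF \<rho> E] by (auto simp: unmergeable_def)
  then have JV: "J \<subseteq> ?V"
    using J(1) by blast
  have fin: "finite I" "finite J"
    using IV JV finite_subset by blast+
  have "wt l (I - J) = wt l (J - I)"
  proof -
    have "wt l ((I - J) \<union> (I \<inter> J)) = wt l (I - J) + wt l (I \<inter> J)"
      "wt l ((J - I) \<union> (I \<inter> J)) = wt l (J - I) + wt l (I \<inter> J)"
      using fin by (intro wt_Un; auto)+
    moreover have "(I - J) \<union> (I \<inter> J) = I" "(J - I) \<union> (I \<inter> J) = J"
      by auto
    ultimately show ?thesis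
      using J(2) by simp
  qed
  then obtain g where g: "g ` (J - I) \<subseteq> I - J" "\<forall>x\<in>I - J. part l x = wt l {y\<in>J - I. g y = x}"
    using unmergeable_decompose[OF l I, of "I - J" "J - I"] JV by blast
  define blk where "blk z = (SOME E. E \<in> \<rho> \<and> z \<in> E)" for z
  have blk: "blk z \<in> \<rho> \<and> z \<in> blk z" if "z \<in> ?V" for z
  proof -
    have "z \<in> \<Union>\<rho>"
      unfolding Pt_Union[OF \<rho>] by (rule that)
    then show ?thesis
      unfolding blk_def by (intro someI_ex[of "\<lambda>E. E \<in> \<rho> \<and> z \<in> E"]) blast
  qed
  have blk_eq: "blk z = E' \<longleftrightarrow> z \<in> E'" if "z \<in> ?V" "E' \<in> \<rho>" for z E'
    using blk[OF that(1)] Pt_disjoint[OF \<rho> _ that(2), of "blk z"] by auto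
  define h where "h z = (if z \<in> J - I then g z else z)" for z
  have hV: "h z \<in> ?V" if "z \<in> ?V" for z
  proof (cases "z \<in> J - I")
    case True
    then have "g z \<in> I"
      using g(1) by blast
    then show ?thesis
      using True IV by (auto simp: h_def)
  qed (use that in \<open>auto simp: h_def\<close>)
  define f where "f B = (if B = I then E else blk (h (the_elem B)))" for B
  have sI: "{z} \<noteq> I" if "z \<in> ?V - I" for z
    using that by auto
  have "block_map (wt l) (one_block (length l) I) \<rho> f"
    unfolding block_map_def
  proof (intro conjI ballI)
    show "f ` one_block (length l) I \<subseteq> \<rho>"
      using E blk hV by (auto simp: f_def one_block_eq)
  next
    fix E' assume E': "E' \<in> \<rho>"
    have E'V: "E' \<subseteq> ?V" "finite E'"
      using Pt_block(1)[OF \<rho> E'] finite_subset by auto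
    let ?Z = "{z \<in> ?V - I. h z \<in> E'}"
    let ?S = "if E' = E then {I} else {}"
    have eq: "{B \<in> one_block (length l) I. f B = E'} = ?S \<union> (\<lambda>z. {z}) ` ?Z"
    proof -
      have "f {z} = E' \<longleftrightarrow> h z \<in> E'" if "z \<in> ?V - I" for z
        using sI[OF that] blk_eq[OF hV E', of z] that by (simp add: f_def)
      then have "{B \<in> (\<lambda>z. {z}) ` (?V - I). f B = E'} = (\<lambda>z. {z}) ` ?Z"
        by blast
      moreover have "{B \<in> {I}. f B = E'} = ?S"
        by (auto simp: f_def)
      moreover have "{B \<in> one_block (length l) I. f B = E'} =
          {B \<in> {I}. f B = E'} \<union> {B \<in> (\<lambda>z. {z}) ` (?V - I). f B = E'}"
        unfolding one_block_eq by blast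
      ultimately show ?thesis
        by simp
    qed
    have "(\<Sum>B\<in>{B \<in> one_block (length l) I. f B = E'}. wt l B) = (\<Sum>B\<in>?S. wt l B) + (\<Sum>B\<in>(\<lambda>z. {z}) ` ?Z. wt l B)"
      unfolding eq using sI by (intro sum.union_disjoint) auto
    also have "(\<Sum>B\<in>(\<lambda>z. {z}) ` ?Z. wt l B) = wt l ?Z"
      by (subst sum.reindex) (auto simp: wt_def inj_on_def)
    \<comment> \<open>\<open>E'\<close> receives its own indices outside \<open>I\<close> and
      \<open>J\<close>, and for each of its indices in \<open>I - J\<close> a group of the same
      weight. Only the indices in \<open>J\<close> are missing; these lie in \<open>E\<close>, where
      \<open>I\<close> makes up for them.\<close>
    also have "wt l ?Z = wt l (E' - J)"
    proof -
      let ?Y = "{y \<in> J - I. g y \<in> E'}"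
      have "?Z = (E' - J - I) \<union> ?Y"
        using E'V JV by (auto simp: h_def split: if_splits)
      then have "wt l ?Z = wt l (E' - J - I) + wt l ?Y"
        using fin E'V by (simp, intro wt_Un) auto
      also have "wt l ?Y = wt l ((I - J) \<inter> E')"
      proof -
        have "wt l ((I - J) \<inter> E') = (\<Sum>x\<in>(I - J) \<inter> E'. wt l {y\<in>J - I. g y = x})"
          unfolding wt_def[of l "(I - J) \<inter> E'"] using g(2) by (intro sum.cong) auto
        also have "\<dots> = (\<Sum>x\<in>(I - J) \<inter> E'. wt l {y\<in>?Y. g y = x})"
          by (intro sum.cong arg_cong[of _ _ "wt l"]) auto
        also have "\<dots> = wt l ?Y"
          unfolding wt_def using fin g(1) by (intro sum.group) auto
        finally show ?thesis
          by simp
      qed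
      also have "wt l (E' - J - I) + wt l ((I - J) \<inter> E') = wt l ((E' - J - I) \<union> ((I - J) \<inter> E'))"
        using fin E'V by (intro wt_Un[symmetric]) auto
      also have "(E' - J - I) \<union> ((I - J) \<inter> E') = E' - J"
        by auto
      finally show ?thesis .
    qed
    also have "(\<Sum>B\<in>?S. wt l B) + wt l (E' - J) = wt l E'"
    proof (cases "E' = E")
      case True
      then show ?thesis
        using J wt_Diff[OF E'V(2), of J] wt_mono[OF E'V(2), of J l] by simp
    next
      case False
      then have "E' - J = E'"
        using Pt_disjoint[OF \<rho> E' E] J(1) by blast
      then show ?thesis
        using False by simp
    qed
    finally show "wt l E' = (\<Sum>B\<in>{B \<in> one_block (length l) I. f B = E'}. wt l B)"
      by simp
  qed
  then show ?thesis
    using block_map_imp_down[OF l(2) one_block_Pt[OF IV assms(8)] \<rho>] by blast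
qed

section \<open>Lists that end in several copies of the largest part\<close>

lemma part_replicate_tail:
  "i \<in> {length rest + 1..length rest + k} \<Longrightarrow> part (rest @ replicate k M) i = M"
  by (auto simp: part_def nth_append)

lemma part_head: "i \<in> {1..length rest} \<Longrightarrow> part (rest @ zs) i \<in> set rest"
  by (auto simp: part_def nth_append)

context
  fixes rest :: "nat list" and k M :: nat
  assumes seq: "seqm (mset (rest @ replicate k M))" and pos: "positive (rest @ replicate k M)"
    and less: "\<And>x. x \<in> set rest \<Longrightarrow> x < M" and k: "k \<ge> 1"
begin

lemma M_pos: "M > 0"
  using pos k by (auto simp: positive_def)

lemma pos_rest: "positive rest"
  unfolding positive_def
proof
  fix x assume "x \<in> set rest"
  then have "x \<in> set (rest @ replicate k M)"
    by simp
  then show "0 < x"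
    using pos unfolding positive_def by blast
qed

lemma seq_rest: "seqm (mset rest)"
  using seqm_mono[OF seq] by simp

lemma part_le_M: "i \<in> {1..length rest + k} \<Longrightarrow> part (rest @ replicate k M) i \<le> M"
  using part_head[of i rest "replicate k M"] less part_replicate_tail[of i rest k M]
  by (cases "i \<le> length rest") (auto intro: less_imp_le)

lemma wt_tail:
  assumes "A \<subseteq> {length rest + 1..length rest + k}"
  shows "wt (rest @ replicate k M) A = card A * M"
  unfolding wt_def using assms part_replicate_tail by (subst sum.cong[OF refl, of A _ "\<lambda>_. M"]) auto

text \<open>\<open>d\<close> of the \<open>k\<close> tail indices realize \<open>d * M\<close>, so
  the relation lives in the whole list with the largest part on the left; sequentiality then finds
  \<open>M\<close> inside \<open>Y\<close>.\<close>

lemma surplus: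
  assumes d: "1 \<le> d" "d \<le> k" and XY: "X \<subseteq> {1..length rest}" "Y \<subseteq> {1..length rest}"
    and w: "d * M + wt rest X = wt rest Y"
  shows "\<exists>J\<subseteq>Y. wt rest J = M"
proof -
  let ?l = "rest @ replicate k M" and ?T = "{length rest + 1..length rest + k}"
  obtain T where T: "T \<subseteq> ?T" "card T = d"
    using obtain_subset_with_card_n[of d ?T] d by auto
  then have "finite T" "T \<noteq> {}"
    using d finite_subset by auto
  then obtain q where q: "q \<in> T"
    by blast
  have "wt ?l (T \<union> X) = wt ?l T + wt ?l X"
    using T XY \<open>finite T\<close> finite_subset[OF XY(1)] by (intro wt_Un) fastforce+
  then have "wt ?l (T \<union> X) = wt ?l Y"
    using wt_tail[OF T(1)] T(2) w XY by (simp add: wt_append)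
  moreover have "part ?l q = M"
    using q T part_replicate_tail by blast
  moreover have "T \<union> X \<subseteq> {1..length ?l}" "Y \<subseteq> {1..length ?l}"
    using T XY by auto
  ultimately have *: "wt ?l (T \<union> X) = wt ?l Y" "T \<union> X \<subseteq> {1..length ?l}" "Y \<subseteq> {1..length ?l}"
    and pq: "part ?l q = M"
    by blast+
  have "part ?l x \<le> part ?l q" if "x \<in> T \<union> X \<union> Y" for x
  proof -
    have "x \<in> {1..length rest + k}"
      using that *(2,3) by auto
    then show ?thesis
      unfolding pq by (rule part_le_M)
  qed
  then obtain J where "J \<subseteq> Y" "wt ?l J = M"
    using seqm_index[OF seq *(2,3,1), of q] q pq by auto
  then show ?thesis
    using XY(2) by (metis subset_trans wt_append(1))
qed

lemma wt_split_tail: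
  assumes "A \<subseteq> {1..length rest + k}"
  shows "wt (rest @ replicate k M) A =
    wt rest (A \<inter> {1..length rest}) + card (A \<inter> {length rest + 1..length rest + k}) * M"
proof -
  let ?l = "rest @ replicate k M" and ?T = "{length rest + 1..length rest + k}"
  have "wt ?l ((A \<inter> {1..length rest}) \<union> (A \<inter> ?T)) = wt ?l (A \<inter> {1..length rest}) + wt ?l (A \<inter> ?T)"
    by (intro wt_Un) auto
  moreover have "(A \<inter> {1..length rest}) \<union> (A \<inter> ?T) = A"
    using assms by auto
  moreover have "wt ?l (A \<inter> ?T) = card (A \<inter> ?T) * M"
    by (rule wt_tail) blast
  ultimately show ?thesis
    by (simp add: wt_append)
qed

text \<open>The side that is lighter on the small indices must contain more copies of
  \<open>M\<close>; the excess lies between 1 and \<open>k\<close> and feeds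
  \<open>surplus\<close>.\<close>

lemma unbalanced_aux:
  assumes A: "A \<subseteq> {1..length rest + k}" and B: "B \<subseteq> {1..length rest + k}"
    and w: "wt (rest @ replicate k M) A = wt (rest @ replicate k M) B"
    and lt: "wt rest (A \<inter> {1..length rest}) < wt rest (B \<inter> {1..length rest})"
  shows "\<exists>J\<subseteq>B \<inter> {1..length rest}. wt rest J = M"
proof -
  let ?T = "{length rest + 1..length rest + k}"
  define a where "a = card (A \<inter> ?T)"
  define b where "b = card (B \<inter> ?T)"
  have eq: "wt rest (A \<inter> {1..length rest}) + a * M = wt rest (B \<inter> {1..length rest}) + b * M"
    using w by (simp only: wt_split_tail[OF A] wt_split_tail[OF B] a_def b_def)
  then have "b * M < a * M"
    using lt by linarith
  then have ab: "b < a"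
    by simp
  have "a \<le> k"
    using card_mono[of ?T "A \<inter> ?T"] by (simp add: a_def)
  have "a * M = (a - b) * M + b * M"
    using ab by (simp flip: add_mult_distrib)
  then have "(a - b) * M + wt rest (A \<inter> {1..length rest}) = wt rest (B \<inter> {1..length rest})"
    using eq by linarith
  then show ?thesis
    using ab \<open>a \<le> k\<close> by (intro surplus[of "a - b"]) auto
qed

lemma unbalanced:
  assumes "v \<in> S_vec (rest @ replicate k M)"
    and "wt (rest @ replicate k M) (Plus v \<inter> {1..length rest}) \<noteq> wt (rest @ replicate k M) (Minus v \<inter> {1..length rest})"
  obtains B J where "B \<in> {Plus v, Minus v}" "J \<subseteq> B \<inter> {1..length rest}" "wt rest J = M"
proof -
  have v: "v \<in> tern (length rest + k)" "wt (rest @ replicate k M) (Plus v) = wt (rest @ replicate k M) (Minus v)"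
    using assms(1) by (simp_all add: S_vec_iff)
  note t = tern_support[OF v(1)]
  have "wt rest (Plus v \<inter> {1..length rest}) \<noteq> wt rest (Minus v \<inter> {1..length rest})"
    using assms(2) by (simp add: wt_append)
  then consider "wt rest (Plus v \<inter> {1..length rest}) < wt rest (Minus v \<inter> {1..length rest})"
    | "wt rest (Minus v \<inter> {1..length rest}) < wt rest (Plus v \<inter> {1..length rest})"
    by linarith
  then show ?thesis
  proof cases
    case 1
    from unbalanced_aux[OF t v(2) this] that show ?thesis
      by blast
  next
    case 2
    from unbalanced_aux[OF t(2,1) v(2)[symmetric] this] that show ?thesis
      by blast
  qed
qed

context
  fixes I :: "nat set"
  assumes I: "unmergeable rest I" and wI: "wt rest I = M"
begin

abbreviation tail_closure :: "nat set set set" where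
  "tail_closure \<equiv> down (length rest + k) (add_singles {length rest + 1..length rest + k} (one_block (length rest) I))
    (S_vec (rest @ replicate k M))"

lemma I_subset: "I \<subseteq> {1..length rest}" "I \<noteq> {}"
  using I wI M_pos by (auto simp: unmergeable_def)

text \<open>Pigeonhole: \<open>I\<close> and the \<open>k\<close> tail singletons are
  \<open>k + 1\<close> blocks of weight \<open>M\<close>, but the blocks of \<open>\<rho>\<close>
  contain only \<open>k\<close> tail indices. Some block receives more of the former than it holds
  of the latter and must cover the difference with small parts.\<close>

lemma closure_tail_block:
  assumes \<rho>: "\<rho> \<in> tail_closure"
  shows "\<exists>E\<in>\<rho>. \<exists>J\<subseteq>E \<inter> {1..length rest}. wt rest J = M"
proof -
  let ?N = "length rest" and ?l = "rest @ replicate k M" and ?T = "{length rest + 1..length rest + k}"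
  let ?\<pi> = "add_singles ?T (one_block ?N I)"
  have len: "length ?l = ?N + k" "{1..?N} \<union> ?T = {1..?N + k}"
    by auto
  have "?\<pi> \<in> Pt ({1..?N} \<union> ?T)"
    by (rule add_singles_Pt[OF one_block_Pt[OF I_subset]]) auto
  then have \<pi>: "?\<pi> \<in> Pt {1..length ?l}"
    by (simp only: len)
  obtain f where f: "f ` ?\<pi> \<subseteq> \<rho>" "\<And>E. E \<in> \<rho> \<Longrightarrow> wt ?l E = (\<Sum>B\<in>{B\<in>?\<pi>. f B = E}. wt ?l B)"
    and \<rho>P: "\<rho> \<in> Pt {1..?N + k}"
  proof -
    have "\<rho> \<in> Pt {1..?N + k}"
      using \<rho> by (simp add: down_def)
    moreover obtain f where "block_map (wt ?l) ?\<pi> \<rho> f"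
      using down_imp_block_map[OF \<pi>, of \<rho>] \<rho> unfolding len(1) by blast
    ultimately show thesis
      using that unfolding block_map_def by blast
  qed
  have fin\<rho>: "finite \<rho>"
    using Pt_finite[OF \<rho>P] by simp
  define T' where "T' = insert I ((\<lambda>i. {i}) ` ?T)"
  have T': "finite T'" "T' \<subseteq> ?\<pi>"
    by (auto simp: T'_def add_singles_def one_block_eq)
  have I_T: "I \<notin> (\<lambda>i. {i}) ` ?T"
    using I_subset by auto
  then have cT': "card T' = Suc k"
    by (simp add: T'_def card_image)
  have sT': "(\<Sum>E\<in>\<rho>. card {B\<in>T'. f B = E}) = card T'"
    unfolding card_eq_sum using T' f(1) by (intro sum.group[OF T'(1) fin\<rho>]) blast
  have sT: "(\<Sum>E\<in>\<rho>. card (E \<inter> ?T)) = k"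
  proof -
    have "card (\<Union>E\<in>\<rho>. E \<inter> ?T) = (\<Sum>E\<in>\<rho>. card (E \<inter> ?T))"
      by (rule card_UN_disjoint[OF fin\<rho>]) (use Pt_disjoint[OF \<rho>P] in auto)
    moreover have "(\<Union>E\<in>\<rho>. E \<inter> ?T) = ?T"
      using Pt_Union[OF \<rho>P] len(2) by blast
    ultimately show ?thesis
      by simp
  qed
  have "\<exists>E\<in>\<rho>. card (E \<inter> ?T) < card {B\<in>T'. f B = E}"
  proof (rule ccontr)
    assume "\<not> ?thesis"
    then have "(\<Sum>E\<in>\<rho>. card {B\<in>T'. f B = E}) \<le> (\<Sum>E\<in>\<rho>. card (E \<inter> ?T))"
      by (intro sum_mono) (simp add: not_less)
    then show False
      unfolding sT sT' cT' by simp
  qed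
  then obtain E where E: "E \<in> \<rho>" "card (E \<inter> ?T) < card {B\<in>T'. f B = E}"
    by blast
  define m where "m = card {B\<in>T'. f B = E}"
  define e where "e = card (E \<inter> ?T)"
  define X where "X = {i \<in> {1..?N} - I. f {i} = E}"
  have X: "X \<subseteq> {1..?N} - I"
    by (auto simp: X_def)
  have EV: "E \<subseteq> {1..?N + k}"
    using Pt_block(1)[OF \<rho>P E(1)] .
  have wT': "wt ?l B = M" if "B \<in> T'" for B
    using that part_replicate_tail[of _ rest k M] wI I_subset by (auto simp: T'_def wt_append)
  have "{B\<in>?\<pi>. f B = E} = {B\<in>T'. f B = E} \<union> (\<lambda>i. {i}) ` X"
    by (auto simp: add_singles_def one_block_eq T'_def X_def)
  moreover have "{B\<in>T'. f B = E} \<inter> (\<lambda>i. {i}) ` X = {}"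
    using I_subset by (auto simp: T'_def X_def)
  ultimately have "wt ?l E = (\<Sum>B\<in>{B\<in>T'. f B = E}. wt ?l B) + (\<Sum>B\<in>(\<lambda>i. {i}) ` X. wt ?l B)"
    using f(2)[OF E(1)] T'(1) finite_subset[OF X] by (simp add: sum.union_disjoint)
  also have "(\<Sum>B\<in>{B\<in>T'. f B = E}. wt ?l B) = m * M"
    using wT' by (simp add: m_def)
  also have "(\<Sum>B\<in>(\<lambda>i. {i}) ` X. wt ?l B) = wt ?l X"
    by (subst sum.reindex) (auto simp: wt_def inj_on_def)
  also have "wt ?l X = wt rest X"
    using X by (intro wt_append) blast
  finally have "m * M + wt rest X = wt rest (E \<inter> {1..?N}) + e * M"
    using wt_split_tail[OF EV] by (simp only: e_def)
  moreover have "m * M = (m - e) * M + e * M"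
    using E(2) by (simp add: m_def e_def flip: add_mult_distrib)
  ultimately have eq: "(m - e) * M + wt rest X = wt rest (E \<inter> {1..?N})"
    by linarith
  have "m \<le> Suc k"
    using card_mono[OF T'(1), of "{B\<in>T'. f B = E}"] cT' by (auto simp: m_def)
  have "\<exists>J\<subseteq>E \<inter> {1..?N}. wt rest J = M"
  proof (cases "m - e \<le> k")
    case True
    then show ?thesis
      using E(2) X eq by (intro surplus[of "m - e" X]) (auto simp: m_def e_def)
  next
    case False
    then have me: "m - e = k + 1"
      using \<open>m \<le> Suc k\<close> by simp
    \<comment> \<open>The excess is one more than the number of tail indices that
      \<open>surplus\<close> can use; letting \<open>I\<close>, of weight \<open>M\<close>, stand in
      for one copy absorbs it.\<close>
    have "wt rest (I \<union> X) = wt rest I + wt rest X"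
      using I_subset(1) X finite_subset[OF I_subset(1)] finite_subset[OF X] by (intro wt_Un) auto
    then have "k * M + wt rest (I \<union> X) = wt rest (E \<inter> {1..?N})"
      using eq wI me by simp
    then show ?thesis
      using k X I_subset by (intro surplus[of k "I \<union> X"]) auto
  qed
  then show ?thesis
    using E(1) by blast
qed

lemma restrict_in_down:
  assumes "\<rho> \<in> Pt {1..length rest + k}" "E \<in> \<rho>" "J \<subseteq> E \<inter> {1..length rest}" "wt rest J = M"
  shows "restrict_part {1..length rest} \<rho> \<in> down (length rest) (one_block (length rest) I) (S_vec rest)"
proof (rule down_one_block[OF seq_rest pos_rest I _ _ assms(3) _ I_subset(2)])
  show "restrict_part {1..length rest} \<rho> \<in> Pt {1..length rest}"
    by (rule restrict_part_Pt[OF assms(1)]) auto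
  have "J \<noteq> {}"
    using assms(4) M_pos by auto
  then show "E \<inter> {1..length rest} \<in> restrict_part {1..length rest} \<rho>"
    using assms(2,3) by (auto simp: restrict_part_def)
qed (simp add: assms(4) wI)

text \<open>This is the product form of the collapsed family that \<open>FQ_append\<close> asks for.
  The nontrivial inclusion combines the pigeonhole argument with \<open>down_one_block\<close> for
  the small indices.\<close>

lemma closure_tail:
  "tail_closure =
   {\<rho> \<in> Pt {1..length rest + k}. restrict_part {1..length rest} \<rho> \<in>
      down (length rest) (one_block (length rest) I) (S_vec rest)}" (is "?\<Gamma> = ?R")
proof (intro set_eqI iffI)
  fix \<rho> assume \<rho>: "\<rho> \<in> ?\<Gamma>"
  then have "\<rho> \<in> Pt {1..length rest + k}"
    by (simp add: down_def)
  then show "\<rho> \<in> ?R"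
    using closure_tail_block[OF \<rho>] restrict_in_down by blast
next
  fix \<rho> assume "\<rho> \<in> ?R"
  then show "\<rho> \<in> ?\<Gamma>"
    using down_add_singles[OF pos one_block_Pt[OF I_subset], of \<rho>] by simp
qed

text \<open>An unbalanced relation has a subset of weight \<open>M\<close> among the small indices
  of one sign. The block of that sign contains the subset, so the partition of the vector lies in
  the closure and the vector has been removed.\<close>

lemma closure_balanced:
  assumes "v \<in> S_vec (rest @ replicate k M)"
    and "vect_partition (length rest + k) v \<notin>
      tail_closure"
  shows "wt (rest @ replicate k M) (Plus v \<inter> {1..length rest}) = wt (rest @ replicate k M) (Minus v \<inter> {1..length rest})"
proof (rule ccontr)
  assume "\<not> ?thesis"
  with assms(1) obtain B J where BJ: "B \<in> {Plus v, Minus v}" "J \<subseteq> B \<inter> {1..length rest}" "wt rest J = M"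
    by (rule unbalanced)
  have v: "vect_partition (length rest + k) v \<in> Pt {1..length rest + k}"
    using assms(1) by (intro vect_partition_Pt) (simp add: S_vec_iff)
  have "J \<noteq> {}"
    using BJ(3) M_pos by auto
  then have "B \<in> vect_partition (length rest + k) v"
    using BJ(1,2) by (auto simp: vect_partition_def)
  from restrict_in_down[OF v this BJ(2,3)] v show False
    using assms(2) unfolding closure_tail by blast
qed

end

end

section \<open>Merging one block, and minimal sets of given weight\<close>

definition block_list :: "nat \<Rightarrow> nat set \<Rightarrow> nat set list" where
  "block_list n I = map (\<lambda>i. {i}) (sorted_list_of_set ({1..n} - I)) @ [I]"

lemma block_list_OPt:
  assumes "I \<subseteq> {1..n}" "I \<noteq> {}"
  shows "block_list n I \<in> OPt {1..n}" "set (block_list n I) = one_block n I"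
proof -
  show set: "set (block_list n I) = one_block n I"
    by (auto simp: block_list_def one_block_eq)
  have "distinct (block_list n I)"
    using assms(2) by (auto simp: block_list_def distinct_map)
  then show "block_list n I \<in> OPt {1..n}"
    using one_block_Pt[OF assms] by (simp add: OPt_def Pt_def set)
qed

lemma map_wt_block_list:
  "map (wt l) (block_list n I) = map (part l) (sorted_list_of_set ({1..n} - I)) @ [wt l I]"
  by (simp add: block_list_def)

lemma OPt_append_singles:
  fixes N k :: nat
  assumes \<pi>: "\<pi> \<in> OPt {1..N}"
  defines "\<pi>' \<equiv> \<pi> @ map (\<lambda>i. {i}) [N + 1..<N + k + 1]"
  shows "\<pi>' \<in> OPt {1..N + k}" "set \<pi>' = add_singles {N + 1..N + k} (set \<pi>)"
proof -
  have eq: "set [N + 1..<N + k + 1] = {N + 1..N + k}"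
    by auto
  show set: "set \<pi>' = add_singles {N + 1..N + k} (set \<pi>)"
    unfolding \<pi>'_def set_append set_map eq add_singles_def by simp
  have P: "set \<pi> \<in> Pt {1..N}" "distinct \<pi>"
    using \<pi> by (auto simp: OPt_def Pt_def)
  have "distinct \<pi>'"
    using P(2) Pt_block(1)[OF P(1)] by (fastforce simp: \<pi>'_def distinct_map)
  moreover have "add_singles {N + 1..N + k} (set \<pi>) \<in> Pt ({1..N} \<union> {N + 1..N + k})"
    by (rule add_singles_Pt[OF P(1)]) auto
  moreover have "{1..N} \<union> {N + 1..N + k} = {1..N + k}"
    by auto
  ultimately show "\<pi>' \<in> OPt {1..N + k}"
    by (simp add: OPt_def Pt_def set)
qed

lemma map_wt_append_singles:
  assumes "\<pi> \<in> OPt {1..length rest}"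
  shows "map (wt (rest @ zs)) (\<pi> @ map (\<lambda>i. {i}) [length rest + 1..<length rest + length zs + 1]) =
    map (wt rest) \<pi> @ zs"
proof -
  have "set \<pi> \<in> Pt {1..length rest}"
    using assms by (simp add: OPt_def Pt_def)
  then have "map (wt (rest @ zs)) \<pi> = map (wt rest) \<pi>"
    using Pt_block(1) wt_append(1) by (intro map_cong) auto
  moreover have "map (wt (rest @ zs)) (map (\<lambda>i. {i}) [length rest + 1..<length rest + length zs + 1]) = zs"
    by (rule nth_equalityI) (auto simp: part_def nth_append simp del: upt_Suc)
  ultimately show ?thesis
    by simp
qed

lemma mset_map_part:
  "finite V \<Longrightarrow> mset (map (part l) (sorted_list_of_set V)) = parts_of l V"
  unfolding parts_of_def by (metis mset_map mset_set_set sorted_list_of_set.distinct_sorted_key_list_of_set sorted_list_of_set.set_sorted_key_list_of_set)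

lemma sorted_map_part:
  assumes "sorted l" "V \<subseteq> {1..length l}"
  shows "sorted (map (part l) (sorted_list_of_set V))"
  unfolding sorted_map
proof (rule sorted_wrt_mono_rel[of _ "(\<le>)"])
  have "finite V"
    using assms(2) finite_subset by blast
  then show "part l i \<le> part l j"
    if "i \<in> set (sorted_list_of_set V)" "j \<in> set (sorted_list_of_set V)" "i \<le> j" for i j
    using that assms(2) by (intro part_mono[OF assms(1)]) auto
qed simp

lemma mset_minus_parts_of:
  assumes "I \<subseteq> {1..length l}"
  shows "mset l - parts_of l I = parts_of l ({1..length l} - I)"
proof -
  have "mset l = parts_of l (({1..length l} - I) \<union> I)"
    using assms by (simp add: mset_eq_parts_of Un_absorb2)
  also have "\<dots> = parts_of l ({1..length l} - I) + parts_of l I"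
    using assms finite_subset by (intro parts_of_union) auto
  finally show ?thesis
    by simp
qed

text \<open>A set of least cardinality works: if two or more of its elements had the weight of an
  outside index, exchanging them for this index would give a smaller set of the same weight.\<close>

lemma exists_unmergeable:
  assumes "J \<subseteq> {1..length l}" "wt l J = c"
  obtains I where "unmergeable l I" "wt l I = c"
proof -
  define P where "P I \<longleftrightarrow> I \<subseteq> {1..length l} \<and> wt l I = c" for I
  have PJ: "P J"
    using assms by (simp add: P_def)
  obtain I where I: "P I" "\<And>I'. P I' \<Longrightarrow> card I \<le> card I'"
    using ex_has_least_nat[of P J card] PJ by blast
  have fin: "finite I"
    using I(1) finite_subset by (auto simp: P_def)
  have "unmergeable l I"
    unfolding unmergeable_def
  proof (intro conjI ballI allI impI)
    show "I \<subseteq> {1..length l}"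
      using I(1) by (simp add: P_def)
  next
    fix q X assume q: "q \<in> {1..length l} - I" and X: "X \<subseteq> I" "wt l X = part l q"
    show "card X \<le> 1"
    proof (rule ccontr)
      assume "\<not> card X \<le> 1"
      have finX: "finite X"
        using X(1) fin finite_subset by blast
      have "wt l ((I - X) \<union> {q}) = wt l (I - X) + wt l {q}"
        using q fin by (intro wt_Un) auto
      then have "wt l (insert q (I - X)) = c"
        using X I(1) wt_Diff[OF fin X(1), of l] wt_mono[OF fin X(1), of l] by (simp add: P_def)
      then have "P (insert q (I - X))"
        using q I(1) by (auto simp: P_def)
      moreover have "card (insert q (I - X)) < card I"
        using q fin finX X(1) \<open>\<not> card X \<le> 1\<close> card_mono[OF fin X(1)] by (simp add: card_Diff_subset)
      ultimately show False
        using I(2) by (simp add: leD)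
    qed
  qed
  then show ?thesis
    using that I(1) by (simp add: P_def)
qed

lemma card_ge_2:
  assumes "I \<subseteq> {1..length l}" "wt l I = c" "\<And>x. x \<in> set l \<Longrightarrow> x < c" "c > 0"
  shows "card I \<ge> 2"
proof (rule ccontr)
  assume "\<not> ?thesis"
  moreover have "finite I"
    using assms(1) finite_subset by blast
  ultimately consider "I = {}" | i where "I = {i}"
    by (metis One_nat_def card_0_eq card_1_singletonE less_2_cases_iff not_le)
  then show False
  proof cases
    case (2 i)
    then show ?thesis
      using assms part_head[of i l "[]"] by fastforce
  qed (use assms in simp)
qed

lemma S_vec_replicate: "M > 0 \<Longrightarrow> cut_of (replicate k M) = cut_of (replicate k 1)"
proof -
  assume M: "M > 0"
  have "(\<Sum>i=1..k. x i * int (part (replicate k M) i)) = int M * (\<Sum>i=1..k. x i * int (part (replicate k 1) i))"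
    for x :: vect
    unfolding sum_distrib_left by (rule sum.cong) (auto simp: part_def)
  then show ?thesis
    using M by (simp add: cut_of_def S_vec_def)
qed

text \<open>The counterpart of \<open>closure_tail\<close> for an arbitrary partition
  \<open>\<nu>\<close>: \<open>W\<close> outweighs all other parts together, so a block map must
  send the new singleton to the block of the new index, and what remains is a block map on the old
  indices.\<close>

lemma closure_big:
  assumes pos: "positive (rest @ [W])" and W: "wt rest {1..length rest} < W" and \<nu>: "\<nu> \<in> Pt {1..length rest}"
  defines "N \<equiv> length rest"
  shows "down (N + 1) (add_singles {N + 1..N + 1} \<nu>) (S_vec (rest @ [W])) =
    {\<rho> \<in> Pt {1..N + 1}. restrict_part {1..N} \<rho> \<in> down N \<nu> (S_vec rest)}" (is "?\<Gamma> = ?R")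
proof (intro set_eqI iffI)
  let ?l = "rest @ [W]"
  have len: "length ?l = N + 1" "{1..N} \<union> {N + 1..N + 1} = {1..N + 1}"
    by (auto simp: N_def)
  fix \<rho> assume \<rho>: "\<rho> \<in> ?\<Gamma>"
  have "add_singles {N + 1..N + 1} \<nu> \<in> Pt ({1..N} \<union> {N + 1..N + 1})"
    by (rule add_singles_Pt) (use \<nu> in \<open>auto simp: N_def\<close>)
  then have \<pi>: "add_singles {N + 1..N + 1} \<nu> \<in> Pt {1..length ?l}"
    by (simp only: len)
  have \<rho>P: "\<rho> \<in> Pt {1..N + 1}"
    using \<rho> by (simp add: down_def)
  obtain f where "block_map (wt ?l) (add_singles {N + 1..N + 1} \<nu>) \<rho> f"
    using down_imp_block_map[OF \<pi>, of \<rho>] \<rho> unfolding len(1) by blast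
  then have f: "f ` add_singles {N + 1..N + 1} \<nu> \<subseteq> \<rho>"
    "\<And>E. E \<in> \<rho> \<Longrightarrow> wt ?l E = (\<Sum>B\<in>{B\<in>add_singles {N + 1..N + 1} \<nu>. f B = E}. wt ?l B)"
    by (auto simp: block_map_def)
  have fin: "finite \<nu>" "finite (add_singles {N + 1..N + 1} \<nu>)"
    using Pt_finite[OF \<nu>] by (auto simp: add_singles_def)
  have not\<nu>: "{N + 1} \<notin> \<nu>"
    using Pt_block(1)[OF \<nu>, of "{N + 1}"] by (auto simp: N_def)
  have wN: "wt ?l {N + 1} = W"
    by (simp add: part_def N_def)
  have Esplit: "wt ?l E = wt rest (E \<inter> {1..N}) + (if N + 1 \<in> E then W else 0)" if "E \<in> \<rho>" for E
  proof -
    have E: "E \<subseteq> {1..N + 1}"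
      using Pt_block(1)[OF \<rho>P that] .
    have "wt ?l ((E \<inter> {1..N}) \<union> (E \<inter> {N + 1})) = wt ?l (E \<inter> {1..N}) + wt ?l (E \<inter> {N + 1})"
      by (intro wt_Un) auto
    moreover have "(E \<inter> {1..N}) \<union> (E \<inter> {N + 1}) = E"
      using E by auto
    ultimately show ?thesis
      using wN by (simp add: N_def wt_append)
  qed
  \<comment> \<open>A block without the index \<open>N + 1\<close> is too light to receive the
    singleton of weight \<open>W\<close>.\<close>
  have fn: "N + 1 \<in> f {N + 1}"
  proof (rule ccontr)
    assume n: "N + 1 \<notin> f {N + 1}"
    have E: "f {N + 1} \<in> \<rho>"
      using f(1) by (auto simp: add_singles_def)
    have "wt ?l {N + 1} \<le> wt ?l (f {N + 1})"
      unfolding f(2)[OF E] using fin by (intro member_le_sum) (auto simp: add_singles_def)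
    moreover have "wt ?l (f {N + 1}) \<le> wt rest {1..N}"
      using Esplit[OF E] n wt_mono[of "{1..N}" "f {N + 1} \<inter> {1..N}" rest] by simp
    ultimately show False
      using W wN by (simp add: N_def)
  qed
  have w\<nu>: "wt ?l B = wt rest B" if "B \<in> \<nu>" for B
    using Pt_block(1)[OF \<nu> that] by (simp add: wt_append)
  have key: "wt rest (E \<inter> {1..N}) = (\<Sum>B\<in>{B\<in>\<nu>. f B = E}. wt rest B)" if E: "E \<in> \<rho>" for E
  proof -
    have "{B\<in>add_singles {N + 1..N + 1} \<nu>. f B = E} = {B\<in>\<nu>. f B = E} \<union> (if f {N + 1} = E then {{N + 1}} else {})"
      by (auto simp: add_singles_def)
    then have "wt ?l E = (\<Sum>B\<in>{B\<in>\<nu>. f B = E}. wt ?l B) + (\<Sum>B\<in>(if f {N + 1} = E then {{N + 1}} else {}). wt ?l B)"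
      unfolding f(2)[OF E] using fin not\<nu> by (simp add: sum.union_disjoint)
    also have "(\<Sum>B\<in>{B\<in>\<nu>. f B = E}. wt ?l B) = (\<Sum>B\<in>{B\<in>\<nu>. f B = E}. wt rest B)"
      using w\<nu> by (intro sum.cong) auto
    also have "(\<Sum>B\<in>(if f {N + 1} = E then {{N + 1}} else {}). wt ?l B) = (if N + 1 \<in> E then W else 0)"
    proof -
      have "f {N + 1} \<in> \<rho>"
        using f(1) by (auto simp: add_singles_def)
      then have "f {N + 1} = E \<longleftrightarrow> N + 1 \<in> E"
        using Pt_disjoint[OF \<rho>P _ E] fn by blast
      then show ?thesis
        using wN by simp
    qed
    finally show ?thesis
      using Esplit[OF E] by simp
  qed
  define g where "g B = f B \<inter> {1..N}" for B
  have gne: "g B \<noteq> {}" "f B \<in> \<rho>" if B: "B \<in> \<nu>" for B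
  proof -
    show fB: "f B \<in> \<rho>"
      using f(1) B by (auto simp: add_singles_def)
    have "wt rest B \<le> wt rest (g B)"
      unfolding g_def key[OF fB] using fin B by (intro member_le_sum) auto
    moreover have "wt rest B \<noteq> 0"
      using Pt_block[OF \<nu> B] wt_eq_0[of rest B] pos by (auto simp: positive_def)
    ultimately show "g B \<noteq> {}"
      by auto
  qed
  have "block_map (wt rest) \<nu> (restrict_part {1..N} \<rho>) g"
    unfolding block_map_def
  proof (intro conjI ballI)
    show "g ` \<nu> \<subseteq> restrict_part {1..N} \<rho>"
      using gne by (auto simp: restrict_part_def g_def)
  next
    fix E' assume "E' \<in> restrict_part {1..N} \<rho>"
    then obtain E where E: "E \<in> \<rho>" "E' = E \<inter> {1..N}" "E' \<noteq> {}"
      by (auto simp: restrict_part_def)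
    have "g B = E' \<longleftrightarrow> f B = E" if "B \<in> \<nu>" for B
      using gne[OF that] E Pt_disjoint[OF \<rho>P gne(2)[OF that] E(1)] unfolding g_def by blast
    then have "{B\<in>\<nu>. g B = E'} = {B\<in>\<nu>. f B = E}"
      by blast
    then show "wt rest E' = (\<Sum>B\<in>{B\<in>\<nu>. g B = E'}. wt rest B)"
      using key[OF E(1)] E(2) by simp
  qed
  moreover have "positive rest"
    using pos by (auto simp: positive_def)
  moreover have "restrict_part {1..N} \<rho> \<in> Pt {1..N}"
    by (rule restrict_part_Pt[OF \<rho>P]) auto
  ultimately have "restrict_part {1..N} \<rho> \<in> down N \<nu> (S_vec rest)"
    unfolding N_def using block_map_imp_down[of rest \<nu>] \<nu> by blast
  then show "\<rho> \<in> ?R"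
    using \<rho>P by simp
next
  fix \<rho> assume "\<rho> \<in> ?R"
  then show "\<rho> \<in> ?\<Gamma>"
    using down_add_singles[OF pos \<nu>, of \<rho>] by (simp add: N_def)
qed

text \<open>If \<open>W\<close> stood on one side of a relation, all other parts together could not
  balance it.\<close>

lemma balanced_big:
  assumes "positive (rest @ [W])" "wt rest {1..length rest} < W" "v \<in> S_vec (rest @ [W])"
  shows "wt (rest @ [W]) (Plus v \<inter> {1..length rest}) = wt (rest @ [W]) (Minus v \<inter> {1..length rest})"
proof -
  let ?l = "rest @ [W]" and ?N = "length rest"
  have v: "v \<in> tern (?N + 1)" "wt ?l (Plus v) = wt ?l (Minus v)"
    using assms(3) by (simp_all add: S_vec_iff)
  have n: "?N + 1 \<notin> A" if AB: "A \<subseteq> {1..?N + 1}" "B \<subseteq> {1..?N + 1}" "A \<inter> B = {}" "wt ?l A = wt ?l B" for A B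
  proof
    assume A: "?N + 1 \<in> A"
    have B: "B \<subseteq> {1..?N}"
    proof
      fix x assume "x \<in> B"
      then have "x \<in> {1..?N + 1}" "x \<noteq> ?N + 1"
        using A AB(2,3) by auto
      then show "x \<in> {1..?N}"
        by auto
    qed
    have "wt ?l {?N + 1} \<le> wt ?l A"
      using A AB(1) finite_subset by (intro wt_mono) auto
    moreover have "wt ?l B \<le> wt rest {1..?N}"
      using B wt_mono[of "{1..?N}" B rest] by (simp add: wt_append)
    ultimately show False
      using AB(4) assms(2) by (simp add: part_def)
  qed
  note t = tern_support[OF v(1)] and d = Plus_Minus_disjoint[of v]
  have "?N + 1 \<notin> Plus v" "?N + 1 \<notin> Minus v"
    using n[OF t d v(2)] n[OF t(2,1) _ v(2)[symmetric]] d by blast+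
  then have "Plus v \<inter> {1..?N} = Plus v" "Minus v \<inter> {1..?N} = Minus v"
    using t by (auto simp: subset_iff le_Suc_eq)
  then show ?thesis
    using v(2) by simp
qed

text \<open>Every block of \<open>\<pi>\<close> is the union of the blocks of \<open>\<tau>\<close>
  inside it, and \<open>\<sigma>\<close> lists their positions. This factors a merge through a finer
  one.\<close>

lemma OPt_factor:
  assumes \<tau>: "\<tau> \<in> OPt {1..n}" and \<pi>: "\<pi> \<in> OPt {1..n}" and ref: "\<forall>C\<in>set \<tau>. \<exists>B\<in>set \<pi>. C \<subseteq> B"
  defines "\<sigma> \<equiv> map (\<lambda>B. {j \<in> {1..length \<tau>}. \<tau> ! (j - 1) \<subseteq> B}) \<pi>"
  shows "\<sigma> \<in> OPt {1..length \<tau>}" "op_comp \<sigma> \<tau> = \<pi>"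
    "\<And>B. B \<in> set \<pi> \<Longrightarrow> (\<Union>j\<in>{j \<in> {1..length \<tau>}. \<tau> ! (j - 1) \<subseteq> B}. \<tau> ! (j - 1)) = B"
proof -
  define ix where "ix B = {j \<in> {1..length \<tau>}. \<tau> ! (j - 1) \<subseteq> B}" for B
  have P: "set \<tau> \<in> Pt {1..n}" "set \<pi> \<in> Pt {1..n}" and dist: "distinct \<pi>"
    using \<tau> \<pi> by (auto simp: OPt_def Pt_def)
  have in\<tau>: "\<tau> ! (j - 1) \<in> set \<tau>" if "j \<in> {1..length \<tau>}" for j
    using that by auto
  have U: "(\<Union>j\<in>ix B. \<tau> ! (j - 1)) = B" if B: "B \<in> set \<pi>" for B
  proof (intro set_eqI iffI)
    fix x assume x: "x \<in> B"
    then have "x \<in> \<Union>(set \<tau>)"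
      unfolding Pt_Union[OF P(1)] using Pt_block(1)[OF P(2) B] by blast
    then obtain j where j: "j < length \<tau>" "x \<in> \<tau> ! j"
      by (auto simp: in_set_conv_nth)
    then obtain B' where "B' \<in> set \<pi>" "\<tau> ! j \<subseteq> B'"
      using ref by (metis nth_mem)
    then have "\<tau> ! j \<subseteq> B"
      using Pt_disjoint[OF P(2) B, of B'] x j(2) by blast
    then show "x \<in> (\<Union>j\<in>ix B. \<tau> ! (j - 1))"
      using j by (intro UN_I[of "Suc j"]) (auto simp: ix_def)
  qed (auto simp: ix_def)
  then show "\<And>B. B \<in> set \<pi> \<Longrightarrow> (\<Union>j\<in>{j \<in> {1..length \<tau>}. \<tau> ! (j - 1) \<subseteq> B}. \<tau> ! (j - 1)) = B"
    by (simp only: ix_def)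
  have \<sigma>: "\<sigma> = map ix \<pi>"
    by (simp add: \<sigma>_def ix_def)
  show "op_comp \<sigma> \<tau> = \<pi>"
    using U by (simp add: op_comp_def \<sigma> o_def map_idI)
  have inj: "inj_on ix (set \<pi>)"
    using U by (metis inj_onI)
  have ne: "ix B \<noteq> {}" if "B \<in> set \<pi>" for B
    using U[OF that] Pt_block(2)[OF P(2) that] by auto
  have un: "\<Union>(ix ` set \<pi>) = {1..length \<tau>}"
  proof
    show "{1..length \<tau>} \<subseteq> \<Union>(ix ` set \<pi>)"
    proof
      fix j assume j: "j \<in> {1..length \<tau>}"
      then obtain B where "B \<in> set \<pi>" "\<tau> ! (j - 1) \<subseteq> B"
        using ref in\<tau>[OF j] by blast
      then show "j \<in> \<Union>(ix ` set \<pi>)"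
        using j by (auto simp: ix_def)
    qed
  qed (auto simp: ix_def)
  have dj: "ix B \<inter> ix B' = {}" if "B \<in> set \<pi>" "B' \<in> set \<pi>" "B \<noteq> B'" for B B'
  proof (rule ccontr)
    assume "ix B \<inter> ix B' \<noteq> {}"
    then obtain j where "j \<in> {1..length \<tau>}" "\<tau> ! (j - 1) \<subseteq> B \<inter> B'"
      by (auto simp: ix_def)
    then show False
      using Pt_block(2)[OF P(1) in\<tau>] Pt_disjoint[OF P(2) that] by auto
  qed
  have "partition_on {1..length \<tau>} (ix ` set \<pi>)"
    unfolding partition_on_def disjoint_def
  proof (intro conjI un ballI impI notI)
    fix a b assume "a \<in> ix ` set \<pi>" "b \<in> ix ` set \<pi>" "a \<noteq> b"
    then show "a \<inter> b = {}"
      using dj by blast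
  next
    assume "{} \<in> ix ` set \<pi>"
    then show False
      using ne by (metis imageE)
  qed
  then show "\<sigma> \<in> OPt {1..length \<tau>}"
    using dist inj by (simp add: OPt_def \<sigma> distinct_map)
qed

lemma part_in_set: "i \<in> {1..length l} \<Longrightarrow> part l i \<in> set l"
  using part_head[of i l "[]"] by simp

text \<open>No part exceeds \<open>c\<close>, so the condition of \<open>seqm_merge\<close> on
  larger parts holds vacuously, and the copies of \<open>c\<close> behind \<open>rest\<close> supply
  the second occurrence of the sum.\<close>

lemma seqm_merged:
  assumes seq: "seqm (mset (rest @ replicate k c))" and pos: "positive (rest @ replicate k c)"
    and less: "\<And>x. x \<in> set rest \<Longrightarrow> x < c" and k: "k \<ge> 1"
    and I: "I \<subseteq> {1..length rest}" "wt rest I = c"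
  shows "seqm (mset (map (part rest) (sorted_list_of_set ({1..length rest} - I)) @ replicate (Suc k) c))"
proof -
  let ?L = "mset (rest @ replicate k c)"
  have sub: "parts_of rest I \<subseteq># mset rest"
    using I(1) by (simp add: mset_eq_parts_of parts_of_mono)
  then have eq: "?L - parts_of rest I = parts_of rest ({1..length rest} - I) + replicate_mset k c"
    using mset_minus_parts_of[OF I(1)] by (simp add: subset_mset.diff_add_assoc2 add.commute)
  have "seqm (add_mset (\<Sum>\<^sub># (parts_of rest I)) (?L - parts_of rest I))"
  proof (rule seqm_merge[OF seq])
    show "parts_of rest I \<subseteq># ?L"
      using sub by (simp add: subset_mset.add_increasing2)
    show "\<Sum>\<^sub># (parts_of rest I) \<in># ?L - parts_of rest I"
      unfolding eq sum_parts_of I(2) using k by simp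
    have "p \<le> c" if "p \<in># ?L" for p
      using that less by (auto intro: less_imp_le split: if_splits)
    then show "i \<notin># B" if "p \<in># ?L" "\<Sum>\<^sub># (parts_of rest I) < p" for p B i
      using that by (metis I(2) leD sum_parts_of)
  qed
  from this[unfolded eq sum_parts_of I(2)] show ?thesis
    unfolding mset_append mset_map_part[OF finite_Diff[OF finite_atLeastAtMost]] by simp
qed

lemma sorted_decompose:
  assumes "sorted (l :: nat list)" "l \<noteq> []"
  obtains rest k where "l = rest @ replicate k (last l)" "k \<ge> 1" "\<And>x. x \<in> set rest \<Longrightarrow> x < last l"
proof -
  define rest where "rest = takeWhile (\<lambda>x. x < last l) l"
  define ys where "ys = dropWhile (\<lambda>x. x < last l) l"
  have l: "l = rest @ ys"
    by (simp add: rest_def ys_def)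
  have "y = last l" if "y \<in> set ys" for y
  proof -
    have "y \<in> set l"
      using that l by simp
    then obtain i where "i < length l" "y = l ! i"
      by (auto simp: in_set_conv_nth)
    then have "y \<le> last l"
      using assms by (auto simp: last_conv_nth intro!: sorted_nth_mono)
    moreover have ys: "sorted ys" "ys \<noteq> []"
      using assms(1) that sorted_append[of rest ys] l by auto
    then have "hd ys \<le> y"
      using that by (cases ys) auto
    moreover have "\<not> hd ys < last l"
      using hd_dropWhile[of "\<lambda>x. x < last l" l] ys(2) by (simp add: ys_def)
    ultimately show ?thesis
      by simp
  qed
  then have ys: "ys = replicate (length ys) (last l)"
    by (simp add: replicate_length_same)
  show ?thesis
  proof (rule that[of rest "length ys"])
    show "l = rest @ replicate (length ys) (last l)"
      using trans[OF l arg_cong[OF ys, of "(@) rest"]] .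
    show "1 \<le> length ys"
    proof (rule ccontr)
      assume "\<not> ?thesis"
      then have "rest = l"
        using l[symmetric] by (cases ys) simp_all
      then have "last l \<in> set rest"
        using last_in_set[OF assms(2)] by simp
      from set_takeWhileD[OF this[unfolded rest_def]] show False
        by simp
    qed
  qed (auto simp: rest_def dest: set_takeWhileD)
qed

section \<open>Product decompositions and contractibility\<close>

context
  fixes F :: "cut \<Rightarrow> 'a pspace" and M :: "cut \<Rightarrow> cut \<Rightarrow> nat set list \<Rightarrow> 'a \<Rightarrow> 'a"
  assumes rf: "resonance_functor F M"
    and ones: "\<And>k. k \<ge> 2 \<Longrightarrow> pcontractible (F (cut_of (replicate k 1)))"
begin

abbreviation F_collapsed :: "nat list \<Rightarrow> nat set \<Rightarrow> 'a pspace" where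
  "F_collapsed rest I \<equiv>
    FQ F M (length rest) (S_vec rest) (down (length rest) (one_block (length rest) I) (S_vec rest))"

text \<open>Because \<open>\<tau>\<close> refines \<open>\<pi>\<close>, the inclusion along
  \<open>\<pi>\<close> factors by functoriality through the space merged along
  \<open>\<tau>\<close>, which is contractible.\<close>

lemma pnull_incl:
  assumes ne: "l \<noteq> []" and l: "positive l" and \<tau>: "\<tau> \<in> OPt {1..length l}" and \<pi>: "\<pi> \<in> OPt {1..length l}"
    and ref: "\<forall>C\<in>set \<tau>. \<exists>B\<in>set \<pi>. C \<subseteq> B"
    and con: "pcontractible (F (cut_of (map (wt l) \<tau>)))"
  shows "pnull (F (merge_cut \<pi> (S_vec l))) (F (length l, S_vec l)) (incl M (length l) (S_vec l) \<pi>)"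
proof -
  define \<sigma> where "\<sigma> = map (\<lambda>B. {j \<in> {1..length \<tau>}. \<tau> ! (j - 1) \<subseteq> B}) \<pi>"
  note \<sigma> = OPt_factor[OF \<tau> \<pi> ref, folded \<sigma>_def]
  have ne': "\<pi> \<noteq> []" "\<tau> \<noteq> []"
    using \<pi> \<tau> ne by (auto simp: OPt_def partition_on_def Suc_le_eq)
  note pos = positive_map_wt[OF l \<tau>] positive_map_wt[OF l \<pi>]
  let ?A = "cut_of (map (wt l) \<pi>)" and ?B = "cut_of (map (wt l) \<tau>)" and ?C = "(length l, S_vec l)"
  have cuts: "S_vec l \<in> cuts (length l)" "S_vec (map (wt l) \<tau>) \<in> cuts (length \<tau>)" "S_vec (map (wt l) \<pi>) \<in> cuts (length \<pi>)"
    using S_vec_in_cuts[OF l] S_vec_in_cuts[OF pos(1)] S_vec_in_cuts[OF pos(2)] by simp_all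
  have len: "1 \<le> length l" "1 \<le> length \<tau>" "1 \<le> length \<pi>"
    using ne ne' by (auto simp: Suc_le_eq)
  have mBC: "morph ?B ?C \<tau>"
    using cuts len \<tau> by (simp add: morph_def cut_of_def merge_S_vec[OF \<tau>])
  \<comment> \<open>Merging in two stages gives the same list of weights, so the source of the first
    morphism is literally the cut merged along \<open>\<pi>\<close>.\<close>
  have "map (wt (map (wt l) \<tau>)) \<sigma> = map (wt l) \<pi>"
  proof -
    have "wt (map (wt l) \<tau>) {j \<in> {1..length \<tau>}. \<tau> ! (j - 1) \<subseteq> B} = wt l B" if "B \<in> set \<pi>" for B
    proof -
      have "{j \<in> {1..length \<tau>}. \<tau> ! (j - 1) \<subseteq> B} \<subseteq> {1..length \<tau>}"
        by blast
      from wt_op_blocks[OF \<tau> this] \<sigma>(3)[OF that] show ?thesis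
        by simp
    qed
    then show ?thesis
      by (simp add: \<sigma>_def)
  qed
  moreover have "\<sigma> \<in> OPt {1..length (map (wt l) \<tau>)}"
    using \<sigma>(1) by simp
  ultimately have "merge \<sigma> (S_vec (map (wt l) \<tau>)) = S_vec (map (wt l) \<pi>)"
    using merge_S_vec by metis
  then have mAB: "morph ?A ?B \<sigma>"
    using cuts len \<sigma>(1) by (simp add: morph_def cut_of_def) (simp add: \<sigma>_def)
  have pf: "pfunctor F M"
    using rf by (simp add: resonance_functor_def)
  then have maps: "pmap (F ?A) (F ?B) (M ?A ?B \<sigma>)" "pmap (F ?B) (F ?C) (M ?B ?C \<tau>)"
    using mAB mBC unfolding pfunctor_def by blast+
  have comp: "M ?A ?C \<pi> x = M ?B ?C \<tau> (M ?A ?B \<sigma> x)" if "x \<in> topspace (fst (F ?A))" for x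
    using pf mAB mBC that \<sigma>(2) unfolding pfunctor_def by metis
  have "pspace (F ?A)"
    using ne' pos(2) by (intro pspace_cut_of[OF rf]) auto
  then show ?thesis
    unfolding incl_def merge_cut_S_vec[OF \<pi>]
    by (rule pnull_factor[OF con maps]) (simp add: comp)
qed

text \<open>The closure quotient is evaluated in two ways: as \<open>F\<close> of the whole list,
  because the collapsed subspace belongs to the list with \<open>Suc k\<close> copies of
  \<open>c\<close> and is contractible by \<open>con\<close>; and as a smash product, because its
  family of partitions has product form.\<close>

lemma FQ_append_replicate:
  assumes seq: "seqm (mset (rest @ replicate k c))" and pos: "positive (rest @ replicate k c)"
    and less: "\<And>x. x \<in> set rest \<Longrightarrow> x < c" and k: "k \<ge> 1"
    and I: "unmergeable rest I" "wt rest I = c"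
    and con: "pcontractible (F (cut_of (map (part rest) (sorted_list_of_set ({1..length rest} - I)) @ replicate (Suc k) c)))"
  shows "F (cut_of (rest @ replicate k c)) \<simeq>\<^sub>*
    smash (F_collapsed rest I) (F (cut_of (replicate k 1)))"
proof -
  let ?N = "length rest" and ?l = "rest @ replicate k c"
  note sub = I_subset[OF seq pos less k I]
  have c: "c > 0"
    by (rule M_pos[OF seq pos less k])
  have ne: "rest \<noteq> []" "replicate k c \<noteq> []"
    using sub k by auto
  \<comment> \<open>\<open>block_list\<close> puts \<open>I\<close> last, so the merged part
    \<open>c\<close> comes directly before the old copies, and the block weights have the shape
    required in \<open>con\<close>.\<close>
  define \<nu> where "\<nu> = block_list ?N I"
  define \<pi> where "\<pi> = \<nu> @ map (\<lambda>i. {i}) [?N + 1..<?N + k + 1]"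
  have \<nu>: "\<nu> \<in> OPt {1..?N}" "set \<nu> = one_block ?N I"
    using block_list_OPt[OF sub] by (simp_all add: \<nu>_def)
  have \<pi>: "\<pi> \<in> OPt {1..?N + k}" "set \<pi> = add_singles {?N + 1..?N + k} (one_block ?N I)"
    using OPt_append_singles[OF \<nu>(1), of k] \<nu>(2) by (simp_all add: \<pi>_def)
  have "map (wt ?l) \<pi> = map (wt rest) \<nu> @ replicate k c"
    using map_wt_append_singles[OF \<nu>(1), of "replicate k c"] by (simp add: \<pi>_def)
  also have "\<dots> = map (part rest) (sorted_list_of_set ({1..?N} - I)) @ replicate (Suc k) c"
    by (simp add: \<nu>_def map_wt_block_list I(2))
  finally have mc: "merge_cut \<pi> (S_vec ?l) = cut_of (map (part rest) (sorted_list_of_set ({1..?N} - I)) @ replicate (Suc k) c)"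
    using merge_cut_S_vec[of \<pi> ?l] \<pi>(1) by simp
  have cut: "S_vec ?l \<in> cuts (?N + k)"
    using S_vec_in_cuts[OF pos] by simp
  have "positive (map (wt ?l) \<pi>)"
    using positive_map_wt[OF pos, of \<pi>] \<pi>(1) by simp
  then have "pspace (F (merge_cut \<pi> (S_vec ?l)))"
    using merge_cut_S_vec[of \<pi> ?l] \<pi>(1) by (auto intro!: pspace_cut_of[OF rf] simp: \<pi>_def \<nu>_def block_list_def)
  then have 1: "FQ F M (?N + k) (S_vec ?l) (down (?N + k) (set \<pi>) (S_vec ?l)) \<simeq>\<^sub>* F (?N + k, S_vec ?l)"
    using k con by (intro FQ_down_contractible[OF rf _ cut \<pi>(1)]) (simp_all add: mc)
  have 2: "FQ F M (?N + k) (S_vec ?l) (down (?N + k) (set \<pi>) (S_vec ?l)) \<simeq>\<^sub>*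
    smash (FQ F M ?N (S_vec rest) (down ?N (one_block ?N I) (S_vec rest))) (F (cut_of (replicate k c)))"
    using FQ_append[OF rf ne pos, of "down ?N (one_block ?N I) (S_vec rest)" "down (?N + k) (set \<pi>) (S_vec ?l)"]
      closure_tail[OF seq pos less k I] closure_balanced[OF seq pos less k I]
    by (simp add: closed_parts_down \<pi>(2))
  show ?thesis
    using pequiv_trans[OF pequiv_sym[OF 1] 2] by (simp add: cut_of_def[of "rest @ _"] S_vec_replicate[OF c])
qed

text \<open>An unbalanced relation would produce a set of small parts of weight \<open>c\<close>;
  without such sets all relations split.\<close>

lemma F_append_replicate:
  assumes "seqm (mset (rest @ replicate k c))" "positive (rest @ replicate k c)"
    and "\<And>x. x \<in> set rest \<Longrightarrow> x < c" and "k \<ge> 1" and "rest \<noteq> []"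
    and no: "\<And>J. J \<subseteq> {1..length rest} \<Longrightarrow> wt rest J \<noteq> c"
  shows "F (cut_of (rest @ replicate k c)) \<simeq>\<^sub>* smash (F (cut_of rest)) (F (cut_of (replicate k 1)))"
proof -
  have "F (cut_of (rest @ replicate k c)) \<simeq>\<^sub>* smash (F (cut_of rest)) (F (cut_of (replicate k c)))"
  proof (rule F_append[OF rf assms(5) _ assms(2)])
    show "replicate k c \<noteq> []"
      using assms(4) by auto
    show "wt (rest @ replicate k c) (Plus v \<inter> {1..length rest}) = wt (rest @ replicate k c) (Minus v \<inter> {1..length rest})"
      if "v \<in> S_vec (rest @ replicate k c)" for v
    proof (rule ccontr)
      assume "\<not> ?thesis"
      from unbalanced[OF assms(1-4) that this] no show False
        by (metis Int_lower2 subset_trans)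
    qed
  qed
  then show ?thesis
    using S_vec_replicate[OF M_pos[OF assms(1-4)]] by simp
qed

text \<open>Induction on the number of parts below \<open>c\<close>. If some of them sum to
  \<open>c\<close>, merging an unmergeable such set leaves fewer small parts and one more copy of
  \<open>c\<close>; otherwise the small parts split off directly. Either way
  \<open>F (cut_of (replicate k 1))\<close> is a smash factor, contractible since
  \<open>k \<ge> 2\<close>.\<close>

lemma contractible_mm:
  assumes "seqm (mset (rest @ replicate k c))" "positive (rest @ replicate k c)"
    and "\<And>x. x \<in> set rest \<Longrightarrow> x < c" and "k \<ge> 2"
  shows "pcontractible (F (cut_of (rest @ replicate k c)))"
  using assms
proof (induction "length rest" arbitrary: rest k rule: less_induct)
  case less
  have k: "k \<ge> 1"
    using less.prems(4) by simp
  note prems = less.prems(1-3) k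
  have c: "c > 0"
    by (rule M_pos[OF prems])
  have con1: "pcontractible (F (cut_of (replicate k 1)))" and ps1: "pspace (F (cut_of (replicate k 1)))"
    using ones[OF less.prems(4)] k by (auto intro!: pspace_cut_of[OF rf] simp: positive_def)
  have posr: "positive rest"
    by (rule pos_rest[OF prems])
  show ?case
  proof (cases "rest = []")
    case True
    then show ?thesis
      using con1 S_vec_replicate[OF c] by simp
  next
    case ne: False
    show ?thesis
    proof (cases "\<exists>J\<subseteq>{1..length rest}. wt rest J = c")
      case True
      then obtain I where I: "unmergeable rest I" "wt rest I = c"
        using exists_unmergeable[of _ rest c] by metis
      have IV: "I \<subseteq> {1..length rest}"
        using I(1) by (simp add: unmergeable_def)
      let ?rest = "map (part rest) (sorted_list_of_set ({1..length rest} - I))"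
      have "finite I"
        using IV finite_subset by blast
      then have "length ?rest < length rest"
        using IV card_ge_2[OF IV I(2) less.prems(3) c] card_mono[OF _ IV] by (simp add: card_Diff_subset)
      moreover have "x \<in> set rest" if "x \<in> set ?rest" for x
        using that part_in_set[of _ rest] by auto
      ultimately have "pcontractible (F (cut_of (?rest @ replicate (Suc k) c)))"
        using less.prems(2,3,4) seqm_merged[OF prems IV I(2)]
        by (intro less.hyps) (auto simp: positive_def simp del: replicate_Suc)
      from FQ_append_replicate[OF prems I this]
      have "F (cut_of (rest @ replicate k c)) \<simeq>\<^sub>*
        smash (F_collapsed rest I) (F (cut_of (replicate k 1)))" .
      moreover have "pspace (F_collapsed rest I)"
        using ne S_vec_in_cuts[OF posr] by (intro pspace_FQ[OF rf]) (auto simp: Suc_le_eq)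
      ultimately show ?thesis
        using pcontractible_smash_right con1 ps1 pcontractible_pequiv by metis
    next
      case False
      then have "F (cut_of (rest @ replicate k c)) \<simeq>\<^sub>* smash (F (cut_of rest)) (F (cut_of (replicate k 1)))"
        by (intro F_append_replicate[OF prems ne]) auto
      then show ?thesis
        using pcontractible_smash_right con1 ps1 pcontractible_pequiv pspace_cut_of[OF rf ne posr] by metis
    qed
  qed
qed

text \<open>The condition on the parts larger than \<open>a\<close> makes the repeated part \<open>a\<close> behave like a repeated
  largest part: larger parts are split off without affecting the occurrences of \<open>a\<close>.\<close>

lemma contractible_repeated:
  assumes "seqm (mset l)" "positive l" "sorted l" "count (mset l) a \<ge> 2"
    and "\<And>p B. p \<in># mset l \<Longrightarrow> a < p \<Longrightarrow> B \<subseteq># mset l - {#p#} \<Longrightarrow> \<Sum>\<^sub># B = p \<Longrightarrow> a \<notin># B"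
  shows "pcontractible (F (cut_of l))"
  using assms
proof (induction "length l" arbitrary: l rule: less_induct)
  case less
  have "a \<in># mset l"
    using less.prems(4) by (metis count_greater_zero_iff less_le_trans zero_less_numeral)
  then have al: "a \<in> set l" "l \<noteq> []"
    by auto
  obtain rest k where l: "l = rest @ replicate k (last l)" and k: "k \<ge> 1"
    and lt: "\<And>x. x \<in> set rest \<Longrightarrow> x < last l"
    using sorted_decompose[OF less.prems(3) al(2)] by blast
  define c where "c = last l"
  have lc: "l = rest @ replicate k c"
    using l by (simp add: c_def)
  have ltc: "\<And>x. x \<in> set rest \<Longrightarrow> x < c"
    using lt by (simp add: c_def)
  have prems: "seqm (mset (rest @ replicate k c))" "positive (rest @ replicate k c)"
    using less.prems(1,2) lc by auto
  note pr = prems ltc k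
  have c: "c > 0" and posr: "positive rest"
    using M_pos[OF pr] pos_rest[OF pr] by blast+
  have mono: "a \<notin># B" if "L \<subseteq># mset l" "p \<in># L" "a < p" "B \<subseteq># L - {#p#}" "\<Sum>\<^sub># B = p" for L p B
  proof -
    have "L - {#p#} \<subseteq># mset l - {#p#}"
      by (rule mset_subset_eqI) (use mset_subset_eq_count[OF that(1)] in \<open>auto intro: diff_le_mono\<close>)
    from less.prems(5)[OF mset_subset_eqD[OF that(1,2)] that(3) subset_mset.order_trans[OF that(4) this] that(5)]
    show ?thesis .
  qed
  show ?case
  proof (cases "k \<ge> 2")
    case True
    then show ?thesis
      using contractible_mm[OF prems ltc] lc by simp
  next
    case False
    then have k1: "k = 1"
      using k by simp
    have lc1: "l = rest @ [c]"
      using lc k1 by simp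
    have "a \<noteq> c"
    proof
      assume "a = c"
      then have "count (mset rest) a = 0"
        using ltc by (auto simp: count_eq_zero_iff)
      then show False
        using less.prems(4) lc1 \<open>a = c\<close> by simp
    qed
    then have ac: "a < c" and ca: "count (mset rest) a \<ge> 2"
      using al(1) ltc less.prems(4) by (auto simp: lc1)
    then have ne: "rest \<noteq> []"
      by auto
    have sorted: "sorted rest"
      using less.prems(3) by (simp add: lc1 sorted_append)
    have sub: "mset rest \<subseteq># mset l"
      by (simp add: lc1)
    have IH: "pcontractible (F (cut_of rest))"
      using less.hyps[OF _ seqm_mono[OF less.prems(1) sub] posr sorted ca] mono[OF sub] by (simp add: lc1)
    have ps: "pspace (F (cut_of rest))" "pspace (F (cut_of (replicate k 1)))"
      using k posr ne by (auto intro!: pspace_cut_of[OF rf] simp: positive_def)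
    show ?thesis
    proof (cases "\<exists>J\<subseteq>{1..length rest}. wt rest J = c")
      case False
      then have "F (cut_of l) \<simeq>\<^sub>* smash (F (cut_of rest)) (F (cut_of (replicate k 1)))"
        unfolding lc by (intro F_append_replicate[OF pr ne]) auto
      then show ?thesis
        using pcontractible_smash[OF ps IH] pcontractible_pequiv by blast
    next
      case True
      then obtain I where I: "unmergeable rest I" "wt rest I = c"
        using exists_unmergeable[of _ rest c] by metis
      have IV: "I \<subseteq> {1..length rest}" "I \<noteq> {}"
        using I_subset[OF pr I] by auto
      let ?rest = "map (part rest) (sorted_list_of_set ({1..length rest} - I))"
      have fin: "finite I"
        using IV finite_subset by blast
      have card: "card I \<ge> 2" "card I \<le> length rest"
        using card_ge_2[OF IV(1) I(2) ltc c] card_mono[OF _ IV(1)] by auto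
      have len: "length ?rest + card I = length rest"
        using IV(1) fin card(2) by (simp add: card_Diff_subset)
      have inrest: "x \<in> set rest" if "x \<in> set ?rest" for x
        using that part_in_set[of _ rest] by auto
      have "pcontractible (F (cut_of (?rest @ replicate (Suc k) c)))"
        using seqm_merged[OF pr IV(1) I(2)] prems(2) ltc inrest k
        by (intro contractible_mm) (auto simp: positive_def simp del: replicate_Suc)
      from FQ_append_replicate[OF pr I this]
      have 1: "F (cut_of l) \<simeq>\<^sub>*
        smash (F_collapsed rest I) (F (cut_of (replicate k 1)))"
        by (simp add: lc)
      \<comment> \<open>This is the subspace collapsed in \<open>F (cut_of rest)\<close>. Its
        contractibility, together with that of \<open>F (cut_of rest)\<close>, makes the first smash
        factor contractible.\<close>
      have merged: "pcontractible (F (cut_of (?rest @ [c])))"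
      proof (rule less.hyps)
        have msub: "mset ?rest \<subseteq># mset rest"
          by (simp only: mset_map_part finite_Diff finite_atLeastAtMost mset_eq_parts_of[of rest] parts_of_mono Diff_subset)
        \<comment> \<open>The part \<open>c\<close> obtained by merging is identified with the last
          part of \<open>l\<close>, so the merged list is a submultiset of \<open>l\<close> and
          inherits sequentiality and the condition on larger parts.\<close>
        then have L: "mset (?rest @ [c]) \<subseteq># mset l"
          by (simp add: lc1)
        show "length (?rest @ [c]) < length l"
          using len card by (simp add: lc1)
        show "seqm (mset (?rest @ [c]))"
          by (rule seqm_mono[OF less.prems(1) L])
        show "positive (?rest @ [c])"
          using inrest posr c by (auto simp: positive_def)
        have "sorted ?rest"
          using sorted by (rule sorted_map_part) blast
        then show "sorted (?rest @ [c])"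
          using inrest ltc by (fastforce simp: sorted_append intro: less_imp_le)
        show "a \<notin># B" if "p \<in># mset (?rest @ [c])" "a < p" "B \<subseteq># mset (?rest @ [c]) - {#p#}" "\<Sum>\<^sub># B = p" for p B
          by (rule mono[OF L that])
        \<comment> \<open>\<open>c\<close> exceeds \<open>a\<close> and is the sum over
          \<open>I\<close>, so \<open>a\<close> does not occur in \<open>I\<close> and keeps its
          multiplicity under the merge.\<close>
        have "parts_of rest I \<subseteq># mset l - {#c#}"
          using IV(1) by (simp add: lc1 mset_eq_parts_of[of rest] parts_of_mono)
        then have "a \<notin># parts_of rest I"
          using less.prems(5)[of c "parts_of rest I"] ac I(2) by (simp add: lc1)
        moreover have "mset ?rest = mset rest - parts_of rest I"
          unfolding mset_map_part[OF finite_Diff[OF finite_atLeastAtMost]] using mset_minus_parts_of[OF IV(1)] by simp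
        ultimately have "count (mset ?rest) a = count (mset rest) a"
          by (simp add: not_in_iff)
        then show "2 \<le> count (mset (?rest @ [c])) a"
          using ca ac by simp
      qed
      have \<nu>: "block_list (length rest) I \<in> OPt {1..length rest}" "set (block_list (length rest) I) = one_block (length rest) I"
        using block_list_OPt[OF IV] by auto
      have mc: "merge_cut (block_list (length rest) I) (S_vec rest) = cut_of (?rest @ [c])"
        by (simp only: merge_cut_S_vec[OF \<nu>(1)] map_wt_block_list I(2))
      have pos': "positive (?rest @ [c])"
        using inrest posr c by (auto simp: positive_def)
      have eqF: "F_collapsed rest I \<simeq>\<^sub>* F (length rest, S_vec rest)"
      proof -
        have "1 \<le> length rest"
          using ne by (simp add: Suc_le_eq)
        moreover have "pspace (F (merge_cut (block_list (length rest) I) (S_vec rest)))"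
          unfolding mc by (rule pspace_cut_of[OF rf _ pos']) simp
        moreover have "pcontractible (F (merge_cut (block_list (length rest) I) (S_vec rest)))"
          unfolding mc by (rule merged)
        ultimately show ?thesis
          unfolding \<nu>(2)[symmetric] by (rule FQ_down_contractible[OF rf _ S_vec_in_cuts[OF posr] \<nu>(1)])
      qed
      have con: "pcontractible (F_collapsed rest I)"
        by (rule pcontractible_pequiv[OF eqF IH[unfolded cut_of_def]])
      have psQ: "pspace (F_collapsed rest I)"
        using ne S_vec_in_cuts[OF posr] by (intro pspace_FQ[OF rf]) (auto simp: Suc_le_eq)
      show ?thesis
        by (rule pcontractible_pequiv[OF 1 pcontractible_smash[OF psQ ps(2) con]])
    qed
  qed
qed

end

section \<open>Lexicographically maximal sets\<close>

text \<open>The first place where the decreasing enumerations differ shows the largest element of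
  the symmetric difference, and it belongs to the larger set.\<close>

lemma lex_largerD:
  assumes "lex_larger A B" "finite A" "finite B"
  shows "B \<subseteq> A \<or> (\<exists>a\<in>A - B. \<forall>x>a. x \<in> A \<longleftrightarrow> x \<in> B)"
proof (cases "B \<subseteq> A")
  case False
  define xs where "xs = rev (sorted_list_of_set A)"
  define ys where "ys = rev (sorted_list_of_set B)"
  obtain q where q: "q < card A" "q < card B" "\<And>p. p < q \<Longrightarrow> xs ! p = ys ! p" "xs ! q > ys ! q"
    using assms(1) False by (auto simp: lex_larger_def xs_def ys_def)
  have dec: "sorted_wrt (>) xs" "sorted_wrt (>) ys"
    by (simp_all add: xs_def ys_def sorted_wrt_rev)
  have set: "set xs = A" "set ys = B" "length xs = card A" "length ys = card B"
    using assms by (simp_all add: xs_def ys_def)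
  have A: "x \<in> A \<longleftrightarrow> (\<exists>i<q. x = xs ! i)" if "x > xs ! q" for x
  proof
    assume "x \<in> A"
    then obtain i where i: "i < card A" "x = xs ! i"
      using set by (metis in_set_conv_nth)
    have "i < q"
      using sorted_wrt_nth_less[OF dec(1), of q i] i that set by (cases i q rule: linorder_cases) auto
    then show "\<exists>i<q. x = xs ! i"
      using i by blast
  next
    assume "\<exists>i<q. x = xs ! i"
    then obtain i where i: "i < q" "x = xs ! i"
      by blast
    then have "i < length xs"
      using q(1) set by simp
    then show "x \<in> A"
      using set(1) nth_mem[of i xs] i by simp
  qed
  have B: "x \<in> B \<longleftrightarrow> (\<exists>i<q. x = ys ! i)" if "x \<ge> xs ! q" for x
  proof
    assume "x \<in> B"
    then obtain i where i: "i < card B" "x = ys ! i"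
      using set by (metis in_set_conv_nth)
    have "i < q"
      using sorted_wrt_nth_less[OF dec(2), of q i] i that set q(4) by (cases i q rule: linorder_cases) auto
    then show "\<exists>i<q. x = ys ! i"
      using i by blast
  next
    assume "\<exists>i<q. x = ys ! i"
    then obtain i where i: "i < q" "x = ys ! i"
      by blast
    then have "i < length ys"
      using q(2) set by simp
    then show "x \<in> B"
      using set(2) nth_mem[of i ys] i by simp
  qed
  have "xs ! q \<in> A"
    using set q(1) nth_mem by metis
  moreover have "xs ! q \<notin> B"
  proof
    assume "xs ! q \<in> B"
    then obtain i where "i < q" "xs ! q = xs ! i"
      using B q(3) by auto
    then show False
      using sorted_wrt_nth_less[OF dec(1), of i q] q(1) set by simp
  qed
  moreover have "x \<in> A \<longleftrightarrow> x \<in> B" if "x > xs ! q" for x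
    using A[OF that] B[of x] that q(3) by auto
  ultimately show ?thesis
    by blast
qed simp

lemma is_I_set_iff:
  "is_I_set l A \<longleftrightarrow> A \<subseteq> {1..length l} \<and> card A \<ge> 2 \<and> wt l A = part l (length l) \<and>
     (\<forall>B. B \<subseteq> {1..length l} \<and> card B \<ge> 2 \<and> wt l B = part l (length l) \<longrightarrow> lex_larger A B)"
  unfolding is_I_set_def Let_def wt_def by (simp add: eq_commute[of "part l (length l)"] imp_conjL)

text \<open>Two candidates that dominate each other coincide: equal weights exclude proper
  inclusion, and the largest index on which they differ cannot belong to both. So the definite
  description is well defined.\<close>

lemma is_I_set_I_set:
  assumes "I_exists l" "positive l"
  shows "is_I_set l (I_set l)"
proof -
  obtain A where A: "is_I_set l A"
    using assms(1) by (auto simp: I_exists_def)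
  have "B = A" if B: "is_I_set l B" for B
  proof -
    have sub: "A \<subseteq> {1..length l}" "B \<subseteq> {1..length l}" and w: "wt l A = wt l B"
      and lex: "lex_larger A B" "lex_larger B A"
      using A B by (auto simp: is_I_set_iff)
    have fin: "finite A" "finite B"
      using sub finite_subset by blast+
    have "B = A" if "B \<subseteq> A"
      using wt_psubset[OF assms(2) sub(1) that] w by simp
    moreover have "B = A" if "A \<subseteq> B"
      using wt_psubset[OF assms(2) sub(2) that] w by simp
    moreover have False if "a \<in> A - B" "\<forall>x>a. x \<in> A \<longleftrightarrow> x \<in> B" "b \<in> B - A" "\<forall>x>b. x \<in> B \<longleftrightarrow> x \<in> A" for a b
      using that by (cases a b rule: linorder_cases) auto
    ultimately show ?thesis
      using lex_largerD[OF lex(1) fin] lex_largerD[OF lex(2) fin(2,1)] by blast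
  qed
  then show ?thesis
    unfolding I_set_def using A by (metis theI)
qed

text \<open>If at least two elements of \<open>I\<close> had together the weight of an outside index
  \<open>q\<close>, all of them would lie below \<open>q\<close>, and exchanging them for
  \<open>q\<close> would give a candidate that \<open>I\<close> does not dominate.\<close>

lemma unmergeable_I_set:
  assumes I: "is_I_set (rest @ zs) I" and l: "sorted (rest @ zs)"
    and sub: "I \<subseteq> {1..length rest}" and less: "\<And>x. x \<in> set rest \<Longrightarrow> x < part (rest @ zs) (length (rest @ zs))"
    and pos: "positive rest"
  shows "unmergeable rest I"
  unfolding unmergeable_def
proof (intro conjI ballI allI impI sub)
  let ?l = "rest @ zs"
  fix q X assume q: "q \<in> {1..length rest} - I" and X: "X \<subseteq> I" "wt rest X = part rest q"
  show "card X \<le> 1"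
  proof (rule ccontr)
    assume card: "\<not> card X \<le> 1"
    have "finite I"
      using finite_subset[OF sub] by simp
    then have fin: "finite I" "finite X"
      using finite_subset[OF X(1)] by simp_all
    have XV: "X \<subseteq> {1..length rest}"
      using X(1) sub by blast
    \<comment> \<open>Two or more positive parts sum to the part at \<open>q\<close>, so each of
      them is strictly smaller and, by sortedness, has a smaller index.\<close>
    have Xq: "i < q" if i: "i \<in> X" for i
    proof (rule ccontr)
      assume "\<not> i < q"
      then have "part rest q \<le> part rest i"
        using q i XV l by (intro part_mono) (auto simp: sorted_append)
      moreover have "wt rest (X - {i}) + part rest i = part rest q"
        using X(2) i fin by (simp add: wt_def sum.remove[of X i])
      ultimately have "wt rest (X - {i}) = 0"
        by simp
      then have "X - {i} = {}"
        using wt_eq_0[OF pos] XV by blast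
      then have "card X \<le> card {i}"
        by (intro card_mono) auto
      then show False
        using card by simp
    qed
    define D where "D = insert q (I - X)"
    have DV: "D \<subseteq> {1..length rest}"
      using q sub by (auto simp: D_def)
    have finD: "finite D"
      using DV finite_subset by blast
    have "wt rest ((I - X) \<union> {q}) = wt rest (I - X) + wt rest {q}"
      using q fin by (intro wt_Un) auto
    then have wD: "wt rest D = wt rest I"
      using X wt_Diff[OF fin(1) X(1), of rest] wt_mono[OF fin(1) X(1), of rest] by (simp add: D_def)
    have wD': "wt ?l D = part ?l (length ?l)"
      using wD I sub DV by (simp add: is_I_set_iff wt_append)
    have pq: "part rest q < part ?l (length ?l)"
      using q part_in_set[of q rest] by (intro less) auto
    have "card D \<ge> 2"
    proof (rule ccontr)
      assume "\<not> ?thesis"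
      moreover have "q \<in> D"
        by (simp add: D_def)
      ultimately have "D = {q}"
        using finD card_le_Suc0_iff_eq[OF finD] by auto
      then show False
        using wD' pq q by (simp add: part_append)
    qed
    moreover have "D \<subseteq> {1..length ?l}"
      using DV by auto
    ultimately have lex: "lex_larger I D"
      using I wD' unfolding is_I_set_iff by blast
    have "q \<in> D" "q \<notin> I"
      using q by (auto simp: D_def)
    then obtain a where a: "a \<in> I - D" "\<forall>x>a. x \<in> I \<longleftrightarrow> x \<in> D"
      using lex_largerD[OF lex fin(1) finD] by blast
    then have "a < q"
      using Xq by (auto simp: D_def)
    then show False
      using a(2) \<open>q \<in> D\<close> \<open>q \<notin> I\<close> by blast
  qed
qed

text \<open>A part exceeding the one at \<open>Max I\<close> would sit at an index above
  \<open>Max I\<close>, and the candidate containing that index would beat \<open>I\<close>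
  lexicographically.\<close>

lemma I_set_bound:
  assumes I: "is_I_set l I" and l: "sorted l" and D: "D \<subseteq># mset l" "\<Sum>\<^sub># D = part l (length l)" "size D \<ge> 2"
    and p: "p \<in># D"
  shows "p \<le> part l (Max I)"
proof (rule ccontr)
  assume gt: "\<not> ?thesis"
  obtain D' where D': "D' \<subseteq> {1..length l}" "D = parts_of l D'"
    using D(1) parts_of_subset by (metis finite_atLeastAtMost mset_eq_parts_of)
  have IV: "I \<subseteq> {1..length l}" "card I \<ge> 2"
    using I by (auto simp: is_I_set_iff)
  have fin: "finite I" "finite D'"
    using IV D'(1) finite_subset by blast+
  obtain i where i: "i \<in> D'" "p = part l i"
    using p fin by (auto simp: D' set_parts_of)
  have "I \<noteq> {}"
    using IV(2) by auto
  then have max: "Max I \<in> I"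
    using fin by simp
  have iq: "Max I < i"
  proof (rule ccontr)
    assume "\<not> ?thesis"
    then have "part l i \<le> part l (Max I)"
      using D'(1) i IV max by (intro part_mono[OF l]) auto
    then show False
      using gt i by simp
  qed
  then have iI: "i \<notin> I"
    using Max_ge[OF fin(1), of i] by auto
  have "card D' \<ge> 2" "wt l D' = part l (length l)"
    using D by (simp_all add: D') (simp add: parts_of_def)
  then have "lex_larger I D'"
    using I D'(1) unfolding is_I_set_iff by blast
  from lex_largerD[OF this fin] iI i obtain a where a: "a \<in> I - D'" "\<forall>x>a. x \<in> I \<longleftrightarrow> x \<in> D'"
    by blast
  then have "a \<le> Max I"
    using fin by simp
  then show False
    using a(2) iq i iI by auto
qed

text \<open>Suppose the representation \<open>B\<close> of \<open>p\<close> shares a submultiset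
  \<open>C\<close> with \<open>I\<close>. Then \<open>c + (B - C)\<close> and
  \<open>p + (I - C)\<close> have equal sums, and sequentiality represents the largest part
  \<open>c\<close> inside the second. With \<open>p\<close> such a representation contradicts
  \<open>I_set_bound\<close>; without \<open>p\<close> it is too light because \<open>C\<close> is
  missing.\<close>

lemma larger_parts_avoid_I_set:
  assumes seq: "seqm (mset l)" and l: "sorted l" "positive l" and I: "is_I_set l I"
    and p: "p \<in># mset l" "part l (Max I) < p" "p < part l (length l)"
    and B: "B \<subseteq># mset l - {#p#}" "\<Sum>\<^sub># B = p" and i: "i \<in># parts_of l I"
  shows "i \<notin># B"
proof
  assume iB: "i \<in># B"
  define c where "c = part l (length l)"
  define Im where "Im = parts_of l I"
  have IV: "I \<subseteq> {1..length l}" "wt l I = c"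
    using I by (auto simp: is_I_set_iff c_def)
  have fin: "finite I"
    using IV finite_subset by blast
  define C where "C = B \<inter># Im"
  have C: "C \<subseteq># B" "C \<subseteq># Im" "i \<in># C"
    using iB i by (auto simp: C_def Im_def)
  have sC: "\<Sum>\<^sub># C > 0"
  proof -
    have "i \<in> set l"
      using i IV fin part_in_set[of _ l] by (auto simp: set_parts_of)
    then have "i > 0"
      using l(2) by (simp add: positive_def)
    then show ?thesis
      using le_sum_mset[OF C(3)] by linarith
  qed
  have Im: "Im \<subseteq># mset l" "\<Sum>\<^sub># Im = c"
    using IV by (auto simp: Im_def mset_eq_parts_of parts_of_mono)
  have Imle: "x \<le> part l (Max I)" if x: "x \<in># Im" for x
  proof -
    obtain j where j: "j \<in> I" "x = part l j"
      using x fin by (auto simp: Im_def set_parts_of)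
    then show ?thesis
    proof -
      have "Max I \<in> I"
        using Max_in[OF fin] j(1) by auto
      then have "j \<in> {1..length l}" "Max I \<in> {1..length l}"
        using j(1) IV(1) by blast+
      then show ?thesis
        using j(2) Max_ge[OF fin j(1)] by (auto intro!: part_mono[OF l(1)])
    qed
  qed
  have ne: "l \<noteq> []"
    using p(1) by auto
  have cl: "c \<in># mset l"
    using part_in_set[of "length l" l] ne by (auto simp: c_def Suc_le_eq)
  have Bl: "B \<subseteq># mset l"
    using subset_mset.order_trans[OF B(1) diff_subset_eq_self] .
  have "c \<notin># B"
    using le_sum_mset[of c B] B(2) p(3) by (auto simp: c_def)
  have 1: "add_mset c (B - C) \<subseteq># mset l"
  proof (rule mset_subset_eqI)
    fix x
    show "count (add_mset c (B - C)) x \<le> count (mset l) x"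
    proof (cases "x = c")
      case True
      then show ?thesis
        using \<open>c \<notin># B\<close> cl by (simp add: not_in_iff Suc_le_eq)
    next
      case False
      then show ?thesis
        using mset_subset_eq_count[OF Bl, of x] by simp
    qed
  qed
  have "p \<notin># Im"
    using Imle[of p] p(2) by linarith
  have 2: "add_mset p (Im - C) \<subseteq># mset l"
  proof (rule mset_subset_eqI)
    fix x
    show "count (add_mset p (Im - C)) x \<le> count (mset l) x"
    proof (cases "x = p")
      case True
      then show ?thesis
        using \<open>p \<notin># Im\<close> p(1) by (simp add: not_in_iff Suc_le_eq)
    next
      case False
      then show ?thesis
        using mset_subset_eq_count[OF Im(1), of x] by simp
    qed
  qed
  have sub: "\<Sum>\<^sub># (B - C) + \<Sum>\<^sub># C = p" "\<Sum>\<^sub># (Im - C) + \<Sum>\<^sub># C = c"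
    using C(1,2) B(2) Im(2) by (simp_all flip: sum_mset.union)
  have "\<exists>D. D \<subseteq># add_mset p (Im - C) \<and> \<Sum>\<^sub># D = c"
  proof (rule seqm_ex[OF seq 1 2])
    show "\<Sum>\<^sub># (add_mset c (B - C)) = \<Sum>\<^sub># (add_mset p (Im - C))"
      using sub by simp
    have "x \<le> c" if "x \<in># B - C" for x
      using le_sum_mset[OF that] sub(1) p(3) by (simp add: c_def)
    then show "\<forall>x\<in>#add_mset c (B - C). x \<le> c"
      by auto
    have "x \<le> c" if "x \<in># Im - C" for x
      using le_sum_mset[OF that] sub(2) by simp
    then show "\<forall>x\<in>#add_mset p (Im - C). x \<le> c"
      using p(3) by (auto simp: c_def)
  qed simp
  then obtain D where D: "D \<subseteq># add_mset p (Im - C)" "\<Sum>\<^sub># D = c"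
    by blast
  show False
  proof (cases "p \<in># D")
    case True
    have "size D \<ge> 2"
    proof (rule ccontr)
      assume "\<not> ?thesis"
      moreover have "D = add_mset p (D - {#p#})"
        using True by simp
      ultimately have "D - {#p#} = {#}"
        by (metis One_nat_def Suc_1 Suc_leI less_Suc_eq_0_disj linorder_not_less size_add_mset size_eq_0_iff_empty
            not_less_eq neq0_conv size_empty)
      then have "D = {#p#}"
        using \<open>D = add_mset p (D - {#p#})\<close> by simp
      then show False
        using D(2) p(3) by (simp add: c_def)
    qed
    then have "p \<le> part l (Max I)"
      using I_set_bound[OF I l(1) subset_mset.order_trans[OF D(1) 2] _ _ True] D(2) by (simp add: c_def)
    then show False
      using p(2) by simp
  next
    case False
    then have "D \<subseteq># Im - C"
      using subset_mset_minusD[OF D(1)] by blast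
    from sum_mset_mono_nat[OF this] show False
      using D(2) sub(2) sC by linarith
  qed
qed

section \<open>The splitting\<close>

lemma sorted_list_of_set_snoc:
  fixes m :: nat
  assumes "finite U" "\<And>u. u \<in> U \<Longrightarrow> u < m"
  shows "sorted_list_of_set (insert m U) = sorted_list_of_set U @ [m]"
proof -
  define V where "V = insert m U"
  have V: "finite V" "set (sorted_list_of_set U @ [m]) = V"
    using assms(1) by (simp_all add: V_def)
  have "m \<notin> U"
    using assms(2) by blast
  have "sorted_list_of_set V = sorted_list_of_set U @ [m]"
    by (rule sorted_distinct_set_unique)
       (use V assms \<open>m \<notin> U\<close> in \<open>auto simp: sorted_append intro: less_imp_le\<close>)
  then show ?thesis
    by (simp only: V_def)
qed

lemma sum_list_map_wt:
  assumes "\<pi> \<in> OPt {1..length l}"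
  shows "wt (map (wt l) \<pi>) {1..length \<pi>} = wt l {1..length l}"
proof -
  have P: "set \<pi> \<in> Pt {1..length l}"
    using assms by (simp add: OPt_def Pt_def)
  have "(\<Union>j\<in>{1..length \<pi>}. \<pi> ! (j - 1)) = \<Union>(set \<pi>)"
  proof (intro set_eqI iffI)
    fix x assume "x \<in> \<Union>(set \<pi>)"
    then obtain j where "j < length \<pi>" "x \<in> \<pi> ! j"
      by (auto simp: in_set_conv_nth)
    then show "x \<in> (\<Union>j\<in>{1..length \<pi>}. \<pi> ! (j - 1))"
      by (intro UN_I[of "Suc j"]) auto
  next
    fix x assume "x \<in> (\<Union>j\<in>{1..length \<pi>}. \<pi> ! (j - 1))"
    then obtain j where "j \<in> {1..length \<pi>}" "x \<in> \<pi> ! (j - 1)"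
      by blast
    moreover from this have "\<pi> ! (j - 1) \<in> set \<pi>"
      by (intro nth_mem) auto
    ultimately show "x \<in> \<Union>(set \<pi>)"
      by blast
  qed
  then show ?thesis
    using wt_op_blocks[OF assms, of "{1..length \<pi>}"] by (simp add: Pt_Union[OF P])
qed

context
  fixes F :: "cut \<Rightarrow> 'a pspace" and M :: "cut \<Rightarrow> cut \<Rightarrow> nat set list \<Rightarrow> 'a \<Rightarrow> 'a"
  assumes rf: "resonance_functor F M"
    and ones: "\<And>k. k \<ge> 2 \<Longrightarrow> pcontractible (F (cut_of (replicate k 1)))"
begin

lemma F_append_big:
  assumes "rest \<noteq> []" "positive (rest @ [W])" "wt rest {1..length rest} < W"
  shows "F (cut_of (rest @ [W])) \<simeq>\<^sub>* smash (F (cut_of rest)) (F (cut_of [1]))"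
proof -
  have "F (cut_of (rest @ [W])) \<simeq>\<^sub>* smash (F (cut_of rest)) (F (cut_of [W]))"
    by (rule F_append[OF rf assms(1) _ assms(2) balanced_big[OF assms(2,3)]]) auto
  then show ?thesis
    using S_vec_replicate[of W 1] assms(2) by (simp add: positive_def)
qed

lemma FQ_append_big:
  assumes "rest \<noteq> []" "positive (rest @ [W])" "wt rest {1..length rest} < W" and \<pi>: "\<pi> \<in> OPt {1..length rest}"
  defines "N \<equiv> length rest"
  shows "FQ F M (N + 1) (S_vec (rest @ [W])) (down (N + 1) (set (\<pi> @ [{N + 1}])) (S_vec (rest @ [W]))) \<simeq>\<^sub>*
    smash (FQ F M N (S_vec rest) (down N (set \<pi>) (S_vec rest))) (F (cut_of [1]))"
proof -
  have \<nu>: "set \<pi> \<in> Pt {1..length rest}"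
    using \<pi> by (simp add: OPt_def Pt_def)
  have set: "set (\<pi> @ [{N + 1}]) = add_singles {N + 1..N + 1} (set \<pi>)"
    by (auto simp: add_singles_def)
  have "cut_of [W] = cut_of [1]"
    using S_vec_replicate[of W 1] assms(2) by (simp add: positive_def)
  moreover have "FQ F M (length rest + length [W]) (S_vec (rest @ [W])) (down (N + 1) (set (\<pi> @ [{N + 1}])) (S_vec (rest @ [W]))) \<simeq>\<^sub>*
    smash (FQ F M (length rest) (S_vec rest) (down N (set \<pi>) (S_vec rest))) (F (cut_of [W]))"
  proof (rule FQ_append[OF rf assms(1) _ assms(2)])
    show "down (N + 1) (set (\<pi> @ [{N + 1}])) (S_vec (rest @ [W])) =
      {\<rho> \<in> Pt {1..length rest + length [W]}. restrict_part {1..length rest} \<rho> \<in> down N (set \<pi>) (S_vec rest)}"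
      using closure_big[OF assms(2,3) \<nu>] unfolding set unfolding N_def by simp
    show "closed_parts (length rest) R (down N (set \<pi>) (S_vec rest))" if "R \<subseteq> S_vec rest" for R
      unfolding N_def by (rule closed_parts_down[OF that])
    show "closed_parts (length rest + length [W]) R (down (N + 1) (set (\<pi> @ [{N + 1}])) (S_vec (rest @ [W])))"
      if "R \<subseteq> S_vec (rest @ [W])" for R
      using closed_parts_down[OF that] by (simp add: N_def)
  qed (use balanced_big[OF assms(2,3)] in auto)
  ultimately show ?thesis
    by (simp add: N_def)
qed

text \<open>Merging only \<open>J\<close> refines merging \<open>I\<close> and produces a second
  copy of the part at \<open>q\<close>, so \<open>contractible_repeated\<close> applies and the
  inclusion factors through a contractible space. The second claim repeats this with a part
  \<open>W\<close> too large for any relation, which only contributes a smash factor.\<close>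

lemma pnull_incl_strongly:
  assumes seq: "seqm (mset rest)" and pos: "positive rest" and sorted: "sorted rest"
    and I: "I \<subseteq> {1..length rest}" and q: "q \<in> I" "J \<subseteq> I - {q}" "wt rest J = part rest q"
    and avoid: "\<And>p B i. p \<in># mset rest \<Longrightarrow> part rest q < p \<Longrightarrow> B \<subseteq># mset rest - {#p#} \<Longrightarrow> \<Sum>\<^sub># B = p \<Longrightarrow>
      i \<in># parts_of rest I \<Longrightarrow> i \<notin># B"
  defines "T \<equiv> S_vec rest" and "N \<equiv> length rest" and "\<nu> \<equiv> block_list (length rest) I"
  shows "pnull (F (merge_cut \<nu> T)) (F (N, T)) (incl M N T \<nu>)"
    "W > wt rest {1..length rest} \<Longrightarrow>
      pnull (F (merge_cut (\<nu> @ [{N + 1}]) (S_vec (rest @ [W])))) (F (N + 1, S_vec (rest @ [W])))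
        (incl M (N + 1) (S_vec (rest @ [W])) (\<nu> @ [{N + 1}]))"
proof -
  define a where "a = part rest q"
  have qN: "q \<in> {1..length rest}"
    using q I by blast
  have a: "a > 0"
    using positive_part[OF pos qN] by (simp add: a_def)
  have J: "J \<subseteq> {1..length rest}" "J \<noteq> {}" "J \<subseteq> I"
    using q(2,3) I a by (auto simp: a_def)
  have finI: "finite I"
    using finite_subset[OF I] by simp
  have ne: "rest \<noteq> []"
    using qN by auto
  \<comment> \<open>\<open>contractible_repeated\<close> asks for a sorted list, so the blocks are
    ordered by weight; an ordered partition may list them in any order.\<close>
  define \<tau> where "\<tau> = sort_key (wt rest) (block_list N J)"
  have \<tau>: "\<tau> \<in> OPt {1..length rest}" "set \<tau> = one_block N J"
    using block_list_OPt[OF J(1,2)] by (auto simp: \<tau>_def N_def OPt_def)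
  have \<nu>: "\<nu> \<in> OPt {1..length rest}" "set \<nu> = one_block N I"
    using block_list_OPt[OF I] q(1) by (auto simp: \<nu>_def N_def)
  have ref: "\<forall>C\<in>set \<tau>. \<exists>B\<in>set \<nu>. C \<subseteq> B"
    using J(3) by (auto simp: \<tau>(2) \<nu>(2) one_block_eq)
  let ?l = "map (wt rest) \<tau>"
  have subJ: "parts_of rest J \<subseteq># mset rest"
    using J(1) by (simp add: mset_eq_parts_of parts_of_mono)
  have ml: "mset ?l = add_mset a (mset rest - parts_of rest J)"
  proof -
    have "mset ?l = mset (map (wt rest) (block_list N J))"
      by (simp add: \<tau>_def)
    also have "\<dots> = add_mset a (parts_of rest ({1..length rest} - J))"
      unfolding map_wt_block_list mset_append mset_map_part[OF finite_Diff[OF finite_atLeastAtMost]]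
      by (simp add: q(3) a_def N_def)
    finally show ?thesis
      using mset_minus_parts_of[OF J(1)] by simp
  qed
  have aq: "a \<in># mset rest - parts_of rest J"
    unfolding mset_minus_parts_of[OF J(1)] using qN q(2) by (auto simp: set_parts_of a_def)
  have JI: "parts_of rest J \<subseteq># parts_of rest I"
    by (rule parts_of_mono[OF finI J(3)])
  have con: "pcontractible (F (cut_of ?l))"
  proof (rule contractible_repeated[OF rf ones])
    have "seqm (add_mset (\<Sum>\<^sub># (parts_of rest J)) (mset rest - parts_of rest J))"
    proof (rule seqm_merge[OF seq subJ])
      show "\<Sum>\<^sub># (parts_of rest J) \<in># mset rest - parts_of rest J"
        using aq by (simp add: q(3) a_def)
      show "i \<notin># B" if "p \<in># mset rest" "\<Sum>\<^sub># (parts_of rest J) < p" "B \<subseteq># mset rest - {#p#}" "\<Sum>\<^sub># B = p"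
        "i \<in># parts_of rest J" for p B i
        using avoid[OF that(1) _ that(3,4) mset_subset_eqD[OF JI that(5)]] that(2) by (simp add: q(3))
    qed
    then show "seqm (mset ?l)"
      unfolding ml by (simp add: q(3) a_def)
    show "positive ?l"
      by (rule positive_map_wt[OF pos \<tau>(1)])
    show "sorted ?l"
      by (simp add: \<tau>_def)
    show "2 \<le> count (mset ?l) a"
      unfolding ml using aq by (simp add: Suc_le_eq flip: count_greater_zero_iff)
    fix p B assume p: "p \<in># mset ?l" "a < p" and B: "B \<subseteq># mset ?l - {#p#}" "\<Sum>\<^sub># B = p"
    show "a \<notin># B"
    proof
      assume aB: "a \<in># B"
      have p': "p \<in># mset rest"
        using p unfolding ml by (auto dest: in_diffD)
      \<comment> \<open>Expanding one copy of \<open>a\<close> in \<open>B\<close> to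
        \<open>J\<close> gives a representation of \<open>p\<close> by parts of \<open>rest\<close>
        that contains parts of \<open>I\<close>, against \<open>avoid\<close>.\<close>
      have "B - {#a#} \<subseteq># mset rest - parts_of rest J"
      proof (rule mset_subset_eqI)
        fix x
        show "count (B - {#a#}) x \<le> count (mset rest - parts_of rest J) x"
          using mset_subset_eq_count[OF B(1)[unfolded ml], of x] by (auto split: if_splits)
      qed
      from subset_mset.add_mono[OF this subset_mset.order_refl[of "parts_of rest J"]]
      have sub: "B - {#a#} + parts_of rest J \<subseteq># mset rest"
        using subJ by simp
      have sum: "\<Sum>\<^sub># (B - {#a#} + parts_of rest J) = p"
        using sum_mset_minus1[OF aB] B(2) q(3) by (simp add: a_def)
      have "p \<notin># B - {#a#} + parts_of rest J"
      proof
        assume "p \<in># B - {#a#} + parts_of rest J"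
        then consider "p \<in># B - {#a#}" | "p \<in># parts_of rest J"
          by auto
        then show False
        proof cases
          case 1
          then show ?thesis
            using le_sum_mset[OF 1] sum_mset_minus1[OF aB] B(2) a by linarith
        next
          case 2
          then show ?thesis
            using le_sum_mset[OF 2] p(2) by (simp add: q(3) a_def)
        qed
      qed
      then have "B - {#a#} + parts_of rest J \<subseteq># mset rest - {#p#}"
        by (rule subset_mset_minus1I[OF sub])
      moreover obtain j where "j \<in># parts_of rest J"
        using J(2) finite_subset[OF J(1)] by (auto simp: set_parts_of)
      ultimately show False
        using avoid[OF p' _ _ sum mset_subset_eqD[OF JI]] p(2) by (auto simp: a_def)
    qed
  qed
  then show "pnull (F (merge_cut \<nu> T)) (F (N, T)) (incl M N T \<nu>)"
    unfolding T_def N_def using pnull_incl[OF rf ones ne pos \<tau>(1) \<nu>(1) ref] by blast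
  assume W: "W > wt rest {1..length rest}"
  have pos': "positive (rest @ [W])"
    using pos W by (simp add: positive_def)
  have ext: "\<pi> @ [{N + 1}] \<in> OPt {1..length (rest @ [W])}" "map (wt (rest @ [W])) (\<pi> @ [{N + 1}]) = map (wt rest) \<pi> @ [W]"
    if "\<pi> \<in> OPt {1..length rest}" for \<pi>
    using OPt_append_singles(1)[OF that, of 1] map_wt_append_singles[OF that, of "[W]"] by (simp_all add: N_def)
  have ne': "?l \<noteq> []"
    using ref q(1) \<tau>(2) by (auto simp: one_block_eq)
  have pl: "positive (?l @ [W])" "positive ?l"
    using positive_map_wt[OF pos \<tau>(1)] W by (auto simp: positive_def)
  have "F (cut_of (?l @ [W])) \<simeq>\<^sub>* smash (F (cut_of ?l)) (F (cut_of [1]))"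
    using W sum_list_map_wt[OF \<tau>(1)] by (intro F_append_big[OF ne' pl(1)]) simp
  moreover have "pcontractible (smash (F (cut_of ?l)) (F (cut_of [1])))"
    by (rule pcontractible_smash[OF pspace_cut_of[OF rf ne' pl(2)] pspace_cut_of[OF rf] con]) (auto simp: positive_def)
  ultimately have "pcontractible (F (cut_of (?l @ [W])))"
    by (rule pcontractible_pequiv)
  then have con': "pcontractible (F (cut_of (map (wt (rest @ [W])) (\<tau> @ [{N + 1}]))))"
    unfolding ext(2)[OF \<tau>(1)] .
  have ref': "\<forall>C\<in>set (\<tau> @ [{N + 1}]). \<exists>B\<in>set (\<nu> @ [{N + 1}]). C \<subseteq> B"
    using ref by auto
  have "pnull (F (merge_cut (\<nu> @ [{N + 1}]) (S_vec (rest @ [W])))) (F (length (rest @ [W]), S_vec (rest @ [W])))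
        (incl M (length (rest @ [W])) (S_vec (rest @ [W])) (\<nu> @ [{N + 1}]))"
    by (rule pnull_incl[OF rf ones _ pos' ext(1)[OF \<tau>(1)] ext(1)[OF \<nu>(1)] ref' con']) auto
  then show "pnull (F (merge_cut (\<nu> @ [{N + 1}]) (S_vec (rest @ [W])))) (F (N + 1, S_vec (rest @ [W])))
        (incl M (N + 1) (S_vec (rest @ [W])) (\<nu> @ [{N + 1}]))"
    by (simp add: N_def)
qed

text \<open>Smashing a splitting of the quotient with \<open>F(1)\<close> would need associativity of smash products, which
  fails for arbitrary spaces. Instead, the whole triple is smashed inside the resonance category, by adding
  a part \<open>W\<close> that is too large to take part in any relation.\<close>

lemma FQ_smash_split:
  assumes ne: "rest \<noteq> []" and pos: "positive rest" and \<nu>: "\<nu> \<in> OPt {1..length rest}"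
    and W: "W > wt rest {1..length rest}"
    and null: "pnull (F (merge_cut (\<nu> @ [{length rest + 1}]) (S_vec (rest @ [W])))) (F (length rest + 1, S_vec (rest @ [W])))
        (incl M (length rest + 1) (S_vec (rest @ [W])) (\<nu> @ [{length rest + 1}]))"
  shows "smash (FQ F M (length rest) (S_vec rest) (down (length rest) (set \<nu>) (S_vec rest))) (F (cut_of [1])) \<simeq>\<^sub>*
    wedge (smash (F (cut_of [1])) (F (cut_of rest))) (susp (smash (F (cut_of [1])) (F (cut_of (map (wt rest) \<nu>)))))"
proof -
  let ?N = "length rest" and ?S = "S_vec (rest @ [W])" and ?\<pi> = "\<nu> @ [{length rest + 1}]" and ?\<mu> = "map (wt rest) \<nu>"
  have pos': "positive (rest @ [W])"
    using pos W by (simp add: positive_def)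
  have \<pi>: "?\<pi> \<in> OPt {1..?N + 1}" "map (wt (rest @ [W])) ?\<pi> = ?\<mu> @ [W]"
    using OPt_append_singles(1)[OF \<nu>, of 1] map_wt_append_singles[OF \<nu>, of "[W]"] by simp_all
  have mc: "merge_cut ?\<pi> ?S = cut_of (?\<mu> @ [W])"
  proof -
    have "?\<pi> \<in> OPt {1..length (rest @ [W])}"
      using \<pi>(1) by simp
    from merge_cut_S_vec[OF this] show ?thesis
      unfolding \<pi>(2) .
  qed
  have cut: "?S \<in> cuts (?N + 1)"
    using S_vec_in_cuts[OF pos'] by simp
  have ne\<mu>: "?\<mu> \<noteq> []"
    using \<nu> ne by (auto simp: OPt_def partition_on_def Suc_le_eq)
  have pos\<mu>: "positive ?\<mu>" "positive (?\<mu> @ [W])"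
    using positive_map_wt[OF pos \<nu>] W by (auto simp: positive_def)
  have ps: "pspace (F (cut_of [1]))" "pspace (F (cut_of rest))" "pspace (F (cut_of ?\<mu>))"
    "pspace (F (cut_of (?\<mu> @ [W])))" "pspace (F (cut_of (rest @ [W])))"
    using pspace_cut_of[OF rf] ne pos ne\<mu> pos\<mu> pos' by (auto simp: positive_def)
  have e: "F (?N + 1, ?S) = F (cut_of (rest @ [W]))"
    by (simp add: cut_of_def)
  have 1: "F (cut_of (rest @ [W])) \<simeq>\<^sub>* smash (F (cut_of [1])) (F (cut_of rest))"
    by (rule pequiv_trans[OF F_append_big[OF ne pos' W] smash_commute[OF ps(2,1)]])
  have "wt ?\<mu> {1..length ?\<mu>} < W"
    using sum_list_map_wt[OF \<nu>] W by simp
  from pequiv_trans[OF F_append_big[OF ne\<mu> pos\<mu>(2) this] smash_commute[OF ps(3,1)]]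
  have 2: "F (cut_of (?\<mu> @ [W])) \<simeq>\<^sub>* smash (F (cut_of [1])) (F (cut_of ?\<mu>))" .
  have A1: "inclusion_map (F (merge_cut ?\<pi> ?S)) (F (?N + 1, ?S)) (incl M (?N + 1) ?S ?\<pi>)"
    "FQ F M (?N + 1) ?S (down (?N + 1) (set ?\<pi>) ?S) \<simeq>\<^sub>* pquot (F (?N + 1, ?S)) (incl_im F M (?N + 1) ?S ?\<pi>)"
    using A1_inclusion[OF rf _ cut \<pi>(1)] by simp_all
  \<comment> \<open>The null-homotopic inclusion splits the quotient with \<open>W\<close> already
    included, so both wedge summands come from spaces of lists and can be turned into smash products
    afterwards.\<close>
  have "pquot (F (?N + 1, ?S)) (incl_im F M (?N + 1) ?S ?\<pi>) \<simeq>\<^sub>* wedge (F (?N + 1, ?S)) (susp (F (merge_cut ?\<pi> ?S)))"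
    unfolding incl_im_def by (rule pquot_null_pequiv[OF _ _ A1(1) null]) (use ps in \<open>simp_all only: mc e\<close>)
  from pequiv_trans[OF pequiv_sym[OF FQ_append_big[OF ne pos' W \<nu>]] pequiv_trans[OF A1(2) this]]
  have "smash (FQ F M ?N (S_vec rest) (down ?N (set \<nu>) (S_vec rest))) (F (cut_of [1])) \<simeq>\<^sub>*
    wedge (F (cut_of (rest @ [W]))) (susp (F (cut_of (?\<mu> @ [W]))))"
    unfolding mc e .
  moreover have "wedge (F (cut_of (rest @ [W]))) (susp (F (cut_of (?\<mu> @ [W])))) \<simeq>\<^sub>*
    wedge (smash (F (cut_of [1])) (F (cut_of rest))) (susp (smash (F (cut_of [1])) (F (cut_of ?\<mu>))))"
    by (intro wedge_pequiv susp_pequiv 1 2 pspace_susp pspace_smash ps)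
  ultimately show ?thesis
    by (rule pequiv_trans)
qed

end

theorem theorem5p6:
  fixes F :: "cut \<Rightarrow> 'a pspace"
    and M :: "cut \<Rightarrow> cut \<Rightarrow> nat set list \<Rightarrow> 'a \<Rightarrow> 'a"
    and l :: "nat list"
  assumes "resonance_functor F M"
    and "\<And>k. k \<ge> 2 \<Longrightarrow> pcontractible (F (cut_of (replicate k 1)))"
    and "sequential l"
    and "I_exists l"
  defines "n \<equiv> length l"
    and "T \<equiv> S_vec (butlast l)"
    and "\<nu> \<equiv> one_block (length l - 1) (I_set l)"
    and "\<mu> \<equiv> map (part l) (sorted_list_of_set ({1..length l} - I_set l))"
  shows "(mm l \<ge> 2 \<longrightarrow> pcontractible (F (cut_of l))) \<and>
    (mm l = 1 \<longrightarrow>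
      F (cut_of l) \<simeq>\<^sub>* smash (FQ F M (n - 1) T (down (n - 1) \<nu> T)) (F (cut_of [1])) \<and>
      (\<exists>\<nu>'\<in>OPt {1..n - 1}. set \<nu>' = \<nu> \<and>
         length \<nu>' = length \<mu> \<and>
         resonance (length \<mu>) (merge \<nu>' T) = resonance (length \<mu>) (S_vec \<mu>) \<and>
         inclusion_map (F (merge_cut \<nu>' T)) (F (n - 1, T)) (incl M (n - 1) T \<nu>') \<and>
         FQ F M (n - 1) T (down (n - 1) \<nu> T) \<simeq>\<^sub>*
           pquot (F (n - 1, T)) (incl_im F M (n - 1) T \<nu>') \<and>
         (strongly_sequential l \<longrightarrow>
            pnull (F (merge_cut \<nu>' T)) (F (n - 1, T)) (incl M (n - 1) T \<nu>'))) \<and>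
      (strongly_sequential l \<longrightarrow>
         F (cut_of l) \<simeq>\<^sub>*
           wedge (smash (F (cut_of [1])) (F (cut_of (butlast l))))
                 (susp (smash (F (cut_of [1])) (F (cut_of \<mu>))))))"
proof -
  note rf = assms(1) and ones = assms(2)
  have l: "l \<noteq> []" "sorted l" "positive l"
    using assms(3) by (auto simp: sequential_def number_partition_def positive_def)
  have seq: "seqm (mset l)"
    by (rule sequential_imp_seqm[OF assms(3)])
  define I where "I = I_set l"
  have I: "is_I_set l I"
    unfolding I_def by (rule is_I_set_I_set[OF assms(4) l(3)])
  define c where "c = part l (length l)"
  have lc: "last l = c"
    using l(1) by (simp add: c_def part_def last_conv_nth)
  obtain rest k where lr: "l = rest @ replicate k c" and k: "k \<ge> 1" and less: "\<And>x. x \<in> set rest \<Longrightarrow> x < c"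
    using sorted_decompose[OF l(2,1)] unfolding lc by metis
  have pr: "seqm (mset (rest @ replicate k c))" "positive (rest @ replicate k c)"
    using seq l(3) unfolding lr[symmetric] by blast+
  have len: "length l = length rest + k"
    by (subst lr) simp
  have tail: "part l i = c" if "i \<in> {length rest + 1..length l}" for i
    using part_replicate_tail[of i rest k c] that len unfolding lr[symmetric] by simp
  have head: "part l i \<in> set rest" if "i \<in> {1..length rest}" for i
    using part_head[OF that, of "replicate k c"] unfolding lr[symmetric] .
  have "{i \<in> {1..length l}. part l i = part l (length l)} = {length rest + 1..length l}"
  proof (intro set_eqI iffI)
    fix i assume i: "i \<in> {i \<in> {1..length l}. part l i = part l (length l)}"
    then have "\<not> i \<le> length rest"
      using head[of i] less[of "part l i"] by (auto simp: c_def)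
    then show "i \<in> {length rest + 1..length l}"
      using i by auto
  next
    fix i assume "i \<in> {length rest + 1..length l}"
    then show "i \<in> {i \<in> {1..length l}. part l i = part l (length l)}"
      using tail[of i] by (auto simp: c_def)
  qed
  then have mm: "mm l = k"
    by (simp add: mm_def len)
  have c: "c > 0"
    by (rule M_pos[OF pr less k])
  have posr: "positive rest"
    by (rule pos_rest[OF pr less k])
  have Il: "I \<subseteq> {1..length l}" "card I \<ge> 2" "wt l I = c"
    using I by (auto simp: is_I_set_iff c_def)
  have finI: "finite I"
    using finite_subset[OF Il(1)] by simp
  \<comment> \<open>An index of weight \<open>c\<close> would exhaust the weight of \<open>I\<close>
    alone, although \<open>I\<close> has at least two elements; so \<open>I\<close> avoids the
    tail.\<close>
  have IN: "I \<subseteq> {1..length rest}"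
  proof
    fix i assume i: "i \<in> I"
    have "part l i \<noteq> c"
    proof
      assume "part l i = c"
      then have "{i} = I"
        using i Il by (intro wt_psubset[OF l(3) Il(1)]) auto
      then have "card I = card {i}"
        by simp
      then show False
        using Il(2) by simp
    qed
    then show "i \<in> {1..length rest}"
      using tail[of i] i Il(1) by (cases "i \<le> length rest") auto
  qed
  have ne: "rest \<noteq> []" "I \<noteq> {}"
    using IN Il(2) by auto
  have wI: "wt rest I = c"
    using wt_append(1)[OF IN, of "replicate k c"] Il(3) unfolding lr[symmetric] by simp
  have um: "unmergeable rest I"
  proof (rule unmergeable_I_set[of rest "replicate k c"])
    show "is_I_set (rest @ replicate k c) I" "sorted (rest @ replicate k c)"
      using I l(2) unfolding lr[symmetric] by blast+
    show "x < part (rest @ replicate k c) (length (rest @ replicate k c))" if "x \<in> set rest" for x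
      using less[OF that] unfolding lr[symmetric] by (simp add: c_def)
  qed (fact IN posr)+
  have "mm l \<ge> 2 \<Longrightarrow> pcontractible (F (cut_of l))"
    using contractible_mm[OF rf ones pr less] unfolding mm lr[symmetric] by blast
  moreover have "F (cut_of l) \<simeq>\<^sub>* smash (FQ F M (n - 1) T (down (n - 1) \<nu> T)) (F (cut_of [1])) \<and>
      (\<exists>\<nu>'\<in>OPt {1..n - 1}. set \<nu>' = \<nu> \<and>
         length \<nu>' = length \<mu> \<and>
         resonance (length \<mu>) (merge \<nu>' T) = resonance (length \<mu>) (S_vec \<mu>) \<and>
         inclusion_map (F (merge_cut \<nu>' T)) (F (n - 1, T)) (incl M (n - 1) T \<nu>') \<and>
         FQ F M (n - 1) T (down (n - 1) \<nu> T) \<simeq>\<^sub>*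
           pquot (F (n - 1, T)) (incl_im F M (n - 1) T \<nu>') \<and>
         (strongly_sequential l \<longrightarrow>
            pnull (F (merge_cut \<nu>' T)) (F (n - 1, T)) (incl M (n - 1) T \<nu>'))) \<and>
      (strongly_sequential l \<longrightarrow>
         F (cut_of l) \<simeq>\<^sub>*
           wedge (smash (F (cut_of [1])) (F (cut_of (butlast l))))
                 (susp (smash (F (cut_of [1])) (F (cut_of \<mu>)))))" if "mm l = 1"
  proof -
    let ?N = "length rest"
    have k1: "k = 1"
      using that mm by simp
    have l1: "l = rest @ [c]"
      using lr k1 by simp
    have bl: "butlast l = rest"
      unfolding l1 by simp
    have nN: "n - 1 = ?N" "length l = ?N + 1"
      using len k1 by (simp_all add: n_def)
    have T: "T = S_vec rest"
      by (simp add: T_def bl)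
    define \<nu>' where "\<nu>' = block_list ?N I"
    have \<nu>'1: "\<nu>' \<in> OPt {1..?N}"
      using block_list_OPt[OF IN ne(2)] by (simp add: \<nu>'_def)
    have \<nu>'2: "set \<nu>' = \<nu>"
      using block_list_OPt[OF IN ne(2)] nN by (simp add: \<nu>'_def \<nu>_def I_def)
    have \<nu>_eq: "\<nu> = one_block ?N I"
      using nN by (simp add: \<nu>_def I_def)
    \<comment> \<open>The last index of \<open>l\<close> carries \<open>c\<close>, and so does the
      merged block, which \<open>block_list\<close> puts last; hence the two lists agree literally,
      not only up to order.\<close>
    have \<mu>: "\<mu> = map (wt rest) \<nu>'"
    proof -
      have "{1..length l} - I = insert (?N + 1) ({1..?N} - I)"
        using IN nN(2) by auto
      moreover have "sorted_list_of_set (insert (?N + 1) ({1..?N} - I)) = sorted_list_of_set ({1..?N} - I) @ [?N + 1]"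
        by (rule sorted_list_of_set_snoc) auto
      moreover have "map (part l) (sorted_list_of_set ({1..?N} - I)) = map (part rest) (sorted_list_of_set ({1..?N} - I))"
        by (rule map_cong) (auto simp: l1 part_append)
      moreover have "part l (?N + 1) = c"
        by (simp add: l1 part_def)
      ultimately show ?thesis
        by (simp add: \<mu>_def \<nu>'_def map_wt_block_list wI flip: I_def)
    qed
    have cut: "T \<in> cuts ?N"
      unfolding T by (rule S_vec_in_cuts[OF posr])
    have N1: "1 \<le> ?N"
      using ne(1) by (simp add: Suc_le_eq)
    \<comment> \<open>Here \<open>k = 1\<close>, so merging \<open>I\<close> yields two copies of
      \<open>c\<close>, and \<open>contractible_mm\<close> provides the contractible
      subspace.\<close>
    have K: "F (cut_of l) \<simeq>\<^sub>* smash (FQ F M (n - 1) T (down (n - 1) \<nu> T)) (F (cut_of [1]))"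
    proof -
      let ?rest = "map (part rest) (sorted_list_of_set ({1..?N} - I))"
      have "x \<in> set rest" if "x \<in> set ?rest" for x
        using that part_in_set[of _ rest] by auto
      then have "pcontractible (F (cut_of (?rest @ replicate (Suc k) c)))"
        using seqm_merged[OF pr less k IN wI] pr(2) less k
        by (intro contractible_mm[OF rf ones]) (auto simp: positive_def simp del: replicate_Suc)
      from FQ_append_replicate[OF rf ones pr less k um wI this]
      show ?thesis
        unfolding nN(1) T \<nu>_eq l1 k1 by simp
    qed
    have null: "pnull (F (merge_cut \<nu>' T)) (F (?N, T)) (incl M ?N T \<nu>')"
      "F (cut_of l) \<simeq>\<^sub>* wedge (smash (F (cut_of [1])) (F (cut_of rest))) (susp (smash (F (cut_of [1])) (F (cut_of \<mu>))))"
      if strong: "strongly_sequential l"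
    proof -
      define q where "q = Max I"
      have q: "q \<in> I"
        unfolding q_def by (rule Max_in[OF finI ne(2)])
      have pq: "part l q = part rest q"
        using q IN by (auto simp: l1 part_append)
      obtain J where J: "J \<subseteq> I - {q}" "part l q = wt l J"
        using strong assms(4) by (auto simp: strongly_sequential_def Let_def wt_def q_def I_def)
      have JN: "J \<subseteq> {1..?N}"
        using J(1) IN by blast
      have wJ: "wt rest J = part rest q"
        using J(2) pq wt_append(1)[OF JN, of "[c]"] by (simp add: l1)
      have seqr: "seqm (mset rest)"
        by (rule seqm_mono[OF seq]) (simp add: l1)
      have sr: "sorted rest"
        using l(2) by (simp add: l1 sorted_append)
      have pI: "parts_of rest I = parts_of l I"
        unfolding parts_of_def using IN finI by (intro image_mset_cong) (auto simp: l1 part_append)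
      \<comment> \<open>Parts of \<open>rest\<close> are strictly below the largest part, so
        lexicographic maximality keeps the parts of \<open>I\<close> out of their
        representations.\<close>
      have avoid: "i \<notin># B" if "p \<in># mset rest" "part rest q < p" "B \<subseteq># mset rest - {#p#}" "\<Sum>\<^sub># B = p" "i \<in># parts_of rest I"
        for p B i
      proof (rule larger_parts_avoid_I_set[OF seq l(2,3) I])
        show "p \<in># mset l"
          using that(1) by (simp add: l1)
        show "part l (Max I) < p"
          using that(2) pq by (simp add: q_def)
        show "p < part l (length l)"
          using that(1) less by (auto simp: c_def)
        have "mset rest - {#p#} \<subseteq># mset l - {#p#}"
          using that(1) by (simp add: l1)
        then show "B \<subseteq># mset l - {#p#}"
          by (rule subset_mset.order_trans[OF that(3)])
      qed (use that pI in auto)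
      show "pnull (F (merge_cut \<nu>' T)) (F (?N, T)) (incl M ?N T \<nu>')"
        unfolding T \<nu>'_def
      proof (rule pnull_incl_strongly(1)[OF rf _ seqr posr sr IN q J(1) wJ])
      qed (fact ones avoid)+
      \<comment> \<open>Any number above the total weight of \<open>rest\<close> serves: such a part
        enters no relation.\<close>
      define W where "W = wt rest {1..?N} + 1"
      have W: "W > wt rest {1..?N}"
        by (simp add: W_def)
      have nullW: "pnull (F (merge_cut (\<nu>' @ [{?N + 1}]) (S_vec (rest @ [W])))) (F (?N + 1, S_vec (rest @ [W])))
        (incl M (?N + 1) (S_vec (rest @ [W])) (\<nu>' @ [{?N + 1}]))"
        unfolding \<nu>'_def
      proof (rule pnull_incl_strongly(2)[OF rf _ seqr posr sr IN q J(1) wJ])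
      qed (fact ones avoid W)+
      have "smash (FQ F M ?N (S_vec rest) (down ?N (set \<nu>') (S_vec rest))) (F (cut_of [1])) \<simeq>\<^sub>*
          wedge (smash (F (cut_of [1])) (F (cut_of rest))) (susp (smash (F (cut_of [1])) (F (cut_of (map (wt rest) \<nu>')))))"
      proof (rule FQ_smash_split[OF rf _ ne(1) posr \<nu>'1 W nullW])
      qed (fact ones)
      from pequiv_trans[OF K[unfolded nN(1) T, folded \<nu>'2] this]
      show "F (cut_of l) \<simeq>\<^sub>* wedge (smash (F (cut_of [1])) (F (cut_of rest))) (susp (smash (F (cut_of [1])) (F (cut_of \<mu>))))"
        unfolding \<mu> .
    qed
    have "merge \<nu>' T = S_vec \<mu>"
      unfolding T \<mu> by (rule merge_S_vec[OF \<nu>'1])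
    moreover have "length \<nu>' = length \<mu>"
      by (simp add: \<mu>)
    ultimately have "\<exists>\<nu>'\<in>OPt {1..n - 1}. set \<nu>' = \<nu> \<and>
         length \<nu>' = length \<mu> \<and>
         resonance (length \<mu>) (merge \<nu>' T) = resonance (length \<mu>) (S_vec \<mu>) \<and>
         inclusion_map (F (merge_cut \<nu>' T)) (F (n - 1, T)) (incl M (n - 1) T \<nu>') \<and>
         FQ F M (n - 1) T (down (n - 1) \<nu> T) \<simeq>\<^sub>*
           pquot (F (n - 1, T)) (incl_im F M (n - 1) T \<nu>') \<and>
         (strongly_sequential l \<longrightarrow>
            pnull (F (merge_cut \<nu>' T)) (F (n - 1, T)) (incl M (n - 1) T \<nu>'))"
      using A1_inclusion[OF rf N1 cut \<nu>'1] \<nu>'1 \<nu>'2 null(1) unfolding nN(1) by (intro bexI[of _ \<nu>']) auto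
    then show ?thesis
      using K null(2) unfolding bl by blast
  qed
  ultimately show ?thesis
    by blast
qed

end
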